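(* Let $N\geq1$, $p>1$ and $a,b\in\mathbb{R}$. Then for any $u\in C_0^\infty(\mathbb{R}^N\setminus\{0\})$, $$\left(\int_{\mathbb{R}^N}\frac{|\nabla u|^p}{|x|^{pb}}dx\right)^{\frac1p}\left(\int_{\mathbb{R}^N}\frac{|u|^p}{|x|^{pa}}dx\right)^{\frac{p-1}{p}}\geq\frac{|N-1-(p-1)a-b|}{p}\int_{\mathbb{R}^N}\frac{|u|^p}{|x|^{(p-1)a+b+1}}dx.$$ Also, (1) If $b+1-a>0$ and $b\leq\frac{N-p}{p}$, then the constant $\frac{N-1-(p-1)a-b}{p}$ is sharp and can be attained only by the functions of the form $u(x)=D\exp\left(\frac{t|x|^{b+1-a}}{b+1-a}\right)$, $t<0$. (2) If $b+1-a<0$ and $b\geq\frac{N-p}{p}$, then the constant $\frac{1+(p-1)a+b-N}{p}$ is sharp and can be attained only by the functions of the form $u(x)=D\exp\left(\frac{t|x|^{b+1-a}}{b+1-a}\right)$, $t>0$.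
   Context: $C_0^\infty(\mathbb{R}^N\setminus\{0\})$ is the space of real-valued smooth functions with compact support in $\mathbb{R}^N\setminus\{0\}$. "Sharp" means that the constant in the inequality cannot be replaced by a larger one. $D$ denotes a real constant.
   Formalization: For N=1, "attained only by" allows a different D on x>0 and on x<0: with a single D it is false, since an extremal restricted to one half-line also gives equality. Attainment is understood in the completion of the test functions, with equality of functions almost everywhere. *)

theory Defs
  imports "HOL-Analysis.Analysis"
begin

definition partial :: "'n::finite \<Rightarrow> (real^'n \<Rightarrow> real) \<Rightarrow> real^'n \<Rightarrow> real" where
  "partial i f x = frechet_derivative f (at x) (axis i 1)"

definition gradient :: "(real^'n::finite \<Rightarrow> real) \<Rightarrow> real^'n \<Rightarrow> real^'n" where
  "gradient f x = (\<chi> i. partial i f x)"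

text \<open>A function is smooth if all its iterated partial derivatives, of every order (order 0
  included), are everywhere differentiable, hence continuous.\<close>

definition smooth :: "(real^'n::finite \<Rightarrow> real) \<Rightarrow> bool" where
  "smooth f \<longleftrightarrow> (\<forall>is. fold partial is f differentiable_on UNIV)"

text \<open>For open \<open>\<Omega>\<close>, a smooth function with compact support in \<open>\<Omega>\<close> is identified with its
  extension by zero to the whole space, which is again smooth.\<close>

definition test_functions :: "(real^'n::finite) set \<Rightarrow> (real^'n \<Rightarrow> real) set" where
  "test_functions \<Omega> = {u. smooth u \<and> compact (closure (support_on UNIV u))
                          \<and> closure (support_on UNIV u) \<subseteq> \<Omega>}"

text \<open>The value of the integrand at the origin is a junk value on a null set.\<close>

definition weighted_integral ::
    "real \<Rightarrow> real \<Rightarrow> (real^'n::finite \<Rightarrow> 'b::real_normed_vector) \<Rightarrow> real" where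
  "weighted_integral p s f = (LINT x|lborel. norm (f x) powr p / norm x powr s)"

text \<open>The two sides of the inequality (without the constant). The gradient is a separate argument
  \<open>g\<close>, so that both sides also make sense for functions that are only weakly differentiable.\<close>

definition ckn_lhs ::
    "real \<Rightarrow> real \<Rightarrow> real \<Rightarrow> (real^'n::finite \<Rightarrow> real) \<Rightarrow> (real^'n \<Rightarrow> real^'n) \<Rightarrow> real" where
  "ckn_lhs p a b u g =
     weighted_integral p (p * b) g powr (1 / p) * weighted_integral p (p * a) u powr ((p - 1) / p)"

definition ckn_rhs :: "real \<Rightarrow> real \<Rightarrow> real \<Rightarrow> (real^'n::finite \<Rightarrow> real) \<Rightarrow> real" where
  "ckn_rhs p a b u = weighted_integral p ((p - 1) * a + b + 1) u"

text \<open>The dimension is passed as \<open>TYPE('n)\<close>, since the constant alone does not determine it.\<close>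

definition ckn_constant :: "real \<Rightarrow> real \<Rightarrow> real \<Rightarrow> real \<Rightarrow> ('n::finite) itself \<Rightarrow> bool" where
  "ckn_constant p a b C _ \<longleftrightarrow>
     (\<forall>u \<in> test_functions (- {0 :: real^'n}). ckn_lhs p a b u (gradient u) \<ge> C * ckn_rhs p a b u)"

definition ckn_sharp :: "real \<Rightarrow> real \<Rightarrow> real \<Rightarrow> real \<Rightarrow> ('n::finite) itself \<Rightarrow> bool" where
  "ckn_sharp p a b C N \<longleftrightarrow> ckn_constant p a b C N \<and> (\<forall>C' > C. \<not> ckn_constant p a b C' N)"

text \<open>The extremal functions do not have compact support in the punctured space. Attainment is
  therefore understood in the completion of the test functions under the norm
  \<open>(\<integral>|\<nabla>u|\<^sup>p/|x|\<^sup>p\<^sup>b + \<integral>|u|\<^sup>p/|x|\<^sup>p\<^sup>a)\<^sup>1\<^sup>/\<^sup>p\<close>, represented as the closure of the graph of the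
  gradient in the product of the two weighted \<open>L\<^sup>p\<close> spaces. Elements are pairs \<open>(u, g)\<close> with
  \<open>g\<close> the weak gradient of \<open>u\<close> on the punctured space; \<open>u\<close> determines \<open>g\<close> almost everywhere.
  The convergence is stated with extended nonnegative integrals, as Bochner integrals vanish on
  non-integrable functions.\<close>

definition ckn_space ::
    "real \<Rightarrow> real \<Rightarrow> real \<Rightarrow> ((real^'n::finite \<Rightarrow> real) \<times> (real^'n \<Rightarrow> real^'n)) set" where
  "ckn_space p a b = {(u, g).
     u \<in> borel_measurable lborel \<and> g \<in> borel_measurable lborel \<and>
     (\<exists>\<phi>. (\<forall>k::nat. \<phi> k \<in> test_functions (- {0})) \<and>
       (\<lambda>k. \<integral>\<^sup>+x. ennreal (\<bar>\<phi> k x - u x\<bar> powr p / norm x powr (p * a)) \<partial>lborel) \<longlonglongrightarrow> 0 \<and>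
       (\<lambda>k. \<integral>\<^sup>+x. ennreal (norm (gradient (\<phi> k) x - g x) powr p / norm x powr (p * b)) \<partial>lborel)
          \<longlonglongrightarrow> 0)}"

text \<open>Attainment of \<open>C\<close> by an element of the completion. Membership makes the two integrals on
  the left finite; the integrability condition does the same for the one on the right.\<close>

definition ckn_attains ::
    "real \<Rightarrow> real \<Rightarrow> real \<Rightarrow> real \<Rightarrow> (real^'n::finite \<Rightarrow> real) \<Rightarrow> (real^'n \<Rightarrow> real^'n) \<Rightarrow> bool" where
  "ckn_attains p a b C u g \<longleftrightarrow>
     (u, g) \<in> ckn_space p a b \<and>
     integrable lborel (\<lambda>x. \<bar>u x\<bar> powr p / norm x powr ((p - 1) * a + b + 1)) \<and>
     ckn_lhs p a b u g = C * ckn_rhs p a b u"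

definition ckn_profile :: "real \<Rightarrow> real \<Rightarrow> real \<Rightarrow> real^'n::finite \<Rightarrow> real" where
  "ckn_profile a b t x = exp (t * norm x powr (b + 1 - a) / (b + 1 - a))"

definition ae_multiple_on ::
    "(real^'n::finite) set \<Rightarrow> (real^'n \<Rightarrow> real) \<Rightarrow> (real^'n \<Rightarrow> real) \<Rightarrow> bool" where
  "ae_multiple_on S u v \<longleftrightarrow> (\<exists>D::real. AE x in lborel. x \<in> S \<longrightarrow> u x = D * v x)"

text \<open>\<open>u = D w\<close> almost everywhere, with one constant \<open>D\<close> in dimension at least 2. On the line the
  punctured space is disconnected and the two half-lines do not interact: for an extremal
  \<open>w\<close>, the function equal to \<open>w\<close> on one half-line and to \<open>0\<close> on the other also
  lies in the completion and attains equality. In dimension 1 there is therefore one constant for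
  each half-line.\<close>

definition multiple_of_profile :: "(real^'n::finite \<Rightarrow> real) \<Rightarrow> (real^'n \<Rightarrow> real) \<Rightarrow> bool" where
  "multiple_of_profile u w \<longleftrightarrow>
     (if CARD('n) \<ge> 2 then ae_multiple_on UNIV u w
      else \<forall>H \<in> components (- {0}). ae_multiple_on H u w)"

end

theory Submission
  imports Defs
begin

text \<open>
  Write \<open>\<gamma> = (p - 1) a + b + 1\<close>, \<open>\<beta> = b + 1 - a\<close> and \<open>q = p (b + 1)\<close>. Everything rests on two facts.

  \<^item> Comparing \<open>\<integral> |u|\<^sup>p / |x|\<^sup>\<gamma>\<close> with the same integral for a dilate of \<open>u\<close> gives an identity that
    only involves the radial derivative (\<open>radial_identity\<close>):
    \<open>(\<gamma> - N) \<integral> |u|\<^sup>p / |x|\<^sup>\<gamma> = p \<integral> |u|\<^sup>p\<^sup>-\<^sup>2 u (x \<bullet> \<nabla>u) / |x|\<^sup>\<gamma>\<close>.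
  \<^item> The integrand on the right is in absolute value at most \<open>(|u| / |x|\<^sup>a)\<^sup>p\<^sup>-\<^sup>1\<close> times \<open>|\<nabla>u| / |x|\<^sup>b\<close>. Young's
    inequality with a free real parameter \<open>t\<close> bounds its product with \<open>p |t|\<^sup>p\<^sup>-\<^sup>2 t\<close> by
    \<open>|\<nabla>u|\<^sup>p / |x|\<^sup>p\<^sup>b + (p - 1) |t|\<^sup>p |u|\<^sup>p / |x|\<^sup>p\<^sup>a\<close>; the difference of the two sides,
    \<open>young_gap\<close>, is nonnegative and vanishes exactly if \<open>\<nabla>u = t |x|\<^sup>\<beta>\<^sup>-\<^sup>2 u x\<close>, the differential
    equation of the profile \<open>exp (t |x|\<^sup>\<beta> / \<beta>)\<close>.

  Integrating the gap and optimising in \<open>|t|\<close> yields the inequality (\<open>ckn_inequality\<close>).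

  The cases (1) and (2) are the two signs of \<open>\<beta>\<close> in the single hypothesis \<open>\<beta> (N - q) \<ge> 0\<close> with
  \<open>\<beta> \<noteq> 0\<close>, and admissible parameters are those with \<open>t \<beta> < 0\<close>. Since
  \<open>N - p a = (N - q) + p \<beta>\<close> and \<open>N - \<gamma> = (N - q) + (p - 1) \<beta>\<close>, all relevant exponents lie on the
  same side of \<open>N\<close>, where the profile has finite weighted norms, and \<open>N - \<gamma>\<close> has the sign of \<open>\<beta>\<close>,
  which makes the constant of each case equal to \<open>|N - \<gamma>| / p\<close>.

  Attainment: the profile is cut off in the variable \<open>ln |x|\<close> at scale \<open>k\<close>. The gradient of the cutoff
  is at most \<open>const / (k |x|)\<close> and costs \<open>k\<^sup>-\<^sup>p \<integral> w\<^sup>p / |x|\<^sup>q\<close> over the annulus \<open>|ln |x|| \<le> k\<close>. As \<open>q\<close>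
  lies between \<open>N\<close> and \<open>p a\<close>, this integral grows at most linearly in \<open>k\<close>, and \<open>p > 1\<close> makes the
  cost vanish, also in the critical case \<open>q = N\<close> (\<open>ckn_space_ckn_profile\<close>). Equality for the profile
  is the dilation identity again.

  Sharpness and uniqueness: inequalities whose integrand is nonnegative and continuous in
  \<open>(u, \<nabla>u)\<close> pass from test functions to the completion by Fatou's lemma
  (\<open>ckn_space_closure\<close>). Hence a larger constant would contradict equality for the profile, and an
  extremal pair \<open>(u, g)\<close> has vanishing gap almost everywhere for the optimal \<open>t\<close>. Then the quotient of
  \<open>u\<close> by the profile is an \<open>L\<^sup>1\<close>-limit, locally, of smooth functions whose gradients tend to \<open>0\<close>, so it is
  constant on every connected open set that avoids the origin (\<open>ckn_space_multiple_on\<close>).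
\<close>

section \<open>Radial integrals and dilations\<close>

text \<open>Both sides are integrals of \<open>f\<close> over the half-line, against the image of Lebesgue measure under the
  norm and against the density \<open>n \<omega> r\<^sup>n\<^sup>-\<^sup>1\<close>; the two measures agree on the half-lines up to \<open>r\<close> because a ball
  of radius \<open>r\<close> has volume \<open>\<omega> r\<^sup>n\<close>.\<close>

lemma nn_integral_radial:
  fixes f :: "real \<Rightarrow> ennreal"
  assumes [measurable]: "f \<in> borel_measurable borel"
  defines "n \<equiv> DIM('a::euclidean_space)"
  shows "(\<integral>\<^sup>+x. f (norm (x::'a)) \<partial>lborel) =
    (\<integral>\<^sup>+r. ennreal (n * unit_ball_vol n * r ^ (n - 1)) * indicator {0..} r * f r \<partial>lborel)"
proof -
  have n: "n > 0" by (simp add: n_def)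
  define \<rho> where "\<rho> r = ennreal (n * unit_ball_vol n * r ^ (n - 1)) * indicator {0..} r" for r :: real
  have [measurable]: "\<rho> \<in> borel_measurable borel" unfolding \<rho>_def by measurable
  have ball: "emeasure (distr lborel borel (norm :: 'a \<Rightarrow> real)) {..r}
      = ennreal (if r \<ge> 0 then unit_ball_vol n * r ^ n else 0)" for r
  proof -
    have "(norm :: 'a \<Rightarrow> real) -` {..r} \<inter> space lborel = cball 0 r" by auto
    then show ?thesis
      by (subst emeasure_distr) (auto simp: emeasure_cball n_def)
  qed
  have dens: "emeasure (density lborel \<rho>) {..r} = ennreal
      (if r \<ge> 0 then unit_ball_vol n * r ^ n else 0)" for r
  proof (cases "r \<ge> 0")
    case True
    have "emeasure (density lborel \<rho>) {..r} = (\<integral>\<^sup>+x. ennreal (n * unit_ball_vol n * x ^ (n - 1))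
        * indicator {0..r} x \<partial>lborel)"
      by (subst emeasure_density) (auto intro!: nn_integral_cong simp: \<rho>_def split: split_indicator)
    also have "\<dots> = ennreal (unit_ball_vol n * r ^ n - unit_ball_vol n * 0 ^ n)"
      using True n by (intro nn_integral_FTC_Icc)
        (auto intro!: derivative_eq_intros mult_nonneg_nonneg simp: field_simps)
    finally show ?thesis using True n by simp
  next
    case False
    then have "(\<integral>\<^sup>+x. \<rho> x * indicator {..r} x \<partial>lborel) = (\<integral>\<^sup>+x. 0 \<partial>(lborel::real measure))"
      by (intro nn_integral_cong) (auto simp: \<rho>_def split: split_indicator)
    with False show ?thesis by (subst emeasure_density) auto
  qed
  have "distr lborel borel (norm :: 'a \<Rightarrow> real) = density lborel \<rho>"
  proof (rule measure_eqI_generator_eq[where E = "range atMost" and \<Omega> = UNIV and A = "\<lambda>i. {..real i}"])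
    show "Int_stable (range (atMost :: real \<Rightarrow> _))"
      by (auto simp: Int_stable_def intro: range_eqI[where x = "min _ _"])
    show "sets (distr lborel borel norm) = sigma_sets UNIV (range (atMost :: real \<Rightarrow> _))"
      by (simp add: borel_eq_atMost image_def)
    then show "sets (density lborel \<rho>) = sigma_sets UNIV (range atMost)"
      by simp
    show "(\<Union>i. {..real i}) = UNIV"
      using real_arch_simple by auto
  qed (auto simp: ball dens)
  then have "(\<integral>\<^sup>+r. f r \<partial>distr lborel borel (norm :: 'a \<Rightarrow> real)) = (\<integral>\<^sup>+r. f r \<partial>density lborel \<rho>)"
    by simp
  then show ?thesis
    by (simp add: nn_integral_distr nn_integral_density \<rho>_def)
qed

lemma nn_integral_dilation:
  fixes f :: "'a::euclidean_space \<Rightarrow> ennreal"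
  assumes [measurable]: "f \<in> borel_measurable borel" and s: "s > 0"
  shows "(\<integral>\<^sup>+x. f (s *\<^sub>R x) \<partial>lborel) = ennreal (1 / s ^ DIM('a)) * (\<integral>\<^sup>+x. f x \<partial>lborel)"
proof -
  have "(\<integral>\<^sup>+x. f x \<partial>lborel) = (\<integral>\<^sup>+x. f x \<partial>density (distr lborel borel (\<lambda>x. 0 + s *\<^sub>R x))
      (\<lambda>_. ennreal (\<bar>s\<bar> ^ DIM('a))))"
    using lborel_affine[of s "0::'a"] s by simp
  also have "\<dots> = ennreal (s ^ DIM('a)) * (\<integral>\<^sup>+x. f (s *\<^sub>R x) \<partial>lborel)"
    using s by (simp add: nn_integral_density nn_integral_distr nn_integral_cmult)
  finally show ?thesis
    using s by (simp add: mult.assoc[symmetric] ennreal_mult[symmetric])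
qed

lemma has_bochner_integral_dilation:
  fixes f :: "'a::euclidean_space \<Rightarrow> real"
  assumes f: "integrable lborel f" and s: "s > 0"
  shows "has_bochner_integral lborel (\<lambda>x. f (s *\<^sub>R x)) ((\<integral>x. f x \<partial>lborel) / s ^ DIM('a))"
proof -
  have [measurable]: "f \<in> borel_measurable borel" using f by auto
  have "(\<integral>\<^sup>+x. ennreal (norm (f x)) \<partial>lborel) < \<infinity>" using f by (simp add: integrable_iff_bounded)
  then have "(\<integral>\<^sup>+x. ennreal (norm (f (s *\<^sub>R x))) \<partial>lborel) < \<infinity>"
    using s by (subst nn_integral_dilation) (auto simp: ennreal_mult_less_top)
  then have i: "integrable lborel (\<lambda>x. f (s *\<^sub>R x))" by (simp add: integrable_iff_bounded)
  have "(\<integral>x. f x \<partial>lborel) = (\<integral>x. f x \<partial>density (distr lborel borel (\<lambda>x. 0 + s *\<^sub>R x))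
      (\<lambda>_. ennreal (\<bar>s\<bar> ^ DIM('a))))"
    using lborel_affine[of s "0::'a"] s by simp
  also have "\<dots> = s ^ DIM('a) * (\<integral>x. f (s *\<^sub>R x) \<partial>lborel)"
    using s by (subst integral_density) (auto simp: integral_distr)
  finally show ?thesis using s i by (simp add: has_bochner_integral_iff)
qed

text \<open>Integration by parts against the field \<open>x\<close>, without a divergence theorem: for
  \<open>h x = x \<bullet> \<nabla>f x\<close> one has \<open>f (2 x) - f x = \<integral> h (s x) / s ds\<close> over \<open>1 \<le> s \<le> 2\<close>, and
  integrating in \<open>x\<close> turns every dilation into an explicit power of \<open>s\<close>.\<close>

lemma dilation_identity:
  fixes f h :: "'a::euclidean_space \<Rightarrow> real"
  assumes f: "integrable lborel f" and h: "integrable lborel h"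
    and cont: "continuous_on (- {0}) h"
    and deriv: "\<And>x. x \<noteq> 0 \<Longrightarrow> ((\<lambda>s. f (s *\<^sub>R x)) has_real_derivative h x) (at 1)"
  shows "(\<integral>x. h x \<partial>lborel) = - DIM('a) * (\<integral>x. f x \<partial>lborel)"
proof -
  let ?n = "DIM('a)"
  have [measurable]: "f \<in> borel_measurable borel" "h \<in> borel_measurable borel"
    using f h by auto
  define H where "H z = indicator {1..2} (fst z) * (h (fst z *\<^sub>R snd z) / fst z)" for z :: "real \<times> 'a"
  have [measurable]: "H \<in> borel_measurable (lborel \<Otimes>\<^sub>M lborel)"
    unfolding H_def by measurable
  have slice: "has_bochner_integral lborel (\<lambda>x. H (s, x))
      (indicator {1..2} s * ((\<integral>x. h x \<partial>lborel) / s ^ Suc ?n))" for s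
  proof (cases "s \<in> {1..2}")
    case True
    have "has_bochner_integral lborel (\<lambda>x. h (s *\<^sub>R x) / s) ((\<integral>x. h x \<partial>lborel) / s ^ ?n / s)"
      using True by (intro has_bochner_integral_divide_zero has_bochner_integral_dilation h) auto
    then show ?thesis using True by (simp add: H_def field_simps)
  next
    case False
    then show ?thesis by (simp add: H_def has_bochner_integral_zero)
  qed
  have slice_norm: "(\<integral>x. norm (H (s, x)) \<partial>lborel) = indicator {1..2} s
      * ((\<integral>x. \<bar>h x\<bar> \<partial>lborel) / s ^ Suc ?n)" for s
  proof (cases "s \<in> {1..2}")
    case True
    have "has_bochner_integral lborel (\<lambda>x. \<bar>h (s *\<^sub>R x)\<bar> / s) ((\<integral>x. \<bar>h x\<bar> \<partial>lborel) / s ^ ?n / s)"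
      using True h by (intro has_bochner_integral_divide_zero has_bochner_integral_dilation) auto
    then show ?thesis using True by (simp add: H_def field_simps has_bochner_integral_iff)
  next
    case False
    then show ?thesis by (simp add: H_def)
  qed
  have pow: "has_bochner_integral lborel (\<lambda>s. c / s ^ Suc ?n * indicator {1..2} s)
      (- c / ?n / 2 ^ ?n - - c / ?n / 1 ^ ?n)" for c :: real
  proof (rule has_bochner_integral_FTC_Icc_real)
    fix s :: real assume s: "1 \<le> s"
    have n: "s ^ (?n - 1) * s = s ^ ?n" using power_minus_mult[of ?n s] by simp
    show "((\<lambda>s. - c / ?n / s ^ ?n) has_real_derivative c / s ^ Suc ?n) (at s)"
      by (rule derivative_eq_intros refl)+ (use s n in \<open>simp_all add: field_simps\<close>)
    show "isCont (\<lambda>s. c / s ^ Suc ?n) s" using s by (intro continuous_intros) auto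
  qed simp
  have int: "integrable (lborel \<Otimes>\<^sub>M lborel) H"
  proof (rule lborel_pair.Fubini_integrable)
    show "integrable lborel (\<lambda>s. \<integral>x. norm (H (s, x)) \<partial>lborel)"
      unfolding slice_norm using pow[of "\<integral>x. \<bar>h x\<bar> \<partial>lborel"]
          by (simp add: has_bochner_integral_iff mult.commute)
    show "AE s in lborel. integrable lborel (\<lambda>x. H (s, x))"
      using slice by (auto simp: has_bochner_integral_iff)
  qed simp
  have "(\<integral>s. (\<integral>x. H (s, x) \<partial>lborel) \<partial>lborel) = (\<integral>x. h x \<partial>lborel) / ?n * (1 - 1 / 2 ^ ?n)"
    using slice pow[of "\<integral>x. h x \<partial>lborel"]
    by (simp add: has_bochner_integral_iff mult.commute diff_divide_distrib right_diff_distrib)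
  moreover have "(\<integral>x. (\<integral>s. H (s, x) \<partial>lborel) \<partial>lborel) = (\<integral>x. f (2 *\<^sub>R x) - f x \<partial>lborel)"
  proof (intro integral_cong_AE)
    have "AE x in lborel. x \<noteq> (0::'a)" by (rule AE_lborel_singleton)
    then show "AE x in lborel. (\<integral>s. H (s, x) \<partial>lborel) = f (2 *\<^sub>R x) - f x"
    proof eventually_elim
      fix x :: 'a assume x: "x \<noteq> 0"
      have "(\<integral>s. (h (s *\<^sub>R x) / s) * indicator {1..2} s \<partial>lborel) = f (2 *\<^sub>R x) - f (1 *\<^sub>R x)"
      proof (rule integral_FTC_Icc_real)
        fix s :: real assume s: "1 \<le> s"
        have "((\<lambda>r. f ((r / s) *\<^sub>R (s *\<^sub>R x))) has_real_derivative h (s *\<^sub>R x) * (1 / s)) (at s)"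
          by (rule DERIV_chain2[where f = "\<lambda>r. f (r *\<^sub>R (s *\<^sub>R x))" and g = "\<lambda>r. r / s"])
            (use s deriv[of "s *\<^sub>R x"] x in \<open>auto intro!: derivative_eq_intros\<close>)
        then show "((\<lambda>s. f (s *\<^sub>R x)) has_real_derivative h (s *\<^sub>R x) / s) (at s)"
          using s by simp
        have "isCont h (s *\<^sub>R x)" using s x cont by (simp add: continuous_on_eq_continuous_at open_Compl)
        then have "isCont (\<lambda>s. h (s *\<^sub>R x)) s"
          by (rule isCont_o2[rotated]) (intro continuous_intros)
        then show "isCont (\<lambda>s. h (s *\<^sub>R x) / s) s" using s by (intro continuous_intros) auto
      qed simp
      then show "(\<integral>s. H (s, x) \<partial>lborel) = f (2 *\<^sub>R x) - f x" by (simp add: H_def mult.commute)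
    qed
  qed measurable
  moreover have "(\<integral>s. (\<integral>x. H (s, x) \<partial>lborel) \<partial>lborel) = (\<integral>x. (\<integral>s. H (s, x) \<partial>lborel) \<partial>lborel)"
    using lborel_pair.Fubini_integral[of "\<lambda>s x. H (s, x)"] int by simp
  moreover have "(\<integral>x. f (2 *\<^sub>R x) - f x \<partial>lborel) = - (\<integral>x. f x \<partial>lborel) * (1 - 1 / 2 ^ ?n)"
    using has_bochner_integral_dilation[OF f, of 2] f
    by (simp add: has_bochner_integral_iff algebra_simps)
  ultimately have "(\<integral>x. h x \<partial>lborel) / ?n * (1 - 1 / 2 ^ ?n) = - (\<integral>x. f x \<partial>lborel) * (1 - 1 / 2 ^ ?n)"
    by simp
  moreover have "(1::real) < 2 ^ ?n" by (rule one_less_power) auto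
  then have "2 ^ ?n \<noteq> (1::real)" by (metis less_irrefl)
  then have "1 - 1 / 2 ^ ?n \<noteq> (0::real)" by (simp add: field_simps)
  ultimately have "(\<integral>x. h x \<partial>lborel) / ?n = - (\<integral>x. f x \<partial>lborel)"
    by (metis mult_right_cancel)
  then show ?thesis by (simp add: field_simps)
qed

section \<open>Young's inequality and signed powers\<close>

lemma powr_gt_tangent:
  fixes r p :: real
  assumes "p > 1" "r \<ge> 0" "r \<noteq> 1"
  shows "1 + p * (r - 1) < r powr p"
proof -
  have D: "((\<lambda>x. x powr p) has_real_derivative p * x powr (p - 1)) (at x)" if "x > 0" for x :: real
    using that by (auto intro!: derivative_eq_intros)
  consider "r = 0" | "0 < r" "r < 1" | "r > 1" using assms by linarith
  then show ?thesis
  proof cases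
    case 1
    with assms show ?thesis by simp
  next
    case 2
    obtain z where z: "r < z" "z < 1" "1 powr p - r powr p = (1 - r) * (p * z powr (p - 1))"
      using MVT2[of r 1 "\<lambda>x. x powr p" "\<lambda>x. p * x powr (p - 1)"] D 2 by auto
    have "z powr (p - 1) < 1 powr (p - 1)" using z 2 assms by (intro powr_less_mono2) auto
    then have "(1 - r) * (p * z powr (p - 1)) < (1 - r) * p" using 2 assms by simp
    with z show ?thesis by (simp add: algebra_simps)
  next
    case 3
    obtain z where z: "1 < z" "z < r" "r powr p - 1 powr p = (r - 1) * (p * z powr (p - 1))"
      using MVT2[of 1 r "\<lambda>x. x powr p" "\<lambda>x. p * x powr (p - 1)"] D 3 by auto
    have "1 powr (p - 1) < z powr (p - 1)" using z 3 assms by (intro powr_less_mono2) auto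
    then have "(r - 1) * p < (r - 1) * (p * z powr (p - 1))" using 3 assms by simp
    with z show ?thesis by (simp add: algebra_simps)
  qed
qed

text \<open>Young's inequality in the homogeneous form obtained from the tangent of \<open>r\<^sup>p\<close> at \<open>1\<close> with
  \<open>r = y / x\<close>; strictness is what later identifies the extremals.\<close>

lemma young_powr_strict:
  fixes x y p :: real
  assumes "p > 1" "x \<ge> 0" "y \<ge> 0" "x \<noteq> y"
  shows "p * (x powr (p - 1) * y) < y powr p + (p - 1) * x powr p"
proof (cases "x = 0")
  case True
  with assms show ?thesis by simp
next
  case False
  then have x: "x > 0" using assms by simp
  have "1 + p * (y / x - 1) < (y / x) powr p"
    using assms x by (intro powr_gt_tangent) (auto simp: field_simps)
  then have "x powr p * (1 + p * (y / x - 1)) < x powr p * (y / x) powr p"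
    using x by simp
  moreover have "x powr p * (y / x) powr p = y powr p"
    using x assms by (simp add: powr_divide)
  moreover have "x powr p * (1 + p * (y / x - 1)) = p * (x powr (p - 1) * y) - (p - 1) * x powr p"
    using x by (simp add: powr_diff field_simps)
  ultimately show ?thesis by linarith
qed

lemma young_powr:
  fixes x y p :: real
  assumes "p > 1" "x \<ge> 0" "y \<ge> 0"
  shows "p * (x powr (p - 1) * y) \<le> y powr p + (p - 1) * x powr p"
proof (cases "x = y")
  case True
  then show ?thesis using assms powr_mult_base[of y "p - 1"] by (simp add: algebra_simps)
next
  case False
  then show ?thesis using young_powr_strict[OF assms] by simp
qed

text \<open>For \<open>q = p - 1\<close> this is \<open>|s|\<^sup>p\<^sup>-\<^sup>2 s\<close>, the derivative of \<open>|s|\<^sup>p / p\<close>, in a form that stays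
  meaningful and continuous at \<open>s = 0\<close> when \<open>p < 2\<close>.\<close>

definition signed_powr :: "real \<Rightarrow> real \<Rightarrow> real" where
  "signed_powr s q = sgn s * \<bar>s\<bar> powr q"

lemma continuous_signed_powr [continuous_intros]:
  assumes "q > 0" and "continuous_on S f"
  shows "continuous_on S (\<lambda>x. signed_powr (f x) q)"
proof -
  have "signed_powr s q = max s 0 powr q - max (- s) 0 powr q" for s
    by (auto simp: signed_powr_def max_def sgn_if)
  then show ?thesis
    using assms by (auto intro!: continuous_intros continuous_on_powr')
qed

lemma measurable_signed_powr [measurable]: "(\<lambda>s. signed_powr s q) \<in> borel_measurable borel"
  unfolding signed_powr_def by measurable

lemma abs_powr_has_derivative:
  assumes "p > 1"
  shows "((\<lambda>s. \<bar>s\<bar> powr p) has_real_derivative p * signed_powr s (p - 1)) (at s)"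
proof -
  consider "s = 0" | "s > 0" | "s < 0" by linarith
  then show ?thesis
  proof cases
    case 1
    have "continuous_on UNIV (\<lambda>h. signed_powr h (p - 1))"
      using assms by (intro continuous_intros) auto
    then have "isCont (\<lambda>h. signed_powr h (p - 1)) 0" by (simp add: continuous_on_eq_continuous_at)
    then have "((\<lambda>h. signed_powr h (p - 1)) \<longlongrightarrow> 0) (at 0)"
      by (simp add: isCont_def signed_powr_def)
    moreover have "\<bar>h\<bar> powr p / h = signed_powr h (p - 1)" for h
      by (auto simp: signed_powr_def powr_diff sgn_if)
    ultimately have "((\<lambda>h. \<bar>h\<bar> powr p / h) \<longlongrightarrow> 0) (at 0)" by presburger
    then show ?thesis using 1 by (simp add: DERIV_def signed_powr_def)
  next
    case 2
    have "((\<lambda>s. s powr p) has_real_derivative p * signed_powr s (p - 1)) (at s)"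
      using 2 by (auto intro!: derivative_eq_intros simp: signed_powr_def)
    then show ?thesis
      by (rule has_field_derivative_transform_within_open[where S = "{0<..}"]) (use 2 in auto)
  next
    case 3
    have "((\<lambda>s. (- s) powr p) has_real_derivative p * signed_powr s (p - 1)) (at s)"
      using 3 by (auto intro!: derivative_eq_intros simp: signed_powr_def)
    then show ?thesis
      by (rule has_field_derivative_transform_within_open[where S = "{..<0}"]) (use 3 in auto)
  qed
qed

section \<open>Gradients and test functions\<close>

lemma gradient_eqI:
  assumes "(f has_derivative (\<lambda>h. v \<bullet> h)) (at x)"
  shows "gradient f x = v"
proof -
  have "frechet_derivative f (at x) = (\<lambda>h. v \<bullet> h)"
    using frechet_derivative_at[OF assms] by (rule sym)
  then show ?thesis by (simp add: gradient_def partial_def vec_eq_iff inner_axis)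
qed

lemma has_derivative_gradient:
  fixes f :: "real^'n::finite \<Rightarrow> real"
  assumes "f differentiable (at x)"
  shows "(f has_derivative (\<lambda>h. gradient f x \<bullet> h)) (at x)"
proof -
  let ?f' = "frechet_derivative f (at x)"
  have D: "(f has_derivative ?f') (at x)" using assms frechet_derivative_works by blast
  then interpret linear ?f' by (rule has_derivative_linear)
  have "?f' = (\<lambda>h. gradient f x \<bullet> h)"
  proof
    fix h :: "real^'n"
    have "h = (\<Sum>i\<in>UNIV. h $ i *\<^sub>R axis i 1)"
      using basis_expansion[of h] by (simp add: scalar_mult_eq_scaleR)
    then have "?f' h = ?f' (\<Sum>i\<in>UNIV. h $ i *\<^sub>R axis i 1)" by (rule arg_cong)
    also have "\<dots> = gradient f x \<bullet> h"
      by (simp add: sum scale inner_vec_def gradient_def partial_def mult.commute)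
    finally show "?f' h = gradient f x \<bullet> h" .
  qed
  with D show ?thesis by simp
qed

lemma
  fixes u :: "real^'n::finite \<Rightarrow> real"
  assumes "smooth u"
  shows smooth_has_derivative: "(u has_derivative (\<lambda>h. gradient u x \<bullet> h)) (at x)"
    and smooth_continuous: "continuous_on S u"
    and smooth_continuous_gradient: "continuous_on S (gradient u)"
proof -
  have D: "fold partial is u differentiable_on UNIV" for "is" using assms unfolding smooth_def by blast
  show "(u has_derivative (\<lambda>h. gradient u x \<bullet> h)) (at x)"
    using D[of "[]"] by (intro has_derivative_gradient) (simp add: differentiable_on_def)
  show "continuous_on S u"
    using differentiable_imp_continuous_on[OF D[of "[]"]] continuous_on_subset by auto
  have "continuous_on UNIV (partial i u)" for i
    using differentiable_imp_continuous_on[OF D[of "[i]"]] by simp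
  then show "continuous_on S (gradient u)"
    unfolding gradient_def by (intro continuous_intros) (auto intro: continuous_on_subset)
qed

lemma test_function_support:
  assumes "u \<in> test_functions (- {0 :: real^'n::finite})"
  obtains K where "compact K" "0 \<notin> K" "\<And>x. x \<notin> K \<Longrightarrow> u x = 0" "\<And>x. x \<notin> K \<Longrightarrow> gradient u x = 0"
proof
  let ?K = "closure (support_on UNIV u)"
  show "compact ?K" "0 \<notin> ?K" using assms by (auto simp: test_functions_def)
  show z: "u x = 0" if "x \<notin> ?K" for x
    using that closure_subset[of "support_on UNIV u"] by (auto simp: support_on_def)
  show "gradient u x = 0" if "x \<notin> ?K" for x
  proof (rule gradient_eqI)
    have "((\<lambda>_. 0::real) has_derivative (\<lambda>h. 0 \<bullet> h)) (at x)" by simp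
    then show "(u has_derivative (\<lambda>h. 0 \<bullet> h)) (at x)"
      by (rule has_derivative_transform_within_open[where s = "- ?K"]) (use that z in auto)
  qed
qed

lemma integrable_continuous_compact_support:
  fixes f :: "'a::euclidean_space \<Rightarrow> real"
  assumes "compact K" "continuous_on K f" "\<And>x. x \<notin> K \<Longrightarrow> f x = 0"
  shows "integrable lborel f"
proof -
  have "integrable lborel (\<lambda>x. indicator K x *\<^sub>R f x)" using assms by (intro borel_integrable_compact)
  also have "(\<lambda>x. indicator K x *\<^sub>R f x) = f" by (rule ext) (use assms in \<open>auto simp: indicator_def\<close>)
  finally show ?thesis .
qed

section \<open>The identity for the radial derivative and the inequality\<close>

text \<open>The dilation identity for \<open>|u|\<^sup>p / |x|\<^sup>s\<close>. It is stated for functions that are differentiable off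
  the origin only, so that it applies to test functions and to the profiles alike.\<close>

lemma radial_identity:
  fixes u :: "'a::euclidean_space \<Rightarrow> real" and p s :: real
  assumes p: "p > 1"
    and deriv: "\<And>x. x \<noteq> 0 \<Longrightarrow> (u has_derivative (\<lambda>h. g x \<bullet> h)) (at x)"
    and cont: "continuous_on (- {0}) g"
    and int: "integrable lborel (\<lambda>x. \<bar>u x\<bar> powr p / norm x powr s)"
      "integrable lborel (\<lambda>x. signed_powr (u x) (p - 1) * (x \<bullet> g x) / norm x powr s)"
  shows "p * (\<integral>x. signed_powr (u x) (p - 1) * (x \<bullet> g x) / norm x powr s \<partial>lborel)
    = (s - DIM('a)) * (\<integral>x. \<bar>u x\<bar> powr p / norm x powr s \<partial>lborel)"
proof -
  let ?f = "\<lambda>x. \<bar>u x\<bar> powr p / norm x powr s"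
  let ?g = "\<lambda>x. signed_powr (u x) (p - 1) * (x \<bullet> g x) / norm x powr s"
  have u: "continuous_on (- {0}) u"
    using deriv by (intro continuous_at_imp_continuous_on ballI has_derivative_continuous) auto
  have "(\<integral>x. p * ?g x - s * ?f x \<partial>lborel) = - DIM('a) * (\<integral>x. ?f x \<partial>lborel)"
  proof (rule dilation_identity)
    show "continuous_on (- {0}) (\<lambda>x. p * ?g x - s * ?f x)"
    proof -
      have c1: "continuous_on (- {0}) (\<lambda>x. \<bar>u x\<bar> powr p)"
        using p by (intro continuous_on_powr' continuous_intros u) auto
      have c2: "continuous_on (- {0}) (\<lambda>x. signed_powr (u x) (p - 1))"
        using p by (intro continuous_intros u) auto
      have c3: "continuous_on (- {0}) (\<lambda>x::'a. norm x powr s)"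
        by (intro continuous_intros) auto
      show ?thesis
        by (intro continuous_on_diff continuous_on_mult continuous_on_divide continuous_on_const
            continuous_on_inner continuous_on_id c1 c2 c3 cont) auto
    qed
    fix x :: 'a assume x: "x \<noteq> 0"
    have "((\<lambda>r. u (r *\<^sub>R x)) has_derivative (\<lambda>h. g (1 *\<^sub>R x) \<bullet> (h *\<^sub>R x))) (at 1)"
      by (rule has_derivative_compose[OF bounded_linear_imp_has_derivative[OF
          bounded_linear_scaleR_left] deriv])
        (use x in simp)
    then have *: "((\<lambda>r. u (r *\<^sub>R x)) has_real_derivative (x \<bullet> g x)) (at 1)"
      by (simp add: has_field_derivative_def inner_commute mult_commute_abs)
    have "((\<lambda>r. \<bar>u (r *\<^sub>R x)\<bar> powr p) has_real_derivative (p * signed_powr (u (1 *\<^sub>R x)) (p - 1))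
        * (x \<bullet> g x)) (at 1)"
      by (rule DERIV_chain2[OF abs_powr_has_derivative[OF p] *])
    moreover have "((\<lambda>r. norm (r *\<^sub>R x) powr - s) has_real_derivative - s * norm x powr - s) (at 1)"
    proof -
      have "((\<lambda>r. r powr - s * norm x powr - s) has_real_derivative - s * norm x powr - s) (at 1)"
        by (auto intro!: derivative_eq_intros)
      then show ?thesis
        by (rule has_field_derivative_transform_within_open[where S = "{0<..}"]) (auto simp: powr_mult)
    qed
    ultimately have "((\<lambda>r. \<bar>u (r *\<^sub>R x)\<bar> powr p * norm (r *\<^sub>R x) powr - s) has_real_derivative p * ?g x
        - s * ?f x) (at 1)"
      by (rule DERIV_mult[THEN DERIV_cong]) (simp add: powr_minus_divide field_simps)
    then show "((\<lambda>r. ?f (r *\<^sub>R x)) has_real_derivative p * ?g x - s * ?f x) (at 1)"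
      by (simp add: powr_minus_divide)
  qed (rule int Bochner_Integration.integrable_diff integrable_mult_right)+
  moreover have "(\<integral>x. p * ?g x - s * ?f x \<partial>lborel) = p * (\<integral>x. ?g x \<partial>lborel) - s * (\<integral>x. ?f x \<partial>lborel)"
    by (subst Bochner_Integration.integral_diff)
      (use int in \<open>auto intro!: integrable_mult_right simp del: times_divide_eq_right\<close>)
  ultimately show ?thesis by (simp add: left_diff_distrib)
qed

text \<open>The deficit in Young's inequality for the numbers \<open>|t| |s| / |x|\<^sup>a\<close> and \<open>|v| / |x|\<^sup>b\<close>, where \<open>s\<close> and
  \<open>v\<close> stand for the values of \<open>u\<close> and \<open>\<nabla>u\<close> at \<open>x\<close>, plus a multiple of the deficit in the Cauchy-Schwarz
  inequality for \<open>x\<close> and \<open>v\<close>. The sign of \<open>t\<close> selects the sign of the cross term.\<close>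

definition young_gap :: "real \<Rightarrow> real \<Rightarrow> real \<Rightarrow> real \<Rightarrow> 'a::real_inner \<Rightarrow> real \<Rightarrow> 'a \<Rightarrow> real" where
  "young_gap p a b t x s v =
     norm v powr p / norm x powr (p * b)
     + (p - 1) * \<bar>t\<bar> powr p * (\<bar>s\<bar> powr p / norm x powr (p * a))
     - p * signed_powr t (p - 1) * (signed_powr s (p - 1) * (x \<bullet> v) / norm x powr ((p - 1) * a + b + 1))"

text \<open>The first three summands are the deficit in Young's inequality, the last one is a nonnegative
  multiple of the deficit in the Cauchy-Schwarz inequality.\<close>

lemma young_gap_eq:
  fixes p a b t s :: real and x v :: "'a::real_inner"
  assumes x: "x \<noteq> 0"
  defines "X \<equiv> \<bar>t\<bar> * \<bar>s\<bar> / norm x powr a" and "Y \<equiv> norm v / norm x powr b"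
  shows "young_gap p a b t x s v = Y powr p + (p - 1) * X powr p - p * (X powr (p - 1) * Y)
    + p * X powr (p - 1) / norm x powr b * (norm v - sgn t * sgn s * (sgn x \<bullet> v))"
proof -
  have Y: "Y powr p = norm v powr p / norm x powr (p * b)"
    by (simp add: Y_def powr_divide powr_powr mult.commute)
  have X: "X powr q = \<bar>t\<bar> powr q * \<bar>s\<bar> powr q / norm x powr (q * a)" for q
    by (simp add: X_def powr_divide powr_mult powr_powr mult.commute)
  have "norm x powr ((p - 1) * a + b + 1) = norm x powr ((p - 1) * a) * norm x powr b * norm x"
    using x by (simp add: powr_add)
  then show ?thesis
    using x unfolding young_gap_def X Y by (simp add: Y_def signed_powr_def sgn_div_norm field_simps)
qed

lemma sgn_inner_bound:
  fixes x v :: "'a::real_inner" and t s :: real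
  shows "sgn t * sgn s * (sgn x \<bullet> v) \<le> norm v"
proof -
  have "\<bar>sgn x \<bullet> v\<bar> \<le> norm (sgn x) * norm v" by (rule Cauchy_Schwarz_ineq2)
  also have "\<dots> \<le> norm v" by (simp add: norm_sgn)
  finally show ?thesis by (auto simp: sgn_if abs_le_iff)
qed

lemma young_gap_nonneg:
  assumes p: "p > 1"
  shows "young_gap p a b t x s v \<ge> 0"
proof (cases "x = 0")
  case True
  then show ?thesis by (simp add: young_gap_def)
next
  case False
  let ?X = "\<bar>t\<bar> * \<bar>s\<bar> / norm x powr a" and ?Y = "norm v / norm x powr b"
  have "0 \<le> p * ?X powr (p - 1) / norm x powr b * (norm v - sgn t * sgn s * (sgn x \<bullet> v))"
    using p sgn_inner_bound[of t s x v] by (intro mult_nonneg_nonneg) auto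
  with young_powr[OF p, of ?X ?Y] show ?thesis unfolding young_gap_eq[OF False] by simp
qed

text \<open>Equality in Young's inequality fixes the length of \<open>v\<close> and equality in the Cauchy-Schwarz
  inequality its direction. Together they say that \<open>v\<close> is the gradient of a profile with value \<open>s\<close>.\<close>

lemma young_gap_eq_0:
  fixes x v :: "'a::real_inner"
  assumes p: "p > 1" and x: "x \<noteq> 0" and t: "t \<noteq> 0" and gap: "young_gap p a b t x s v = 0"
  shows "v = (t * norm x powr (b - a - 1) * s) *\<^sub>R x"
proof -
  let ?X = "\<bar>t\<bar> * \<bar>s\<bar> / norm x powr a" and ?Y = "norm v / norm x powr b"
  let ?c = "p * ?X powr (p - 1) / norm x powr b * (norm v - sgn t * sgn s * (sgn x \<bullet> v))"
  have c: "0 \<le> ?c"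
    using p sgn_inner_bound[of t s x v] by (intro mult_nonneg_nonneg) auto
  have y: "p * (?X powr (p - 1) * ?Y) \<le> ?Y powr p + (p - 1) * ?X powr p"
    by (intro young_powr p) auto
  have g: "?Y powr p + (p - 1) * ?X powr p - p * (?X powr (p - 1) * ?Y) + ?c = 0"
    using gap unfolding young_gap_eq[OF x] .
  have c0: "?c = 0" using c y g by linarith
  have "p * (?X powr (p - 1) * ?Y) = ?Y powr p + (p - 1) * ?X powr p" using c y g by linarith
  then have XY: "?X = ?Y" using young_powr_strict[OF p, of ?X ?Y] by fastforce
  have nv: "norm v = \<bar>t\<bar> * \<bar>s\<bar> * norm x powr (b - a)"
    using XY x by (simp add: powr_diff field_simps)
  show ?thesis
  proof (cases "s = 0")
    case True
    with nv show ?thesis by simp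
  next
    case False
    define w where "w = (sgn t * sgn s) *\<^sub>R v"
    have "sgn t * sgn s * (sgn x \<bullet> v) = norm v"
      using c0 False t x p by (simp add: powr_eq_0_iff)
    then have "x \<bullet> w = norm x * norm w"
      using x t False by (simp add: w_def sgn_div_norm abs_mult field_simps abs_sgn_eq)
    \<comment> \<open>Equality in the Cauchy-Schwarz inequality makes \<open>w\<close> a multiple of \<open>x\<close>.\<close>
    then have "norm x *\<^sub>R w = norm w *\<^sub>R x" by (simp add: norm_cauchy_schwarz_eq)
    then have "norm x *\<^sub>R ((sgn t * sgn s) *\<^sub>R w) = (sgn t * sgn s) *\<^sub>R norm w *\<^sub>R x"
      by (metis scaleR_left_commute)
    moreover have "(sgn t * sgn s) *\<^sub>R w = v" "norm w = norm v"
      using t False by (auto simp: w_def sgn_if)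
    ultimately have "norm x *\<^sub>R v = (sgn t * sgn s * norm v) *\<^sub>R x" by simp
    also have "sgn t * sgn s * norm v = t * s * norm x powr (b - a)"
      by (simp add: nv sgn_if)
    also have "\<dots> = norm x * (t * norm x powr (b - a - 1) * s)"
      using x by (simp add: powr_diff powr_add field_simps)
    finally have "norm x *\<^sub>R v = norm x *\<^sub>R ((t * norm x powr (b - a - 1) * s) *\<^sub>R x)" by simp
    then show ?thesis using x by (simp del: scaleR_scaleR)
  qed
qed

lemma
  fixes u :: "real^'n::finite \<Rightarrow> real" and p s :: real
  assumes u: "u \<in> test_functions (- {0})" and p: "p > 1"
  shows integrable_test: "integrable lborel (\<lambda>x. \<bar>u x\<bar> powr p / norm x powr s)"
    and integrable_test_gradient: "integrable lborel (\<lambda>x. norm (gradient u x) powr p / norm x powr s)"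
    and integrable_test_cross:
      "integrable lborel (\<lambda>x. signed_powr (u x) (p - 1) * (x \<bullet> gradient u x) / norm x powr s)"
proof -
  obtain K where K: "compact K" "0 \<notin> K" "\<And>x. x \<notin> K \<Longrightarrow> u x = 0" "\<And>x. x \<notin> K \<Longrightarrow> gradient u x = 0"
    using test_function_support[OF u] by blast
  have sm: "smooth u" using u by (simp add: test_functions_def)
  have 1: "continuous_on K (\<lambda>x. \<bar>u x\<bar> powr p)"
    using p by (intro continuous_on_powr' continuous_intros smooth_continuous[OF sm]) auto
  have 2: "continuous_on K (\<lambda>x. norm (gradient u x) powr p)"
    using p by (intro continuous_on_powr' continuous_intros smooth_continuous_gradient[OF sm]) auto
  have 3: "continuous_on K (\<lambda>x. signed_powr (u x) (p - 1))"
    using p by (intro continuous_signed_powr smooth_continuous[OF sm]) auto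
  have 4: "continuous_on K (\<lambda>x. norm x powr s)"
    using K by (intro continuous_on_powr continuous_intros) auto
  have nz: "\<forall>x\<in>K. norm x powr s \<noteq> 0" using K by auto
  show "integrable lborel (\<lambda>x. \<bar>u x\<bar> powr p / norm x powr s)"
    using K p by (intro integrable_continuous_compact_support[of K] continuous_on_divide 1 4 nz) auto
  show "integrable lborel (\<lambda>x. norm (gradient u x) powr p / norm x powr s)"
    using K p by (intro integrable_continuous_compact_support[of K] continuous_on_divide 2 4 nz) auto
  show "integrable lborel (\<lambda>x. signed_powr (u x) (p - 1) * (x \<bullet> gradient u x) / norm x powr s)"
    using K p by (intro integrable_continuous_compact_support[of K] continuous_on_divide
        continuous_on_mult continuous_on_inner continuous_on_id smooth_continuous_gradient[OF sm] 3 4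
            nz) auto
qed

text \<open>The cross term of the gap is the right-hand side of \<open>radial_identity\<close>; this is where the constant
  \<open>\<gamma> - N\<close> enters.\<close>

lemma integral_young_gap:
  fixes u :: "real^'n::finite \<Rightarrow> real" and p a b t :: real
  assumes p: "p > 1"
    and deriv: "\<And>x. x \<noteq> 0 \<Longrightarrow> (u has_derivative (\<lambda>h. g x \<bullet> h)) (at x)"
    and cont: "continuous_on (- {0}) g"
    and int: "integrable lborel (\<lambda>x. norm (g x) powr p / norm x powr (p * b))"
      "integrable lborel (\<lambda>x. \<bar>u x\<bar> powr p / norm x powr (p * a))"
      "integrable lborel (\<lambda>x. \<bar>u x\<bar> powr p / norm x powr ((p - 1) * a + b + 1))"
      "integrable lborel (\<lambda>x. signed_powr (u x) (p - 1) * (x \<bullet> g x) / norm x powr ((p - 1) * a + b + 1))"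
  shows "has_bochner_integral lborel (\<lambda>x. young_gap p a b t x (u x) (g x))
    (weighted_integral p (p * b) g + (p - 1) * \<bar>t\<bar> powr p * weighted_integral p (p * a) u
      - signed_powr t (p - 1) * ((p - 1) * a + b + 1 - real CARD('n)) * ckn_rhs p a b u)"
proof -
  have R: "p * (\<integral>x. signed_powr (u x) (p - 1) * (x \<bullet> g x) / norm x powr ((p - 1) * a + b + 1) \<partial>lborel)
    = ((p - 1) * a + b + 1 - real CARD('n)) * ckn_rhs p a b u"
    using radial_identity[OF p deriv cont int(3,4)] by (simp add: ckn_rhs_def weighted_integral_def)
  then have *: "signed_powr t (p - 1) * ((p - 1) * a + b + 1 - real CARD('n)) * ckn_rhs p a b u
    = p * signed_powr t (p - 1) * (\<integral>x. signed_powr (u x) (p - 1) * (x \<bullet> g x)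
        / norm x powr ((p - 1) * a + b + 1) \<partial>lborel)"
    by (simp only: mult.assoc mult.left_commute[of p] R)
  show ?thesis
    unfolding young_gap_def * weighted_integral_def real_norm_def
    by (intro has_bochner_integral_diff has_bochner_integral_add
        has_bochner_integral_mult_right has_bochner_integral_integrable int)
qed

lemma integral_young_gap_test:
  fixes u :: "real^'n::finite \<Rightarrow> real" and p a b t :: real
  assumes "u \<in> test_functions (- {0})" and "p > 1"
  shows "has_bochner_integral lborel (\<lambda>x. young_gap p a b t x (u x) (gradient u x))
    (weighted_integral p (p * b) (gradient u) + (p - 1) * \<bar>t\<bar> powr p * weighted_integral p (p * a) u
      - signed_powr t (p - 1) * ((p - 1) * a + b + 1 - real CARD('n)) * ckn_rhs p a b u)"
  using assms
  by (intro integral_young_gap smooth_has_derivative smooth_continuous_gradient integrable_test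
      integrable_test_gradient integrable_test_cross) (auto simp: test_functions_def)

text \<open>The best choice is \<open>r\<^sup>p = A / B\<close>, for which both summands on the right are multiples of \<open>A\<close>. If \<open>A\<close> or
  \<open>B\<close> vanishes, letting \<open>r\<close> tend to \<open>0\<close> or to infinity forces \<open>L \<le> 0\<close>.\<close>

lemma product_bound_from_scaled_sum:
  fixes p A B L :: real
  assumes p: "p > 1" and A: "A \<ge> 0" and B: "B \<ge> 0"
    and scaled: "\<And>r. r > 0 \<Longrightarrow> L * r powr (p - 1) \<le> A + (p - 1) * r powr p * B"
  shows "L / p \<le> A powr (1 / p) * B powr ((p - 1) / p)"
proof -
  consider "A > 0" "B > 0" | "A = 0" | "B = 0" using A B by linarith
  then show ?thesis
  proof cases
    case 1
    define r where "r = (A / B) powr (1 / p)"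
    have r: "r > 0" using 1 by (simp add: r_def)
    have rp: "r powr p = A / B" using p 1 by (simp add: r_def powr_powr)
    have "(p - 1) * r powr p * B = (p - 1) * A" using 1 by (simp add: rp)
    then have "L * r powr (p - 1) \<le> p * A"
      using scaled[OF r] by (simp add: left_diff_distrib)
    then have "L / p \<le> A / r powr (p - 1)" using p r by (simp add: field_simps)
    also have "r powr (p - 1) = A powr ((p - 1) / p) / B powr ((p - 1) / p)"
      using 1 by (simp add: r_def powr_powr powr_divide)
    also have "A / \<dots> = A powr (1 - (p - 1) / p) * B powr ((p - 1) / p)"
      using 1 by (simp add: powr_diff)
    also have "1 - (p - 1) / p = 1 / p" using p by (simp add: field_simps)
    finally show ?thesis .
  next
    case 2
    have "L \<le> 0"
    proof (rule ccontr)
      assume "\<not> L \<le> 0"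
      define r where "r = L / (2 * (p - 1) * B + 1)"
      have d: "2 * (p - 1) * B + 1 > 0" using p B by (simp add: add_nonneg_pos)
      have r: "r > 0" using d \<open>\<not> L \<le> 0\<close> by (simp add: r_def)
      have "L * r powr (p - 1) \<le> (p - 1) * B * r * r powr (p - 1)"
        using scaled[OF r] 2 r by (simp add: powr_diff field_simps)
      then have "L \<le> (p - 1) * B * r" using r by (simp add: mult_le_cancel_right)
      then have "L * (2 * (p - 1) * B + 1) \<le> (p - 1) * B * L"
        using d by (simp add: r_def field_simps)
      moreover have "0 \<le> (p - 1) * B * L" using p B \<open>\<not> L \<le> 0\<close> by simp
      ultimately show False using \<open>\<not> L \<le> 0\<close> by (simp add: algebra_simps)
    qed
    then show ?thesis using 2 p by (simp add: divide_nonpos_pos)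
  next
    case 3
    have "L \<le> 0"
    proof (rule ccontr)
      assume "\<not> L \<le> 0"
      define r where "r = ((A + 1) / L) powr (1 / (p - 1))"
      have r: "r > 0" using A \<open>\<not> L \<le> 0\<close> by (simp add: r_def)
      have "r powr (p - 1) = (A + 1) / L" using p A \<open>\<not> L \<le> 0\<close> by (simp add: r_def powr_powr)
      with scaled[OF r] 3 \<open>\<not> L \<le> 0\<close> show False by simp
    qed
    then show ?thesis using 3 p by (simp add: divide_nonpos_pos)
  qed
qed

lemma weighted_integral_nonneg: "weighted_integral p s f \<ge> 0"
  unfolding weighted_integral_def by (intro integral_nonneg_AE) auto

text \<open>The gap has a nonnegative integral for \<open>t = r\<close> and for \<open>t = - r\<close>. The sign of \<open>\<gamma> - N\<close> decides which of
  the two is useful, and \<open>r\<close> is then optimised.\<close>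

lemma ckn_inequality:
  fixes u :: "real^'n::finite \<Rightarrow> real" and p a b :: real
  assumes p: "p > 1" and u: "u \<in> test_functions (- {0})"
  shows "\<bar>real CARD('n) - ((p - 1) * a + b + 1)\<bar> / p * ckn_rhs p a b u \<le> ckn_lhs p a b u (gradient u)"
proof -
  let ?c = "(p - 1) * a + b + 1 - real CARD('n)"
  have "\<bar>?c\<bar> * ckn_rhs p a b u / p \<le> ckn_lhs p a b u (gradient u)"
    unfolding ckn_lhs_def
  proof (rule product_bound_from_scaled_sum)
    fix r :: real assume r: "r > 0"
    \<comment> \<open>The sign makes the cross term contribute \<open>|\<gamma> - N|\<close>.\<close>
    define t where "t = (if ?c \<ge> 0 then r else - r)"
    have "0 \<le> (\<integral>x. young_gap p a b t x (u x) (gradient u x) \<partial>lborel)"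
      by (intro integral_nonneg_AE) (simp add: young_gap_nonneg[OF p])
    moreover have "signed_powr t (p - 1) * ?c = r powr (p - 1) * \<bar>?c\<bar>" "\<bar>t\<bar> = r"
      using r by (auto simp: t_def signed_powr_def algebra_simps)
    ultimately show "\<bar>?c\<bar> * ckn_rhs p a b u * r powr (p - 1)
        \<le> weighted_integral p (p * b) (gradient u) + (p - 1) * r powr p * weighted_integral p (p * a) u"
      using integral_young_gap_test[OF u p, of a b t] by (simp add: has_bochner_integral_iff mult_ac)
  qed (use p weighted_integral_nonneg in auto)
  then show ?thesis by (simp add: abs_minus_commute)
qed

section \<open>Passage to the completion\<close>

text \<open>A substitute for Minkowski's inequality: by convexity, \<open>|y|\<^sup>p\<close> is bounded by \<open>|z|\<^sup>p\<close> up to a factor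
  that tends to \<open>1\<close> as \<open>r\<close> tends to \<open>0\<close>, at the price of a large multiple of \<open>|y - z|\<^sup>p\<close>.\<close>

lemma norm_powr_split:
  fixes y z :: "'a::real_normed_vector" and p r :: real
  assumes p: "p > 1" and r: "0 < r" "r < 1"
  shows "norm y powr p \<le> (1 - r) powr (1 - p) * norm z powr p + r powr (1 - p) * norm (y - z) powr p"
proof -
  have one: "1 \<le> c powr (1 - p)" if "0 < c" "c < 1" for c :: real
    using powr_mono2'[of "1 - p" c 1] that p by simp
  consider "z = 0" | "y = z" | "z \<noteq> 0" "y \<noteq> z" by blast
  then show ?thesis
  proof cases
    case 1
    with one[of r] r p show ?thesis by (simp add: mult_le_cancel_right1)
  next
    case 2
    with one[of "1 - r"] r p show ?thesis by (simp add: mult_le_cancel_right1)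
  next
    case 3
    have "norm y \<le> norm z + norm (y - z)" using norm_triangle_ineq[of z "y - z"] by simp
    then have "norm y powr p \<le> (norm z + norm (y - z)) powr p" using p by (intro powr_mono2) auto
    also have "norm z + norm (y - z) = (1 - r) *\<^sub>R (norm z / (1 - r)) + r *\<^sub>R (norm (y - z) / r)"
      using r by simp
    also have "\<dots> powr p \<le> (1 - r) * (norm z / (1 - r)) powr p + r * (norm (y - z) / r) powr p"
      using p r 3 by (intro convex_onD[OF powr_convex]) auto
    also have "\<dots> = (1 - r) powr (1 - p) * norm z powr p + r powr (1 - p) * norm (y - z) powr p"
      using r by (simp add: powr_divide powr_diff)
    finally show ?thesis .
  qed
qed

lemma nn_integral_powr_split:
  fixes f h :: "'a \<Rightarrow> 'b::{real_normed_vector, second_countable_topology}" and p r :: real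
  assumes p: "p > 1" and r: "0 < r" "r < 1"
    and [measurable]: "f \<in> borel_measurable M" "h \<in> borel_measurable M" "w \<in> borel_measurable M"
    and w: "\<And>x. w x \<ge> 0"
  shows "(\<integral>\<^sup>+x. ennreal (norm (f x) powr p / w x) \<partial>M)
    \<le> ennreal ((1 - r) powr (1 - p)) * (\<integral>\<^sup>+x. ennreal (norm (h x) powr p / w x) \<partial>M)
      + ennreal (r powr (1 - p)) * (\<integral>\<^sup>+x. ennreal (norm (f x - h x) powr p / w x) \<partial>M)"
proof -
  have "(\<integral>\<^sup>+x. ennreal (norm (f x) powr p / w x) \<partial>M)
    \<le> (\<integral>\<^sup>+x. ennreal ((1 - r) powr (1 - p)) * ennreal (norm (h x) powr p / w x)
         + ennreal (r powr (1 - p)) * ennreal (norm (f x - h x) powr p / w x) \<partial>M)"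
  proof (intro nn_integral_mono)
    fix x
    have "norm (f x) powr p / w x \<le> (1 - r) powr (1 - p) * (norm (h x) powr p / w x) + r powr (1 - p)
        * (norm (f x - h x) powr p / w x)"
      using divide_right_mono[OF norm_powr_split[OF p r, of "f x" "h x"] w[of x]]
      by (simp add: add_divide_distrib)
    then show "ennreal (norm (f x) powr p / w x) \<le> ennreal ((1 - r) powr (1 - p))
        * ennreal (norm (h x) powr p / w x)
         + ennreal (r powr (1 - p)) * ennreal (norm (f x - h x) powr p / w x)"
      using w[of x] by (simp add: ennreal_mult[symmetric] ennreal_plus[symmetric] ennreal_leI del:
          ennreal_plus)
  qed
  also have "\<dots> = ennreal ((1 - r) powr (1 - p)) * (\<integral>\<^sup>+x. ennreal (norm (h x) powr p / w x) \<partial>M)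
      + ennreal (r powr (1 - p)) * (\<integral>\<^sup>+x. ennreal (norm (f x - h x) powr p / w x) \<partial>M)"
    by (simp add: nn_integral_add nn_integral_cmult)
  finally show ?thesis .
qed

lemma test_function_measurable:
  fixes u :: "real^'n::finite \<Rightarrow> real"
  assumes "u \<in> test_functions (- {0})"
  shows "u \<in> borel_measurable borel" "gradient u \<in> borel_measurable borel"
  using assms smooth_continuous[of u UNIV] smooth_continuous_gradient[of u UNIV]
  by (auto simp: test_functions_def intro: borel_measurable_continuous_onI)

lemma nn_integral_weighted:
  assumes "integrable lborel (\<lambda>x. norm (f x) powr p / norm x powr s)"
  shows "(\<integral>\<^sup>+x. ennreal (norm (f x) powr p / norm x powr s) \<partial>lborel) = ennreal (weighted_integral p s f)"
  unfolding weighted_integral_def using assms by (intro nn_integral_eq_integral) auto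

lemmas nn_integral_weighted_real = nn_integral_weighted[where 'b = real, unfolded real_norm_def]

lemma
  fixes u :: "real^'n::finite \<Rightarrow> real" and p a b :: real
  assumes p: "p > 1" and ug: "(u, g) \<in> ckn_space p a b"
  shows ckn_space_measurable: "u \<in> borel_measurable borel" "g \<in> borel_measurable borel"
    and integrable_ckn_space: "integrable lborel (\<lambda>x. norm (u x) powr p / norm x powr (p * a))"
    and integrable_ckn_space_gradient: "integrable lborel (\<lambda>x. norm (g x) powr p / norm x powr (p * b))"
proof -
  from ug obtain \<phi> where [measurable]: "u \<in> borel_measurable borel" "g \<in> borel_measurable borel"
    and \<phi>: "\<And>k::nat. \<phi> k \<in> test_functions (- {0})"
    and lim: "(\<lambda>k. \<integral>\<^sup>+x. ennreal (\<bar>\<phi> k x - u x\<bar> powr p / norm x powr (p * a)) \<partial>lborel) \<longlonglongrightarrow> 0"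
      "(\<lambda>k. \<integral>\<^sup>+x. ennreal (norm (gradient (\<phi> k) x - g x) powr p / norm x powr (p * b)) \<partial>lborel) \<longlonglongrightarrow> 0"
    by (auto simp: ckn_space_def)
  then show "u \<in> borel_measurable borel" "g \<in> borel_measurable borel" by auto
  note [measurable] = test_function_measurable[OF \<phi>]
  have "eventually (\<lambda>k. (\<integral>\<^sup>+x. ennreal (\<bar>\<phi> k x - u x\<bar> powr p / norm x powr (p * a)) \<partial>lborel) < \<infinity>
      \<and> (\<integral>\<^sup>+x. ennreal (norm (gradient (\<phi> k) x - g x) powr p / norm x powr (p * b)) \<partial>lborel) < \<infinity>)
          sequentially"
    using order_tendstoD(2)[OF lim(1), of \<infinity>] order_tendstoD(2)[OF lim(2), of \<infinity>]
        by (simp add: eventually_conj_iff)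
  then obtain k where k: "(\<integral>\<^sup>+x. ennreal (norm (u x - \<phi> k x) powr p / norm x powr (p * a)) \<partial>lborel) < \<infinity>"
    "(\<integral>\<^sup>+x. ennreal (norm (g x - gradient (\<phi> k) x) powr p / norm x powr (p * b)) \<partial>lborel) < \<infinity>"
    by (auto simp: eventually_sequentially norm_minus_commute simp flip: real_norm_def)
  have "(\<integral>\<^sup>+x. ennreal (norm (u x) powr p / norm x powr (p * a)) \<partial>lborel) < \<infinity>"
    by (rule le_less_trans[OF nn_integral_powr_split[OF p, of "1/2" u lborel "\<phi> k"]])
      (use k integrable_test[OF \<phi> p] in \<open>auto simp: ennreal_mult_less_top nn_integral_weighted
          nn_integral_weighted_real\<close>)
  then show "integrable lborel (\<lambda>x. norm (u x) powr p / norm x powr (p * a))"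
    by (simp add: integrable_iff_bounded)
  have "(\<integral>\<^sup>+x. ennreal (norm (g x) powr p / norm x powr (p * b)) \<partial>lborel) < \<infinity>"
    by (rule le_less_trans[OF nn_integral_powr_split[OF p, of "1/2" g lborel "gradient (\<phi> k)"]])
      (use k integrable_test_gradient[OF \<phi> p] in \<open>auto simp: ennreal_mult_less_top nn_integral_weighted
          nn_integral_weighted_real\<close>)
  then show "integrable lborel (\<lambda>x. norm (g x) powr p / norm x powr (p * b))"
    by (simp add: integrable_iff_bounded)
qed

text \<open>The functions need not be integrable for small indices, so the initial part of the sequence is dropped
  before the subsequence theorem for \<open>L\<^sup>1\<close>-convergence is used.\<close>

lemma nn_integral_tendsto_0_subseq_AE:
  fixes d :: "nat \<Rightarrow> 'a \<Rightarrow> real"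
  assumes [measurable]: "\<And>k. d k \<in> borel_measurable M" and nonneg: "\<And>k x. d k x \<ge> 0"
    and lim: "(\<lambda>k. \<integral>\<^sup>+x. ennreal (d k x) \<partial>M) \<longlonglongrightarrow> 0"
  obtains r :: "nat \<Rightarrow> nat" where "strict_mono r" "AE x in M. (\<lambda>k. d (r k) x) \<longlonglongrightarrow> 0"
proof -
  from order_tendstoD(2)[OF lim, of \<infinity>]
  obtain m where m: "\<And>k. k \<ge> m \<Longrightarrow> (\<integral>\<^sup>+x. ennreal (d k x) \<partial>M) < \<infinity>"
    by (auto simp: eventually_sequentially)
  have int: "integrable M (d (k + m))" for k
    using m[of "k + m"] nonneg by (simp add: integrable_iff_bounded)
  have "(\<lambda>k. \<integral>x. norm (d (k + m) x) \<partial>M) \<longlonglongrightarrow> 0"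
  proof -
    have "(\<lambda>k. enn2real (\<integral>\<^sup>+x. ennreal (d (k + m) x) \<partial>M)) \<longlonglongrightarrow> 0"
      using LIMSEQ_ignore_initial_segment[OF lim, of m] by (intro tendsto_enn2real) auto
    then show ?thesis using nonneg by (simp add: integral_eq_nn_integral)
  qed
  from tendsto_L1_AE_subseq[OF int this] obtain r where "strict_mono r" "AE x in M. (\<lambda>k. d (r k + m) x) \<longlonglongrightarrow> 0"
    by blast
  then show thesis using that[of "\<lambda>k. r k + m"] by (auto simp: strict_mono_def)
qed

lemma powr_tendsto_0_imp_tendsto:
  fixes f :: "nat \<Rightarrow> 'a::real_normed_vector" and p c :: real
  assumes "(\<lambda>k. norm (f k - l) powr p / c) \<longlonglongrightarrow> 0" and "p > 0" "c > 0"
  shows "f \<longlonglongrightarrow> l"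
proof -
  have "(\<lambda>k. (norm (f k - l) powr p / c) * c) \<longlonglongrightarrow> 0 * c" by (intro tendsto_intros assms)
  then have "(\<lambda>k. norm (f k - l) powr p) \<longlonglongrightarrow> 0" using assms by simp
  then have "(\<lambda>k. (norm (f k - l) powr p) powr (1 / p)) \<longlonglongrightarrow> 0 powr (1 / p)"
    using assms by (intro tendsto_powr') auto
  then have "(\<lambda>k. norm (f k - l)) \<longlonglongrightarrow> 0" using assms by (simp add: powr_powr)
  then show ?thesis by (simp add: tendsto_norm_zero_iff LIM_zero_iff)
qed

text \<open>Along a subsequence the approximating pairs converge almost everywhere, so Fatou's lemma bounds the left
  side. On the right side only an upper bound for the limit is needed, and \<open>nn_integral_powr_split\<close>
  provides it up to a factor \<open>(1 - q)\<^sup>1\<^sup>-\<^sup>p\<close> that is removed at the end.\<close>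

lemma ckn_space_closure:
  fixes u :: "real^'n::finite \<Rightarrow> real" and p a b :: real and \<Phi> :: "real^'n \<Rightarrow> real \<Rightarrow> real^'n \<Rightarrow> real"
  assumes p: "p > 1" and ug: "(u, g) \<in> ckn_space p a b"
    and \<alpha>: "\<alpha> \<ge> 0" and \<beta>: "\<beta> \<ge> 0"
    and cont: "\<And>x. x \<noteq> 0 \<Longrightarrow> continuous_on UNIV (\<lambda>z. \<Phi> x (fst z) (snd z))"
    and meas: "\<And>f h. f \<in> borel_measurable borel \<Longrightarrow> h \<in> borel_measurable borel
        \<Longrightarrow> (\<lambda>x. \<Phi> x (f x) (h x)) \<in> borel_measurable borel"
    and bound: "\<And>\<phi>. \<phi> \<in> test_functions (- {0}) \<Longrightarrow> (\<integral>\<^sup>+x. ennreal (\<Phi> x (\<phi> x) (gradient \<phi> x)) \<partial>lborel)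
      \<le> ennreal (\<alpha> * weighted_integral p (p * b) (gradient \<phi>) + \<beta> * weighted_integral p (p * a) \<phi>)"
  shows "(\<integral>\<^sup>+x. ennreal (\<Phi> x (u x) (g x)) \<partial>lborel)
      \<le> ennreal (\<alpha> * weighted_integral p (p * b) g + \<beta> * weighted_integral p (p * a) u)"
proof -
  note [measurable] = ckn_space_measurable[OF p ug]
  let ?N = "\<lambda>h. \<integral>\<^sup>+x. ennreal (norm (h x) powr p / norm x powr (p * b)) \<partial>lborel"
  let ?M = "\<lambda>h. \<integral>\<^sup>+x. ennreal (norm (h x) powr p / norm x powr (p * a)) \<partial>lborel"
  from ug obtain \<phi> where \<phi>: "\<And>k::nat. \<phi> k \<in> test_functions (- {0})"
    and lim: "(\<lambda>k. ?M (\<lambda>x. \<phi> k x - u x)) \<longlonglongrightarrow> 0" "(\<lambda>k. ?N (\<lambda>x. gradient (\<phi> k) x - g x)) \<longlonglongrightarrow> 0"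
    by (auto simp: ckn_space_def)
  note [measurable] = test_function_measurable[OF \<phi>]
  let ?d = "\<lambda>k x. norm (\<phi> k x - u x) powr p / norm x powr (p * a) + norm (gradient (\<phi> k) x - g x) powr p
      / norm x powr (p * b)"
  have "(\<lambda>k. ?M (\<lambda>x. \<phi> k x - u x) + ?N (\<lambda>x. gradient (\<phi> k) x - g x)) \<longlonglongrightarrow> 0 + 0"
    by (intro tendsto_intros lim)
  then have "(\<lambda>k. \<integral>\<^sup>+x. ennreal (?d k x) \<partial>lborel) \<longlonglongrightarrow> 0"
    by (simp add: nn_integral_add)
  then obtain r :: "nat \<Rightarrow> nat" where r: "strict_mono r" and ae: "AE x in lborel. (\<lambda>k. ?d (r k) x) \<longlonglongrightarrow> 0"
    by (rule nn_integral_tendsto_0_subseq_AE[rotated 2]) auto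
  have "AE x in lborel. x \<noteq> (0 :: real^'n)" by (rule AE_lborel_singleton)
  with ae have conv: "AE x in lborel. (\<lambda>k. ennreal (\<Phi> x (\<phi> (r k) x) (gradient (\<phi> (r k)) x)))
      \<longlonglongrightarrow> ennreal (\<Phi> x (u x) (g x))"
  proof eventually_elim
    fix x :: "real^'n" assume x: "x \<noteq> 0" and d: "(\<lambda>k. ?d (r k) x) \<longlonglongrightarrow> 0"
    have "(\<lambda>k. norm (\<phi> (r k) x - u x) powr p / norm x powr (p * a)) \<longlonglongrightarrow> 0"
      by (rule tendsto_sandwich[OF _ _ tendsto_const d]) auto
    then have 1: "(\<lambda>k. \<phi> (r k) x) \<longlonglongrightarrow> u x" by (rule powr_tendsto_0_imp_tendsto) (use p x in auto)
    have "(\<lambda>k. norm (gradient (\<phi> (r k)) x - g x) powr p / norm x powr (p * b)) \<longlonglongrightarrow> 0"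
      by (rule tendsto_sandwich[OF _ _ tendsto_const d]) auto
    then have 2: "(\<lambda>k. gradient (\<phi> (r k)) x) \<longlonglongrightarrow> g x" by (rule powr_tendsto_0_imp_tendsto) (use p x in auto)
    have "(\<lambda>k. \<Phi> x (fst (\<phi> (r k) x, gradient (\<phi> (r k)) x)) (snd (\<phi> (r k) x, gradient (\<phi> (r k)) x)))
        \<longlonglongrightarrow> \<Phi> x (fst (u x, g x)) (snd (u x, g x))"
      by (rule continuous_on_tendsto_compose[OF cont[OF x] tendsto_Pair[OF 1 2]]) auto
    then show "(\<lambda>k. ennreal (\<Phi> x (\<phi> (r k) x) (gradient (\<phi> (r k)) x))) \<longlonglongrightarrow> ennreal (\<Phi> x (u x) (g x))"
      by (simp add: tendsto_ennrealI)
  qed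
  let ?X = "ennreal \<alpha> * ?N g + ennreal \<beta> * ?M u"
  have X: "?X = ennreal (\<alpha> * weighted_integral p (p * b) g + \<beta> * weighted_integral p (p * a) u)"
    using \<alpha> \<beta> by (simp add: nn_integral_weighted nn_integral_weighted_real
        integrable_ckn_space_gradient[OF p ug] integrable_ckn_space[OF p ug, unfolded real_norm_def]
      weighted_integral_nonneg ennreal_mult)
  let ?I = "\<integral>\<^sup>+x. ennreal (\<Phi> x (u x) (g x)) \<partial>lborel"
  have main: "?I \<le> ennreal ((1 - q) powr (1 - p)) * ?X" if q: "0 < q" "q < 1" for q
  proof -
    let ?e = "\<lambda>k. ennreal (q powr (1 - p)) * (ennreal \<alpha> * ?N (\<lambda>x. gradient (\<phi> k) x - g x) + ennreal \<beta>
        * ?M (\<lambda>x. \<phi> k x - u x))"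
    have "?I = (\<integral>\<^sup>+x. liminf (\<lambda>k. ennreal (\<Phi> x (\<phi> (r k) x) (gradient (\<phi> (r k)) x))) \<partial>lborel)"
      using conv by (intro nn_integral_cong_AE) (auto simp: lim_imp_Liminf elim!: eventually_mono)
    also have "\<dots> \<le> liminf (\<lambda>k. \<integral>\<^sup>+x. ennreal (\<Phi> x (\<phi> (r k) x) (gradient (\<phi> (r k)) x)) \<partial>lborel)"
      by (intro nn_integral_liminf measurable_compose[OF _ measurable_ennreal]) (simp add: meas)
    also have "\<dots> \<le> liminf (\<lambda>k. ennreal ((1 - q) powr (1 - p)) * ?X + ?e (r k))"
    proof (intro Liminf_mono always_eventually allI)
      fix k
      let ?f = "\<phi> (r k)"
      have "(\<integral>\<^sup>+x. ennreal (\<Phi> x (?f x) (gradient ?f x)) \<partial>lborel)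
        \<le> ennreal (\<alpha> * weighted_integral p (p * b) (gradient ?f) + \<beta> * weighted_integral p (p * a) ?f)"
        by (rule bound[OF \<phi>])
      also have "\<dots> = ennreal \<alpha> * ?N (gradient ?f) + ennreal \<beta> * ?M ?f"
        using \<alpha> \<beta> integrable_test[OF \<phi> p] integrable_test_gradient[OF \<phi> p]
        by (simp add: nn_integral_weighted nn_integral_weighted_real weighted_integral_nonneg ennreal_mult)
      also have "\<dots> \<le> ennreal \<alpha> * (ennreal ((1 - q) powr (1 - p)) * ?N g + ennreal (q powr (1 - p))
          * ?N (\<lambda>x. gradient ?f x - g x))
        + ennreal \<beta> * (ennreal ((1 - q) powr (1 - p)) * ?M u + ennreal (q powr (1 - p))
            * ?M (\<lambda>x. ?f x - u x))"
        using q by (intro add_mono mult_left_mono nn_integral_powr_split[OF p]) auto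
      also have "\<dots> = ennreal ((1 - q) powr (1 - p)) * ?X + ?e (r k)"
        by (simp add: algebra_simps)
      finally show "(\<integral>\<^sup>+x. ennreal (\<Phi> x (?f x) (gradient ?f x)) \<partial>lborel)
          \<le> ennreal ((1 - q) powr (1 - p)) * ?X + ?e (r k)" .
    qed
    also have "\<dots> = ennreal ((1 - q) powr (1 - p)) * ?X + 0"
    proof (rule lim_imp_Liminf)
      have "(\<lambda>k. ennreal (q powr (1 - p)) * (ennreal \<alpha> * ?N (\<lambda>x. gradient (\<phi> k) x - g x) + ennreal \<beta>
          * ?M (\<lambda>x. \<phi> k x - u x)))
        \<longlonglongrightarrow> ennreal (q powr (1 - p)) * (ennreal \<alpha> * 0 + ennreal \<beta> * 0)"
        by (intro ennreal_tendsto_cmult tendsto_add lim) auto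
      then have "(\<lambda>k. ?e (r k)) \<longlonglongrightarrow> 0"
        using LIMSEQ_subseq_LIMSEQ[OF _ r] by (simp add: comp_def)
      then show "(\<lambda>k. ennreal ((1 - q) powr (1 - p)) * ?X + ?e (r k))
          \<longlonglongrightarrow> ennreal ((1 - q) powr (1 - p)) * ?X + 0"
        by (intro tendsto_intros)
    qed simp
    finally show ?thesis by simp
  qed
  let ?x = "\<alpha> * weighted_integral p (p * b) g + \<beta> * weighted_integral p (p * a) u"
  have x: "?x \<ge> 0" using \<alpha> \<beta> by (simp add: weighted_integral_nonneg)
  have "?I \<le> ennreal ?x"
  proof (rule tendsto_lowerbound)
    have "(\<lambda>n. (1 - 1 / real (n + 2)) powr (1 - p) * ?x) \<longlonglongrightarrow> (1 - 0) powr (1 - p) * ?x"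
      by (intro tendsto_intros LIMSEQ_ignore_initial_segment[where f = "\<lambda>n. 1 / real n"] lim_1_over_n) auto
    then show "(\<lambda>n. ennreal ((1 - 1 / real (n + 2)) powr (1 - p) * ?x)) \<longlonglongrightarrow> ennreal ?x"
      by (intro tendsto_ennrealI) simp
    show "eventually (\<lambda>n. ?I \<le> ennreal ((1 - 1 / real (n + 2)) powr (1 - p) * ?x)) sequentially"
      using main x unfolding X by (auto simp: ennreal_mult intro!: always_eventually)
  qed simp
  then show ?thesis .
qed

lemma continuous_young_gap:
  fixes x :: "'a::real_inner" and p a b t :: real
  assumes "p > 1" "x \<noteq> 0"
  shows "continuous_on UNIV (\<lambda>z. young_gap p a b t x (fst z) (snd z))"
  unfolding young_gap_def using assms
  by (intro continuous_on_diff continuous_on_add continuous_on_mult continuous_on_divide continuous_on_const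
      continuous_signed_powr continuous_on_powr' continuous_on_inner continuous_on_norm continuous_on_rabs
      continuous_on_fst continuous_on_snd continuous_on_id) auto

lemma measurable_young_gap [measurable]:
  fixes h :: "'a::euclidean_space \<Rightarrow> 'a"
  assumes [measurable]: "f \<in> borel_measurable borel" "h \<in> borel_measurable borel"
  shows "(\<lambda>x. young_gap p a b t x (f x) (h x)) \<in> borel_measurable borel"
  unfolding young_gap_def by measurable

text \<open>For the parameter \<open>t\<close> that is optimal for \<open>(u, g)\<close>, the closure lemma applied to the gap together
  with \<open>|t|\<^sup>p\<^sup>-\<^sup>1 |c| |u|\<^sup>p / |x|\<^sup>\<gamma>\<close> bounds the integral of their sum by a number which, by the assumed equality,
  is already exhausted by the second summand. Hence the gap vanishes almost everywhere. No such \<open>t\<close> exists if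
  a factor on the left is \<open>0\<close>; then \<open>u\<close> vanishes.\<close>

lemma ckn_attains_gradient:
  fixes u :: "real^'n::finite \<Rightarrow> real" and p a b :: real
  defines "c \<equiv> (p - 1) * a + b + 1 - real CARD('n)"
  assumes p: "p > 1" and c: "c \<noteq> 0" and att: "ckn_attains p a b (\<bar>c\<bar> / p) u g"
  shows "(AE x in lborel. u x = 0) \<or>
    (\<exists>t. t * c > 0 \<and> (AE x in lborel. g x = (t * norm x powr (b - a - 1) * u x) *\<^sub>R x))"
proof -
  let ?s = "(p - 1) * a + b + 1"
  have ug: "(u, g) \<in> ckn_space p a b"
    and int: "integrable lborel (\<lambda>x. \<bar>u x\<bar> powr p / norm x powr ?s)"
    and eq: "ckn_lhs p a b u g = \<bar>c\<bar> / p * ckn_rhs p a b u"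
    using att by (auto simp: ckn_attains_def)
  note [measurable] = ckn_space_measurable[OF p ug]
  define A where "A = weighted_integral p (p * b) g"
  define B where "B = weighted_integral p (p * a) u"
  define R where "R = ckn_rhs p a b u"
  have AB: "A \<ge> 0" "B \<ge> 0" by (auto simp: A_def B_def weighted_integral_nonneg)
  have lhs: "A powr (1 / p) * B powr ((p - 1) / p) = \<bar>c\<bar> / p * R"
    using eq by (simp add: ckn_lhs_def A_def B_def R_def)
  have ne0: "AE x in lborel. x \<noteq> (0 :: real^'n)" by (rule AE_lborel_singleton)
  show ?thesis
  proof (cases "A = 0 \<or> B = 0")
    case True
    then have "A powr (1 / p) * B powr ((p - 1) / p) = 0" by auto
    then have "R = 0" using lhs c p by simp
    then have "AE x in lborel. \<bar>u x\<bar> powr p / norm x powr ?s = 0"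
      using int by (subst (asm) R_def, unfold ckn_rhs_def weighted_integral_def real_norm_def)
        (subst (asm) integral_nonneg_eq_0_iff_AE, auto)
    with ne0 have "AE x in lborel. u x = 0" by eventually_elim auto
    then show ?thesis ..
  next
    case False
    with AB have A: "A > 0" and B: "B > 0" by auto
    \<comment> \<open>The parameter for which Young's inequality is sharp in the integrated form.\<close>
    define r where "r = (A / B) powr (1 / p)"
    define t where "t = sgn c * r"
    have r: "r > 0" using A B by (simp add: r_def)
    have rp: "r powr p = A / B" using p A B by (simp add: r_def powr_powr)
    have abs_t: "\<bar>t\<bar> = r" using r c by (simp add: t_def abs_mult)
    have st: "signed_powr t (p - 1) * c = r powr (p - 1) * \<bar>c\<bar>"
      using r c by (simp add: signed_powr_def abs_t) (simp add: t_def sgn_mult mult_ac abs_sgn)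
    have key: "r powr (p - 1) * \<bar>c\<bar> * R = p * A"
    proof -
      have "r powr (p - 1) * (A powr (1 / p) * B powr ((p - 1) / p)) = A powr ((p - 1) / p + 1 / p)"
        using A B by (simp add: r_def powr_powr powr_divide powr_add)
      also have "(p - 1) / p + 1 / p = 1" using p by (simp add: field_simps)
      finally show ?thesis unfolding lhs using p A by (simp add: field_simps)
    qed
    let ?W = "\<lambda>x s. r powr (p - 1) * \<bar>c\<bar> * (\<bar>s\<bar> powr p / norm x powr ?s)"
    have sum: "1 * A + (p - 1) * r powr p * B = p * A"
    proof -
      have "(p - 1) * r powr p * B = (p - 1) * A" using B by (simp add: rp)
      then show ?thesis by (simp add: left_diff_distrib)
    qed
    have "(\<integral>\<^sup>+x. ennreal (young_gap p a b t x (u x) (g x) + ?W x (u x)) \<partial>lborel)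
      \<le> ennreal (1 * weighted_integral p (p * b) g + (p - 1) * r powr p * weighted_integral p (p * a) u)"
    proof (rule ckn_space_closure[OF p ug, where \<Phi> = "\<lambda>x s v. young_gap p a b t x s v + ?W x s"])
      show "continuous_on UNIV (\<lambda>z. young_gap p a b t x (fst z) (snd z) + ?W x (fst z))" if "x \<noteq> 0" for
          x :: "real^'n"
        using that p by (intro continuous_on_add continuous_young_gap continuous_on_mult
            continuous_on_divide continuous_on_const
          continuous_on_powr' continuous_on_rabs continuous_on_fst continuous_on_id) auto
      fix \<phi> :: "real^'n \<Rightarrow> real" assume \<phi>: "\<phi> \<in> test_functions (- {0})"
      have "has_bochner_integral lborel (\<lambda>x. young_gap p a b t x (\<phi> x) (gradient \<phi> x) + ?W x (\<phi> x))
        ((weighted_integral p (p * b) (gradient \<phi>) + (p - 1) * \<bar>t\<bar> powr p * weighted_integral p (p * a) \<phi>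
          - signed_powr t (p - 1) * ((p - 1) * a + b + 1 - real CARD('n)) * ckn_rhs p a b \<phi>)
          + r powr (p - 1) * \<bar>c\<bar> * ckn_rhs p a b \<phi>)"
        unfolding ckn_rhs_def[of p a b \<phi>] weighted_integral_def[of p ?s] real_norm_def
        by (intro has_bochner_integral_add has_bochner_integral_mult_right has_bochner_integral_integrable
          integrable_test[OF \<phi> p] integral_young_gap_test[OF \<phi> p, of a b t, unfolded ckn_rhs_def
              weighted_integral_def[of p ?s] real_norm_def])
      then have "has_bochner_integral lborel (\<lambda>x. young_gap p a b t x (\<phi> x) (gradient \<phi> x) + ?W x (\<phi> x))
        (1 * weighted_integral p (p * b) (gradient \<phi>) + (p - 1) * r powr p * weighted_integral p (p * a) \<phi>)"
        unfolding c_def[symmetric] st abs_t by simp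
      then have "(\<integral>\<^sup>+x. ennreal (young_gap p a b t x (\<phi> x) (gradient \<phi> x) + ?W x (\<phi> x)) \<partial>lborel)
        = ennreal (1 * weighted_integral p (p * b) (gradient \<phi>) + (p - 1) * r powr p
            * weighted_integral p (p * a) \<phi>)"
        by (subst nn_integral_eq_integral) (auto simp: has_bochner_integral_iff young_gap_nonneg[OF p])
      then show "(\<integral>\<^sup>+x. ennreal (young_gap p a b t x (\<phi> x) (gradient \<phi> x) + ?W x (\<phi> x)) \<partial>lborel)
        \<le> ennreal (1 * weighted_integral p (p * b) (gradient \<phi>) + (p - 1) * r powr p
            * weighted_integral p (p * a) \<phi>)"
        by simp
    qed (use p in auto)
    then have le: "(\<integral>\<^sup>+x. ennreal (young_gap p a b t x (u x) (g x) + ?W x (u x)) \<partial>lborel) \<le> ennreal (p * A)"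
      unfolding A_def[symmetric] B_def[symmetric] sum .
    have "(\<integral>\<^sup>+x. ennreal (?W x (u x)) \<partial>lborel) = ennreal (r powr (p - 1) * \<bar>c\<bar> * R)"
      unfolding R_def ckn_rhs_def weighted_integral_def real_norm_def
      using int by (subst nn_integral_eq_integral) (auto simp del: times_divide_eq_right intro!:
          integrable_mult_right)
    then have "(\<integral>\<^sup>+x. ennreal (young_gap p a b t x (u x) (g x) + ?W x (u x)) \<partial>lborel)
      = (\<integral>\<^sup>+x. ennreal (young_gap p a b t x (u x) (g x)) \<partial>lborel) + ennreal (p * A)"
      unfolding key by (simp add: young_gap_nonneg[OF p] nn_integral_add)
    with le have "(\<integral>\<^sup>+x. ennreal (young_gap p a b t x (u x) (g x)) \<partial>lborel) + ennreal (p * A)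
        \<le> 0 + ennreal (p * A)"
      by simp
    then have "(\<integral>\<^sup>+x. ennreal (young_gap p a b t x (u x) (g x)) \<partial>lborel) = 0"
      by (simp only: ennreal_add_left_cancel_le add.commute[of _ "ennreal (p * A)"]) simp
    then have "AE x in lborel. ennreal (young_gap p a b t x (u x) (g x)) = 0"
      by (subst (asm) nn_integral_0_iff_AE) auto
    with ne0 have "AE x in lborel. g x = (t * norm x powr (b - a - 1) * u x) *\<^sub>R x"
    proof eventually_elim
      fix x :: "real^'n" assume x: "x \<noteq> 0" "ennreal (young_gap p a b t x (u x) (g x)) = 0"
      then have "young_gap p a b t x (u x) (g x) = 0"
        using young_gap_nonneg[OF p, of a b t x "u x" "g x"] by (simp add: ennreal_eq_0_iff)
      then show "g x = (t * norm x powr (b - a - 1) * u x) *\<^sub>R x"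
        using young_gap_eq_0[OF p x(1), of t a b "u x" "g x"] abs_t r by auto
    qed
    moreover have "t * c > 0" using r c by (simp add: t_def mult.commute[of _ r] mult.assoc sgn_if
        mult_neg_neg)
    ultimately show ?thesis by blast
  qed
qed

text \<open>The product on the left of the inequality is not of the form required by the closure lemma. Young's
  inequality replaces it by a sum with a free parameter \<open>r\<close>, the sum passes to the completion, and optimising
  in \<open>r\<close> recovers the product.\<close>

lemma ckn_constant_completion:
  fixes u :: "real^'n::finite \<Rightarrow> real" and p a b C :: real
  assumes p: "p > 1" and ug: "(u, g) \<in> ckn_space p a b"
    and int: "integrable lborel (\<lambda>x. \<bar>u x\<bar> powr p / norm x powr ((p - 1) * a + b + 1))"
    and C: "C \<ge> 0" and const: "ckn_constant p a b C TYPE('n)"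
  shows "C * ckn_rhs p a b u \<le> ckn_lhs p a b u g"
proof -
  let ?s = "(p - 1) * a + b + 1"
  have "p * C * ckn_rhs p a b u / p \<le> ckn_lhs p a b u g"
    unfolding ckn_lhs_def
  proof (rule product_bound_from_scaled_sum)
    fix r :: real assume r: "r > 0"
    let ?k = "p * C * r powr (p - 1)"
    have "(\<integral>\<^sup>+x. ennreal (?k * (\<bar>u x\<bar> powr p / norm x powr ?s)) \<partial>lborel)
      \<le> ennreal (1 * weighted_integral p (p * b) g + (p - 1) * r powr p * weighted_integral p (p * a) u)"
    proof (rule ckn_space_closure[OF p ug, where \<Phi> = "\<lambda>x s v. ?k * (\<bar>s\<bar> powr p / norm x powr ?s)"])
      show "continuous_on UNIV (\<lambda>z. ?k * (\<bar>fst z\<bar> powr p / norm x powr ?s))" if "x \<noteq> 0" for x :: "real^'n"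
        using that p by (intro continuous_on_mult continuous_on_divide continuous_on_const
          continuous_on_powr' continuous_on_rabs continuous_on_fst continuous_on_id) auto
      fix \<phi> :: "real^'n \<Rightarrow> real" assume \<phi>: "\<phi> \<in> test_functions (- {0})"
      let ?A = "weighted_integral p (p * b) (gradient \<phi>)" and ?B = "weighted_integral p (p * a) \<phi>"
      have AB: "?A \<ge> 0" "?B \<ge> 0" by (simp_all add: weighted_integral_nonneg)
      have "(\<integral>\<^sup>+x. ennreal (?k * (\<bar>\<phi> x\<bar> powr p / norm x powr ?s)) \<partial>lborel) = ennreal (?k * ckn_rhs p a b \<phi>)"
        unfolding ckn_rhs_def weighted_integral_def real_norm_def using integrable_test[OF \<phi> p, of ?s] C p
        by (subst nn_integral_eq_integral) (auto simp del: times_divide_eq_right intro!: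
            integrable_mult_right)
      also have "?k * ckn_rhs p a b \<phi> = p * r powr (p - 1) * (C * ckn_rhs p a b \<phi>)" by simp
      also have "\<dots> \<le> p * r powr (p - 1) * ckn_lhs p a b \<phi> (gradient \<phi>)"
        using const \<phi> p by (intro mult_left_mono) (auto simp: ckn_constant_def)
      also have "\<dots> = p * ((r * ?B powr (1 / p)) powr (p - 1) * ?A powr (1 / p))"
        using r AB by (simp add: ckn_lhs_def powr_mult powr_powr)
      also have "\<dots> \<le> (?A powr (1 / p)) powr p + (p - 1) * (r * ?B powr (1 / p)) powr p"
        using r by (intro young_powr p) auto
      also have "\<dots> = 1 * ?A + (p - 1) * r powr p * ?B"
        using r AB p by (simp add: powr_mult powr_powr)
      finally show "(\<integral>\<^sup>+x. ennreal (?k * (\<bar>\<phi> x\<bar> powr p / norm x powr ?s)) \<partial>lborel)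
          \<le> ennreal (1 * ?A + (p - 1) * r powr p * ?B)"
        by (simp add: ennreal_leI)
    qed (use p in auto)
    moreover have "(\<integral>\<^sup>+x. ennreal (?k * (\<bar>u x\<bar> powr p / norm x powr ?s)) \<partial>lborel)
        = ennreal (?k * ckn_rhs p a b u)"
      unfolding ckn_rhs_def weighted_integral_def real_norm_def using int C p
      by (subst nn_integral_eq_integral) (auto simp del: times_divide_eq_right intro!:
          integrable_mult_right)
    ultimately have "ennreal (?k * ckn_rhs p a b u)
        \<le> ennreal (1 * weighted_integral p (p * b) g + (p - 1) * r powr p * weighted_integral p (p * a) u)"
      by (simp only:)
    moreover have "0 \<le> 1 * weighted_integral p (p * b) g + (p - 1) * r powr p
        * weighted_integral p (p * a) u"
      using p by (intro add_nonneg_nonneg mult_nonneg_nonneg weighted_integral_nonneg) auto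
    ultimately show "p * C * ckn_rhs p a b u * r powr (p - 1)
        \<le> weighted_integral p (p * b) g + (p - 1) * r powr p * weighted_integral p (p * a) u"
      by (simp add: ennreal_le_iff mult_ac)
  qed (use p weighted_integral_nonneg in auto)
  then show ?thesis using p by simp
qed

section \<open>Rigidity: a vanishing weak gradient forces local constancy\<close>

lemma pred_ball [measurable (raw)]:
  fixes f :: "'a \<Rightarrow> 'b::{metric_space, second_countable_topology}"
  assumes [measurable]: "f \<in> borel_measurable M"
  shows "Measurable.pred M (\<lambda>x. f x \<in> ball z r)" "Measurable.pred M (\<lambda>x. f x \<in> cball z r)"
  unfolding mem_ball mem_cball by measurable

text \<open>Translation estimate in \<open>L\<^sup>1\<close>: integrate the gradient along the segment from \<open>x\<close> to \<open>x + h\<close>, exchange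
  the integrals, and use that the translates of \<open>ball z r\<close> along the segment stay in
  \<open>ball z (2 * r)\<close>.\<close>

lemma nn_integral_segment_bound:
  fixes f :: "'a::euclidean_space \<Rightarrow> real"
  assumes deriv: "\<And>x. x \<in> ball z (2 * r) \<Longrightarrow> (f has_derivative (\<lambda>h. g x \<bullet> h)) (at x)"
    and cont: "continuous_on (ball z (2 * r)) g"
    and [measurable]: "g \<in> borel_measurable borel" and h: "norm h < r"
  shows "(\<integral>\<^sup>+x. indicator (ball z r) x * ennreal \<bar>f (x + h) - f x\<bar> \<partial>lborel)
    \<le> ennreal (norm h) * (\<integral>\<^sup>+x. indicator (ball z (2 * r)) x * ennreal (norm (g x)) \<partial>lborel)"
proof -
  let ?F = "\<lambda>x. indicator (ball z (2 * r)) x * ennreal (norm (g x))"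
  have [measurable]: "?F \<in> borel_measurable borel" by measurable
  have seg: "x + s *\<^sub>R h \<in> ball z (2 * r)" if "x \<in> ball z r" "0 \<le> s" "s \<le> 1" for x s
  proof -
    have "norm (s *\<^sub>R h) < r" using that h mult_left_le_one_le[of "norm h" s] by simp
    then show ?thesis
      using that norm_triangle_ineq4[of "z - x" "s *\<^sub>R h"] by (simp add: dist_norm algebra_simps)
  qed
  have "(\<integral>\<^sup>+x. indicator (ball z r) x * ennreal \<bar>f (x + h) - f x\<bar> \<partial>lborel)
    \<le> (\<integral>\<^sup>+x. (\<integral>\<^sup>+s. indicator {0..1} s * (ennreal (norm h) * ?F (x + s *\<^sub>R h)) \<partial>lborel) \<partial>lborel)"
  proof (rule nn_integral_mono)
    fix x
    show "indicator (ball z r) x * ennreal \<bar>f (x + h) - f x\<bar>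
        \<le> (\<integral>\<^sup>+s. indicator {0..1} s * (ennreal (norm h) * ?F (x + s *\<^sub>R h)) \<partial>lborel)"
    proof (cases "x \<in> ball z r")
      case True
      have "has_bochner_integral lborel (\<lambda>s. (g (x + s *\<^sub>R h) \<bullet> h) * indicator {0..1} s)
          (f (x + 1 *\<^sub>R h) - f (x + 0 *\<^sub>R h))"
      proof (rule has_bochner_integral_FTC_Icc_real)
        fix s :: real assume s: "0 \<le> s" "s \<le> 1"
        have "((\<lambda>s. x + s *\<^sub>R h) has_derivative (\<lambda>k. k *\<^sub>R h)) (at s)"
          by (auto intro!: derivative_eq_intros)
        from has_derivative_compose[OF this deriv[OF seg[OF True s]]]
        show "((\<lambda>s. f (x + s *\<^sub>R h)) has_real_derivative g (x + s *\<^sub>R h) \<bullet> h) (at s)"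
          by (simp add: has_field_derivative_def mult_commute_abs)
        have "isCont g (x + s *\<^sub>R h)"
          using cont seg[OF True s] by (simp add: continuous_on_eq_continuous_at)
        then have "isCont (\<lambda>s. g (x + s *\<^sub>R h)) s"
          by (rule isCont_o2[rotated]) (intro continuous_intros)
        then show "isCont (\<lambda>s. g (x + s *\<^sub>R h) \<bullet> h) s" by (intro continuous_intros)
      qed simp
      then have "ennreal (norm (f (x + h) - f x)) \<le> (\<integral>\<^sup>+s. ennreal
          (norm ((g (x + s *\<^sub>R h) \<bullet> h) * indicator {0..1} s)) \<partial>lborel)"
        using integral_norm_bound_ennreal[of lborel "\<lambda>s. (g (x + s *\<^sub>R h) \<bullet> h) * indicator {0..1} s"]
        by (simp add: has_bochner_integral_iff)
      also have "\<dots> \<le> (\<integral>\<^sup>+s. indicator {0..1} s * (ennreal (norm h) * ?F (x + s *\<^sub>R h)) \<partial>lborel)"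
      proof (rule nn_integral_mono)
        fix s :: real
        have "\<bar>g (x + s *\<^sub>R h) \<bullet> h\<bar> \<le> norm h * norm (g (x + s *\<^sub>R h))"
          using Cauchy_Schwarz_ineq2[of "g (x + s *\<^sub>R h)" h] by (simp add: mult.commute)
        then show "ennreal (norm ((g (x + s *\<^sub>R h) \<bullet> h) * indicator {0..1} s))
            \<le> indicator {0..1} s * (ennreal (norm h) * ?F (x + s *\<^sub>R h))"
          using seg[OF True, of s] by (auto simp: indicator_def ennreal_mult[symmetric] intro!: ennreal_leI)
      qed
      finally show ?thesis using True by simp
    qed simp
  qed
  also have "\<dots> = (\<integral>\<^sup>+s. (\<integral>\<^sup>+x. indicator {0..1} s * (ennreal (norm h) * ?F (x + s *\<^sub>R h)) \<partial>lborel) \<partial>lborel)"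
    by (rule lborel_pair.Fubini') measurable
  also have "\<dots> = (\<integral>\<^sup>+s. indicator {0..1::real} s * (ennreal (norm h) * (\<integral>\<^sup>+x. ?F x \<partial>lborel)) \<partial>lborel)"
  proof (intro nn_integral_cong)
    fix s :: real
    have "(\<integral>\<^sup>+x. ?F (x + s *\<^sub>R h) \<partial>lborel) = (\<integral>\<^sup>+x. ?F x \<partial>distr lborel borel ((+) (s *\<^sub>R h)))"
      by (subst nn_integral_distr) (auto simp: add.commute)
    also have "\<dots> = (\<integral>\<^sup>+x. ?F x \<partial>lborel)" by (simp only: lborel_distr_plus)
    finally show "(\<integral>\<^sup>+x. indicator {0..1} s * (ennreal (norm h) * ?F (x + s *\<^sub>R h)) \<partial>lborel)
        = indicator {0..1} s * (ennreal (norm h) * (\<integral>\<^sup>+x. ?F x \<partial>lborel))"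
      by (subst nn_integral_cmult, measurable, subst nn_integral_cmult) auto
  qed
  also have "\<dots> = ennreal (norm h) * (\<integral>\<^sup>+x. ?F x \<partial>lborel)"
    by (subst nn_integral_multc) auto
  finally show ?thesis .
qed

lemma AE_lborel_ex_in_open:
  fixes S :: "'a::euclidean_space set"
  assumes "AE x in lborel. P x" and S: "open S" "S \<noteq> {}"
  shows "\<exists>x\<in>S. P x"
proof (rule ccontr)
  assume "\<not> ?thesis"
  with assms(1) have "AE x in lborel. x \<notin> S" by (auto elim!: eventually_mono)
  then have "S \<in> null_sets lborel" using S by (subst AE_iff_null_sets) auto
  then have "negligible S" by (simp add: negligible_iff_null_sets null_sets_completionI)
  with S show False using open_not_negligible by blast
qed

text \<open>By Fubini's theorem almost every \<open>x\<close> satisfies \<open>v (x + h) = v x\<close> for almost every small \<open>h\<close>. A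
  single such \<open>x\<close> close to the centre determines \<open>v\<close> almost everywhere on the smaller ball.\<close>

lemma AE_const_on_ball_if_translation_invariant:
  fixes v :: "'a::euclidean_space \<Rightarrow> real"
  assumes [measurable]: "v \<in> borel_measurable borel" and r: "r > 0"
    and inv: "\<And>h. norm h < r \<Longrightarrow> (\<integral>\<^sup>+x. indicator (ball z r) x * ennreal \<bar>v (x + h) - v x\<bar> \<partial>lborel) = 0"
  shows "\<exists>c. AE x in lborel. x \<in> ball z (r / 2) \<longrightarrow> v x = c"
proof -
  let ?G = "\<lambda>x h. indicator (ball 0 r) h * (indicator (ball z r) x * ennreal \<bar>v (x + h) - v x\<bar>)"
  have "(\<integral>\<^sup>+x. (\<integral>\<^sup>+h. ?G x h \<partial>lborel) \<partial>lborel) = (\<integral>\<^sup>+h. (\<integral>\<^sup>+x. ?G x h \<partial>lborel) \<partial>lborel)"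
    by (rule lborel_pair.Fubini'[symmetric]) measurable
  also have "\<dots> = (\<integral>\<^sup>+h. 0 \<partial>(lborel :: 'a measure))"
  proof (intro nn_integral_cong)
    fix h :: 'a
    have "(\<integral>\<^sup>+x. ?G x h \<partial>lborel) = indicator (ball 0 r) h
        * (\<integral>\<^sup>+x. indicator (ball z r) x * ennreal \<bar>v (x + h) - v x\<bar> \<partial>lborel)"
      by (rule nn_integral_cmult) measurable
    also have "\<dots> = 0" using inv[of h] by (auto simp: indicator_def)
    finally show "(\<integral>\<^sup>+x. ?G x h \<partial>lborel) = 0" .
  qed
  finally have "(\<integral>\<^sup>+x. (\<integral>\<^sup>+h. ?G x h \<partial>lborel) \<partial>lborel) = 0" by simp
  then have "AE x in lborel. (\<integral>\<^sup>+h. ?G x h \<partial>lborel) = 0"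
    by (subst (asm) nn_integral_0_iff_AE) auto
  from AE_lborel_ex_in_open[OF this, of "ball z (r / 2)"] r
  obtain x where x: "x \<in> ball z (r / 2)" and "(\<integral>\<^sup>+h. ?G x h \<partial>lborel) = 0" by auto
  then have ae: "AE h in lborel. ?G x h = 0"
    by (subst (asm) nn_integral_0_iff_AE) auto
  have xr: "x \<in> ball z r" using x r by auto
  from ae have "AE h in lborel. norm h < r \<longrightarrow> v (x + h) = v x"
    by eventually_elim (use xr in \<open>auto simp: indicator_def split: if_splits\<close>)
  then have "AE h in lborel. norm ((x + h) - x) < r \<longrightarrow> v (x + h) = v x" by simp
  then have "AE y in distr lborel borel ((+) x). norm (y - x) < r \<longrightarrow> v y = v x"
    by (subst AE_distr_iff) auto
  then have "AE y in lborel. norm (y - x) < r \<longrightarrow> v y = v x"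
    by (simp only: lborel_distr_plus)
  then have "AE y in lborel. y \<in> ball z (r / 2) \<longrightarrow> v y = v x"
  proof eventually_elim
    fix y assume *: "norm (y - x) < r \<longrightarrow> v y = v x"
    show "y \<in> ball z (r / 2) \<longrightarrow> v y = v x"
      using * x dist_triangle_less_add[of z y "r / 2" x "r / 2"] dist_triangle2[of y x z]
          by (auto simp: dist_norm norm_minus_commute dist_commute)
  qed
  then show ?thesis by blast
qed

text \<open>The local constants agree on overlapping balls, since a nonempty open set is not a null set. Hence
  they form a locally constant function on a connected set, and countably many of the balls cover it.\<close>

lemma AE_const_if_locally_AE_const:
  fixes v :: "'a::euclidean_space \<Rightarrow> real"
  assumes S: "open S" "connected S"
    and loc: "\<And>z. z \<in> S \<Longrightarrow> \<exists>e>0. \<exists>c. AE x in lborel. x \<in> ball z e \<longrightarrow> v x = c"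
  shows "\<exists>c. AE x in lborel. x \<in> S \<longrightarrow> v x = c"
proof (cases "S = {}")
  case False
  then obtain z0 where z0: "z0 \<in> S" by blast
  define P where "P z e c \<longleftrightarrow> e > 0 \<and> ball z e \<subseteq> S \<and> (AE x in lborel. x \<in> ball z e \<longrightarrow> v x = c)" for z e c
  have "\<exists>e c. P z e c" if z: "z \<in> S" for z
  proof -
    from loc[OF z] obtain e c where e: "e > 0" "AE x in lborel. x \<in> ball z e \<longrightarrow> v x = c" by blast
    from S z obtain d where d: "d > 0" "ball z d \<subseteq> S" by (auto simp: open_contains_ball)
    have "AE x in lborel. x \<in> ball z (min d e) \<longrightarrow> v x = c" using e(2) by eventually_elim auto
    with d e have "P z (min d e) c" unfolding P_def by auto
    then show ?thesis by blast
  qed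
  then obtain e c where P: "\<And>z. z \<in> S \<Longrightarrow> P z (e z) (c z)" by metis
  have overlap: "c y = c z" if "y \<in> S" "z \<in> S" "y \<in> ball z (e z)" for y z
  proof -
    have "AE x in lborel. (x \<in> ball y (e y) \<longrightarrow> v x = c y) \<and> (x \<in> ball z (e z) \<longrightarrow> v x = c z)"
      using P[OF that(1)] P[OF that(2)] by (simp add: P_def)
    moreover have "y \<in> ball y (e y) \<inter> ball z (e z)" using P[OF that(1)] that(3) by (simp add: P_def)
    ultimately obtain x where "x \<in> ball y (e y) \<inter> ball z (e z)"
      "(x \<in> ball y (e y) \<longrightarrow> v x = c y) \<and> (x \<in> ball z (e z) \<longrightarrow> v x = c z)"
      using AE_lborel_ex_in_open[of _ "ball y (e y) \<inter> ball z (e z)"] by blast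
    then show ?thesis by auto
  qed
  have const: "c z = c z0" if "z \<in> S" for z
  proof (rule connected_local_const[OF S(2) that z0])
    show "\<forall>z\<in>S. eventually (\<lambda>y. c z = c y) (at z within S)"
    proof
      fix z assume z: "z \<in> S"
      have "eventually (\<lambda>y. y \<in> ball z (e z)) (at z within S)"
        using P[OF z] by (auto simp: P_def eventually_at_topological intro!: exI[of _ "ball z (e z)"])
      moreover have "eventually (\<lambda>y. y \<in> S) (at z within S)" by (simp add: eventually_at_filter)
      ultimately show "eventually (\<lambda>y. c z = c y) (at z within S)"
        by eventually_elim (use overlap z in auto)
    qed
  qed
  obtain D where D: "D \<subseteq> (\<lambda>z. ball z (e z)) ` S" "countable D" "\<Union>D = \<Union>((\<lambda>z. ball z (e z)) ` S)"
    by (rule Lindelof[of "(\<lambda>z. ball z (e z)) ` S"]) auto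
  have "AE x in lborel. \<forall>B\<in>D. x \<in> B \<longrightarrow> v x = c z0"
    unfolding AE_ball_countable[OF D(2)]
  proof
    fix B assume "B \<in> D"
    then obtain z where z: "z \<in> S" "B = ball z (e z)" using D(1) by blast
    with P[OF z(1)] const[OF z(1)] show "AE x in lborel. x \<in> B \<longrightarrow> v x = c z0" by (simp add: P_def)
  qed
  then have "AE x in lborel. x \<in> S \<longrightarrow> v x = c z0"
  proof eventually_elim
    fix x assume *: "\<forall>B\<in>D. x \<in> B \<longrightarrow> v x = c z0"
    show "x \<in> S \<longrightarrow> v x = c z0"
    proof
      assume "x \<in> S"
      then have "x \<in> \<Union>D" using P[of x] by (auto simp: D(3) P_def intro!: bexI[of _ x])
      with * show "v x = c z0" by blast
    qed
  qed
  then show ?thesis by blast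
qed simp

lemma le_add_powr:
  fixes y e p :: real
  assumes "p > 1" "e > 0" "y \<ge> 0"
  shows "y \<le> e + e powr (1 - p) * y powr p"
proof (cases "y \<le> e")
  case True
  then show ?thesis by (simp add: add_increasing2)
next
  case False
  then have "y = y powr (1 - p) * y powr p" using assms by (simp flip: powr_add)
  also have "\<dots> \<le> e powr (1 - p) * y powr p"
    using False assms by (intro mult_right_mono powr_mono2') auto
  finally show ?thesis using assms by linarith
qed

text \<open>Away from the origin the weight is harmless, and the elementary bound \<open>y \<le> d + d\<^sup>1\<^sup>-\<^sup>p y\<^sup>p\<close> with a
  small \<open>d\<close> takes the place of Hoelder's inequality.\<close>

lemma nn_integral_compact_tendsto_0:
  fixes f :: "nat \<Rightarrow> 'a::euclidean_space \<Rightarrow> 'b::{real_normed_vector, second_countable_topology}"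
      and p s :: real
  assumes p: "p > 1" and K: "compact K" "0 \<notin> K" and [measurable]: "\<And>k. f k \<in> borel_measurable borel"
    and lim: "(\<lambda>k. \<integral>\<^sup>+x. ennreal (norm (f k x) powr p / norm x powr s) \<partial>lborel) \<longlonglongrightarrow> 0"
  shows "(\<lambda>k. \<integral>\<^sup>+x. indicator K x * ennreal (norm (f k x)) \<partial>lborel) \<longlonglongrightarrow> 0"
proof (rule tendsto_zero_ennreal)
  fix e :: real assume e: "0 < e"
  have [measurable]: "K \<in> sets borel" using K by (simp add: compact_imp_closed)
  have "bounded ((\<lambda>x. norm x powr s) ` K)"
    using K by (intro compact_imp_bounded compact_continuous_image continuous_on_powr continuous_intros)
        auto
  then obtain L where L: "L > 0" "\<And>x. x \<in> K \<Longrightarrow> norm x powr s \<le> L"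
    by (force simp: bounded_pos)
  define m where "m = measure lborel K"
  have m: "emeasure lborel K = ennreal m" "m \<ge> 0"
    using emeasure_compact_finite[OF K(1)] by (auto simp: m_def emeasure_eq_ennreal_measure)
  define d where "d = e / (2 * (m + 1))"
  define c where "c = d powr (1 - p) * L"
  have d: "d > 0" using e m by (simp add: d_def)
  have c: "c > 0" using d L by (simp add: c_def)
  have dm: "d * m < e / 2" using e m by (simp add: d_def field_simps)
  have "eventually (\<lambda>k. (\<integral>\<^sup>+x. ennreal (norm (f k x) powr p / norm x powr s) \<partial>lborel) < ennreal
      (e / (2 * c))) sequentially"
    using order_tendstoD(2)[OF lim] e c by simp
  then show "eventually (\<lambda>k. (\<integral>\<^sup>+x. indicator K x * ennreal (norm (f k x)) \<partial>lborel) < ennreal e)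
      sequentially"
  proof eventually_elim
    fix k assume small: "(\<integral>\<^sup>+x. ennreal (norm (f k x) powr p / norm x powr s) \<partial>lborel) < ennreal
        (e / (2 * c))"
    have "(\<integral>\<^sup>+x. indicator K x * ennreal (norm (f k x)) \<partial>lborel)
      \<le> (\<integral>\<^sup>+x. ennreal d * indicator K x + ennreal c * ennreal (norm (f k x) powr p / norm x powr s)
          \<partial>lborel)"
    proof (rule nn_integral_mono)
      fix x
      show "indicator K x * ennreal (norm (f k x)) \<le> ennreal d * indicator K x + ennreal c
          * ennreal (norm (f k x) powr p / norm x powr s)"
      proof (cases "x \<in> K")
        case True
        have pos: "norm x powr s > 0" using True K by auto
        have "norm (f k x) \<le> d + d powr (1 - p) * norm (f k x) powr p" by (rule le_add_powr[OF p d]) simp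
        also have "\<dots> \<le> d + c * (norm (f k x) powr p / norm x powr s)"
          using L(2)[OF True] pos d L(1) by (auto simp: c_def field_simps intro!: mult_left_mono
              mult_right_mono)
        finally show ?thesis using True d c by (simp add: ennreal_mult[symmetric]
            ennreal_plus[symmetric] ennreal_leI del: ennreal_plus)
      qed simp
    qed
    also have "\<dots> = ennreal d * ennreal m + ennreal c * (\<integral>\<^sup>+x. ennreal
        (norm (f k x) powr p / norm x powr s) \<partial>lborel)"
      by (simp add: nn_integral_add nn_integral_cmult m)
    also have "\<dots> \<le> ennreal d * ennreal m + ennreal c * ennreal (e / (2 * c))"
      using small by (intro add_left_mono mult_left_mono) auto
    also have "\<dots> = ennreal (d * m + e / 2)"
      using d m c e by (simp add: ennreal_mult[symmetric] ennreal_plus[symmetric] del: ennreal_plus)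
    also have "\<dots> < ennreal e" using dm e by (intro ennreal_lessI) auto
    finally show "(\<integral>\<^sup>+x. indicator K x * ennreal (norm (f k x)) \<partial>lborel) < ennreal e" .
  qed
qed

text \<open>The hypothesis on \<open>g\<close> says that \<open>u / w\<close> has weak gradient zero. For approximating test functions \<open>\<phi> k\<close>
  the quotients \<open>\<phi> k / w\<close> converge to \<open>u / w\<close> and their gradients to \<open>0\<close>, both in \<open>L\<^sup>1\<close> on balls away from the
  origin, so the translation estimate shows that \<open>u / w\<close> is locally invariant under translations.\<close>

lemma ckn_space_multiple_on:
  fixes u w :: "real^'n::finite \<Rightarrow> real" and p a b :: real
  assumes p: "p > 1" and ug: "(u, g) \<in> ckn_space p a b"
    and w: "\<And>x. x \<noteq> 0 \<Longrightarrow> w x > 0"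
    and deriv: "\<And>x. x \<noteq> 0 \<Longrightarrow> (w has_derivative (\<lambda>h. G x \<bullet> h)) (at x)"
    and contG: "continuous_on (- {0}) G"
    and [measurable]: "w \<in> borel_measurable borel" "G \<in> borel_measurable borel"
    and eq: "AE x in lborel. g x = (u x / w x) *\<^sub>R G x"
    and S: "open S" "connected S" "0 \<notin> S"
  shows "ae_multiple_on S u w"
proof -
  note [measurable] = ckn_space_measurable[OF p ug]
  from ug obtain \<phi> where \<phi>: "\<And>k::nat. \<phi> k \<in> test_functions (- {0})"
    and lim: "(\<lambda>k. \<integral>\<^sup>+x. ennreal (norm (\<phi> k x - u x) powr p / norm x powr (p * a)) \<partial>lborel) \<longlonglongrightarrow> 0"
      "(\<lambda>k. \<integral>\<^sup>+x. ennreal (norm (gradient (\<phi> k) x - g x) powr p / norm x powr (p * b)) \<partial>lborel) \<longlonglongrightarrow> 0"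
    by (auto simp: ckn_space_def)
  note [measurable] = test_function_measurable[OF \<phi>]
  have sm: "smooth (\<phi> k)" for k using \<phi> by (simp add: test_functions_def)
  have contw: "continuous_on (- {0}) w"
    using deriv by (intro continuous_at_imp_continuous_on ballI has_derivative_continuous) auto
  define v where "v x = u x / w x" for x
  define V where "V k x = \<phi> k x / w x" for k x
  define H where "H k x = (1 / w x) *\<^sub>R gradient (\<phi> k) x - (\<phi> k x / (w x)\<^sup>2) *\<^sub>R G x" for k x
  have [measurable]: "v \<in> borel_measurable borel" "V k \<in> borel_measurable borel" "H k \<in> borel_measurable
      borel" for k
    unfolding v_def V_def H_def by measurable
  have V_deriv: "(V k has_derivative (\<lambda>h. H k x \<bullet> h)) (at x)" if "x \<noteq> 0" for k x
  proof -
    have wx: "w x \<noteq> 0" using w[OF that] by simp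
    have "((\<lambda>x. \<phi> k x / w x) has_derivative (\<lambda>h. ((gradient (\<phi> k) x \<bullet> h) * w x - \<phi> k x * (G x \<bullet> h))
        / (w x * w x))) (at x)"
      using wx by (intro has_derivative_divide' smooth_has_derivative sm deriv that)
    also have "(\<lambda>h. ((gradient (\<phi> k) x \<bullet> h) * w x - \<phi> k x * (G x \<bullet> h)) / (w x * w x)) = (\<lambda>h. H k x \<bullet> h)"
      using wx by (auto simp: H_def inner_diff_left field_simps power2_eq_square)
    finally show ?thesis by (simp add: V_def[abs_def])
  qed
  have H_cont: "continuous_on (- {0}) (H k)" for k
    unfolding H_def using w
    by (intro continuous_intros smooth_continuous smooth_continuous_gradient sm contw contG) force+
  have "\<exists>c. AE x in lborel. x \<in> S \<longrightarrow> v x = c"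
  proof (rule AE_const_if_locally_AE_const[OF S(1,2)])
    fix z assume "z \<in> S"
    then have z: "z \<noteq> 0" using S by auto
    define r where "r = norm z / 4"
    have r: "r > 0" using z by (simp add: r_def)
    let ?K = "cball z (2 * r)"
    have K0: "0 \<notin> ?K" using z by (simp add: r_def dist_norm)
    have "bounded ((\<lambda>x. 1 / w x + norm (G x) / (w x)\<^sup>2) ` ?K)"
    proof (intro compact_imp_bounded compact_continuous_image)
      have "continuous_on (- {0}) (\<lambda>x. 1 / w x + norm (G x) / (w x)\<^sup>2)"
        using w by (intro continuous_intros contw contG) force+
      then show "continuous_on ?K (\<lambda>x. 1 / w x + norm (G x) / (w x)\<^sup>2)"
        by (rule continuous_on_subset) (use K0 in auto)
    qed simp
    then obtain L where L: "L > 0" "\<And>x. x \<in> ?K \<Longrightarrow> norm (1 / w x + norm (G x) / (w x)\<^sup>2) \<le> L"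
      by (force simp: bounded_pos)
    have L1: "1 / w x \<le> L" "norm (G x) / (w x)\<^sup>2 \<le> L" if "x \<in> ?K" for x
    proof -
      have "w x > 0" using that K0 by (intro w) auto
      then have "0 \<le> 1 / w x" "0 \<le> norm (G x) / (w x)\<^sup>2" by auto
      with L(2)[OF that] show "1 / w x \<le> L" "norm (G x) / (w x)\<^sup>2 \<le> L"
        unfolding real_norm_def by linarith+
    qed
    let ?d1 = "\<lambda>k. \<integral>\<^sup>+x. indicator ?K x * ennreal (norm (\<phi> k x - u x)) \<partial>lborel"
    let ?d2 = "\<lambda>k. \<integral>\<^sup>+x. indicator ?K x * ennreal (norm (gradient (\<phi> k) x - g x)) \<partial>lborel"
    have d: "?d1 \<longlonglongrightarrow> 0" "?d2 \<longlonglongrightarrow> 0"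
      by (rule nn_integral_compact_tendsto_0[OF p _ K0 _ lim(1)]; simp)
        (rule nn_integral_compact_tendsto_0[OF p _ K0 _ lim(2)]; simp)
    let ?B = "\<lambda>k x. ennreal L * (indicator ?K x * ennreal (norm (gradient (\<phi> k) x - g x))
        + indicator ?K x * ennreal (norm (\<phi> k x - u x)))"
    let ?F = "\<lambda>k x. indicator ?K x * ennreal \<bar>V k x - v x\<bar>"
    have F: "(\<integral>\<^sup>+x. ?F k x \<partial>lborel) \<le> ennreal L * ?d1 k" for k
    proof -
      have "(\<integral>\<^sup>+x. ?F k x \<partial>lborel) \<le> (\<integral>\<^sup>+x. ennreal L * (indicator ?K x * ennreal (norm (\<phi> k x - u x)))
          \<partial>lborel)"
      proof (rule nn_integral_mono)
        fix x
        show "?F k x \<le> ennreal L * (indicator ?K x * ennreal (norm (\<phi> k x - u x)))"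
        proof (cases "x \<in> ?K")
          case True
          have wx: "w x > 0" using True K0 by (intro w) auto
          have "\<bar>V k x - v x\<bar> = 1 / w x * norm (\<phi> k x - u x)"
            using wx by (simp add: V_def v_def flip: diff_divide_distrib)
          also have "\<dots> \<le> L * norm (\<phi> k x - u x)" using L1(1)[OF True] by (rule mult_right_mono) simp
          finally show ?thesis using True L by (simp add: ennreal_mult[symmetric] ennreal_leI)
        qed simp
      qed
      also have "\<dots> = ennreal L * ?d1 k" by (rule nn_integral_cmult) measurable
      finally show ?thesis .
    qed
    have H: "(\<integral>\<^sup>+x. indicator (ball z (2 * r)) x * ennreal (norm (H k x)) \<partial>lborel)
        \<le> ennreal L * (?d2 k + ?d1 k)" for k
    proof -
      have "(\<integral>\<^sup>+x. indicator (ball z (2 * r)) x * ennreal (norm (H k x)) \<partial>lborel)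
        \<le> (\<integral>\<^sup>+x. ?B k x \<partial>lborel)"
      proof (rule nn_integral_mono_AE)
        from eq show "AE x in lborel. indicator (ball z (2 * r)) x * ennreal (norm (H k x))
          \<le> ?B k x"
        proof eventually_elim
          fix x assume g: "g x = (u x / w x) *\<^sub>R G x"
          show "indicator (ball z (2 * r)) x * ennreal (norm (H k x))
            \<le> ?B k x"
          proof (cases "x \<in> ball z (2 * r)")
            case True
            then have K: "x \<in> ?K" by simp
            have wx: "w x > 0" using K K0 by (intro w) auto
            have "H k x = (1 / w x) *\<^sub>R (gradient (\<phi> k) x - g x) - ((\<phi> k x - u x) / (w x)\<^sup>2) *\<^sub>R G x"
              using wx by (simp add: H_def g algebra_simps diff_divide_distrib power2_eq_square)
            also have "norm \<dots> \<le> norm ((1 / w x) *\<^sub>R (gradient (\<phi> k) x - g x))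
                + norm (((\<phi> k x - u x) / (w x)\<^sup>2) *\<^sub>R G x)"
              by (rule norm_triangle_ineq4)
            also have "\<dots> = 1 / w x * norm (gradient (\<phi> k) x - g x) + norm (G x) / (w x)\<^sup>2
                * norm (\<phi> k x - u x)"
              using wx by simp
            also have "\<dots> \<le> L * norm (gradient (\<phi> k) x - g x) + L * norm (\<phi> k x - u x)"
              using L1[OF K] by (intro add_mono mult_right_mono) auto
            finally have "norm (H k x) \<le> L * (norm (gradient (\<phi> k) x - g x) + norm (\<phi> k x - u x))"
              by (simp add: algebra_simps)
            then show ?thesis using True K L
              by (simp add: ennreal_mult[symmetric] ennreal_plus[symmetric] ennreal_leI del: ennreal_plus)
          qed simp
        qed
      qed
      also have "\<dots> = ennreal L * (?d2 k + ?d1 k)"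
        by (simp add: nn_integral_cmult nn_integral_add)
      finally show ?thesis .
    qed
    have "\<exists>c. AE x in lborel. x \<in> ball z (r / 2) \<longrightarrow> v x = c"
    proof (rule AE_const_on_ball_if_translation_invariant)
      fix h :: "real^'n" assume h: "norm h < r"
      let ?I = "\<integral>\<^sup>+x. indicator (ball z r) x * ennreal \<bar>v (x + h) - v x\<bar> \<partial>lborel"
      let ?e = "\<lambda>k. ennreal L * ?d1 k + (ennreal (norm h) * (ennreal L * (?d2 k + ?d1 k)) + ennreal L
          * ?d1 k)"
      have "?I \<le> ?e k" for k
      proof -
        have "?I \<le> (\<integral>\<^sup>+x. ?F k (x + h) + (indicator (ball z r) x * ennreal \<bar>V k (x + h) - V k x\<bar>
            + ?F k x) \<partial>lborel)"
        proof (rule nn_integral_mono)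
          fix x
          show "indicator (ball z r) x * ennreal \<bar>v (x + h) - v x\<bar>
              \<le> ?F k (x + h) + (indicator (ball z r) x * ennreal \<bar>V k (x + h) - V k x\<bar> + ?F k x)"
          proof (cases "x \<in> ball z r")
            case True
            have "x \<in> ?K" using True r by simp
            moreover have "x + h \<in> ?K"
              using True h norm_triangle_ineq4[of "z - x" h] by (simp add: dist_norm algebra_simps)
            moreover have "\<bar>v (x + h) - v x\<bar> \<le> \<bar>V k (x + h) - v (x + h)\<bar>
                + (\<bar>V k (x + h) - V k x\<bar> + \<bar>V k x - v x\<bar>)"
              by linarith
            ultimately show ?thesis using True
              by (simp add: ennreal_plus[symmetric] ennreal_leI del: ennreal_plus)
          qed simp
        qed
        also have "\<dots> = (\<integral>\<^sup>+x. ?F k (x + h) \<partial>lborel) + ((\<integral>\<^sup>+x. indicator (ball z r) x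
            * ennreal \<bar>V k (x + h) - V k x\<bar> \<partial>lborel) + (\<integral>\<^sup>+x. ?F k x \<partial>lborel))"
          by (simp add: nn_integral_add)
        also have "(\<integral>\<^sup>+x. ?F k (x + h) \<partial>lborel) = (\<integral>\<^sup>+x. ?F k x \<partial>distr lborel borel ((+) h))"
          by (subst nn_integral_distr) (auto simp: add.commute)
        also have "\<dots> = (\<integral>\<^sup>+x. ?F k x \<partial>lborel)" by (simp only: lborel_distr_plus)
        also have "(\<integral>\<^sup>+x. ?F k x \<partial>lborel) + ((\<integral>\<^sup>+x. indicator (ball z r) x * ennreal \<bar>V k (x + h)
            - V k x\<bar> \<partial>lborel) + (\<integral>\<^sup>+x. ?F k x \<partial>lborel)) \<le> ?e k"
        proof (intro add_mono F)
          have sub: "ball z (2 * r) \<subseteq> - {0}" using K0 by auto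
          have "(\<integral>\<^sup>+x. indicator (ball z r) x * ennreal \<bar>V k (x + h) - V k x\<bar> \<partial>lborel)
            \<le> ennreal (norm h) * (\<integral>\<^sup>+x. indicator (ball z (2 * r)) x * ennreal (norm (H k x)) \<partial>lborel)"
            by (rule nn_integral_segment_bound[OF V_deriv _ _ h])
              (use K0 continuous_on_subset[OF H_cont sub] in auto)
          also have "\<dots> \<le> ennreal (norm h) * (ennreal L * (?d2 k + ?d1 k))" by (intro mult_left_mono H) simp
          finally show "(\<integral>\<^sup>+x. indicator (ball z r) x * ennreal \<bar>V k (x + h) - V k x\<bar> \<partial>lborel)
            \<le> ennreal (norm h) * (ennreal L * (?d2 k + ?d1 k))" .
        qed
        finally show ?thesis .
      qed
      moreover have "?e \<longlonglongrightarrow> ennreal L * 0 + (ennreal (norm h) * (ennreal L * (0 + 0)) + ennreal L * 0)"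
        by (intro tendsto_add ennreal_tendsto_cmult d) auto
      ultimately have "?I \<le> ennreal L * 0 + (ennreal (norm h) * (ennreal L * (0 + 0)) + ennreal L * 0)"
        by (intro tendsto_lowerbound[of ?e]) auto
      then show "?I = 0" by simp
    qed (use r in auto)
    then show "\<exists>e>0. \<exists>c. AE x in lborel. x \<in> ball z e \<longrightarrow> v x = c"
      using r by (intro exI[of _ "r / 2"]) auto
  qed
  then obtain c where "AE x in lborel. x \<in> S \<longrightarrow> v x = c" by blast
  then have "AE x in lborel. x \<in> S \<longrightarrow> u x = c * w x"
  proof eventually_elim
    fix x assume *: "x \<in> S \<longrightarrow> v x = c"
    show "x \<in> S \<longrightarrow> u x = c * w x"
    proof
      assume x: "x \<in> S"
      then have "w x > 0" using S(3) by (intro w) auto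
      with * x show "u x = c * w x" by (auto simp: v_def field_simps)
    qed
  qed
  then show ?thesis by (auto simp: ae_multiple_on_def)
qed

section \<open>Smooth cutoffs of the profile in logarithmic coordinates\<close>

text \<open>The functions that arise by differentiating the standard flat function \<open>exp (- 1 / y)\<close>, which is the case
  \<open>m = 0\<close>.\<close>

definition flat_exp :: "nat \<Rightarrow> real \<Rightarrow> real" where
  "flat_exp m y = (if y > 0 then exp (- 1 / y) / y ^ m else 0)"

lemma flat_exp_has_derivative:
  "(flat_exp m has_real_derivative flat_exp (m + 2) y - m * flat_exp (m + 1) y) (at y)"
proof -
  consider "y > 0" | "y = 0" | "y < 0" by linarith
  then show ?thesis
  proof cases
    case 1
    have "((\<lambda>y. exp (- 1 / y) / y ^ m) has_real_derivative
        (exp (- 1 / y) * (1 / y\<^sup>2) * y ^ m - exp (- 1 / y) * (m * y ^ (m - 1))) / (y ^ m * y ^ m)) (at y)"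
      using 1 by (auto intro!: derivative_eq_intros simp: power2_eq_square)
    also have "(exp (- 1 / y) * (1 / y\<^sup>2) * y ^ m - exp (- 1 / y) * (m * y ^ (m - 1))) / (y ^ m * y ^ m)
        = flat_exp (m + 2) y - m * flat_exp (m + 1) y"
      using 1 by (cases m) (auto simp: flat_exp_def field_simps power2_eq_square)
    finally show ?thesis
      by (rule has_field_derivative_transform_within_open[where S
          = "{0<..}"]) (use 1 in \<open>auto simp: flat_exp_def\<close>)
  next
    case 2
    have "((\<lambda>h. inverse h ^ (m + 1) / exp (inverse h)) \<longlongrightarrow> (0::real)) (at_right 0)"
      by (rule filterlim_compose[OF tendsto_power_div_exp_0 filterlim_inverse_at_top_right])
    then have "((\<lambda>h. flat_exp m h / h) \<longlongrightarrow> 0) (at_right 0)"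
      by (rule Lim_transform_eventually)
        (auto simp: flat_exp_def eventually_at_filter exp_minus field_simps intro!: always_eventually)
    moreover have "((\<lambda>h. flat_exp m h / h) \<longlongrightarrow> 0) (at_left 0)"
      by (rule Lim_transform_eventually[OF tendsto_const]) (auto simp: flat_exp_def eventually_at_filter)
    ultimately have "((\<lambda>h. flat_exp m h / h) \<longlongrightarrow> 0) (at 0)" by (rule filterlim_split_at[rotated])
    then show ?thesis using 2 by (simp add: DERIV_def flat_exp_def)
  next
    case 3
    have "((\<lambda>y. 0) has_real_derivative flat_exp (m + 2) y - m * flat_exp (m + 1) y) (at y)"
      using 3 by (simp add: flat_exp_def)
    then show ?thesis
      by (rule has_field_derivative_transform_within_open[where S
          = "{..<0}"]) (use 3 in \<open>auto simp: flat_exp_def\<close>)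
  qed
qed

text \<open>An algebra of functions of \<open>l = ln |x|\<close> that contains the profile multiplied by a bump and is closed
  under differentiation. It is used to obtain derivatives of all orders at once.\<close>

inductive_set profile_algebra :: "real \<Rightarrow> real \<Rightarrow> real \<Rightarrow> (real \<Rightarrow> real) set" for \<beta> t k where
  const: "(\<lambda>_. c) \<in> profile_algebra \<beta> t k"
| id: "(\<lambda>l. l) \<in> profile_algebra \<beta> t k"
| exp: "(\<lambda>l. exp (c * l)) \<in> profile_algebra \<beta> t k"
| profile: "(\<lambda>l. exp (t * exp (\<beta> * l) / \<beta>)) \<in> profile_algebra \<beta> t k"
| bump: "(\<lambda>l. flat_exp m (1 - (l / k)\<^sup>2)) \<in> profile_algebra \<beta> t k"
| add: "F \<in> profile_algebra \<beta> t k \<Longrightarrow> G \<in> profile_algebra \<beta> t k \<Longrightarrow> (\<lambda>l. F l + G l) \<in> profile_algebra \<beta> t k"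
| mult: "F \<in> profile_algebra \<beta> t k \<Longrightarrow> G \<in> profile_algebra \<beta> t k \<Longrightarrow> (\<lambda>l. F l * G l) \<in> profile_algebra \<beta> t k"

lemma profile_algebra_derivative:
  assumes "\<beta> \<noteq> 0" "k \<noteq> 0" "F \<in> profile_algebra \<beta> t k"
  obtains F' where "F' \<in> profile_algebra \<beta> t k" "\<And>l. (F has_real_derivative F' l) (at l)"
proof -
  have "\<exists>F'\<in>profile_algebra \<beta> t k. \<forall>l. (F has_real_derivative F' l) (at l)"
    using assms(3)
  proof induction
    case (const c)
    show ?case by (intro bexI[of _ "\<lambda>_. 0"] profile_algebra.const) simp
  next
    case id
    show ?case by (intro bexI[of _ "\<lambda>_. 1"] profile_algebra.const) auto
  next
    case (exp c)
    show ?case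
      by (intro bexI[of _ "\<lambda>l. c * exp (c * l)"] profile_algebra.intros) (auto intro!: derivative_eq_intros)
  next
    case profile
    show ?case
      by (intro bexI[of _ "\<lambda>l. (t * exp (\<beta> * l)) * exp (t * exp (\<beta> * l) / \<beta>)"] profile_algebra.intros)
        (use assms(1) in \<open>auto intro!: derivative_eq_intros\<close>)
  next
    case (bump m)
    let ?y = "\<lambda>l. 1 - (l / k)\<^sup>2"
    have "((\<lambda>l. flat_exp m (?y l)) has_real_derivative
        (flat_exp (m + 2) (?y l) + - real m * flat_exp (m + 1) (?y l)) * (- 2 / k\<^sup>2 * l)) (at l)" for l
    proof -
      have "(?y has_real_derivative (- 2 / k\<^sup>2 * l)) (at l)"
        using assms(2) by (auto intro!: derivative_eq_intros simp: power2_eq_square)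
      from DERIV_chain2[OF flat_exp_has_derivative this] show ?thesis by simp
    qed
    then show ?case
      by (intro bexI[of _ "\<lambda>l. (flat_exp (m + 2) (?y l) + - real m * flat_exp (m + 1) (?y l))
          * (- 2 / k\<^sup>2 * l)"]
          profile_algebra.intros) blast
  next
    case (add F G)
    then obtain F' G' where "F' \<in> profile_algebra \<beta> t k" "G' \<in> profile_algebra \<beta> t k"
      "\<And>l. (F has_real_derivative F' l) (at l)" "\<And>l. (G has_real_derivative G' l) (at l)" by blast
    then show ?case
      by (intro bexI[of _ "\<lambda>l. F' l + G' l"] profile_algebra.intros) (auto intro: DERIV_add)
  next
    case (mult F G)
    then obtain F' G' where "F' \<in> profile_algebra \<beta> t k" "G' \<in> profile_algebra \<beta> t k"
      "\<And>l. (F has_real_derivative F' l) (at l)" "\<And>l. (G has_real_derivative G' l) (at l)" by blast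
    with mult show ?case
      by (intro bexI[of _ "\<lambda>l. F' l * G l + G' l * F l"] profile_algebra.intros) (auto intro: DERIV_mult)
  qed
  then show thesis using that by blast
qed

lemma has_derivative_log_radial:
  fixes x :: "'a::euclidean_space"
  assumes x: "x \<noteq> 0" and F: "(F has_real_derivative F') (at (ln (norm x)))"
  shows "((\<lambda>x. F (ln (norm x))) has_derivative (\<lambda>h. ((F' / (norm x)\<^sup>2) *\<^sub>R x) \<bullet> h)) (at x)"
proof -
  have "((\<lambda>x. ln (norm x)) has_derivative (\<lambda>h. (sgn x \<bullet> h) * (1 / norm x))) (at x)"
    using x by (auto intro!: derivative_eq_intros has_derivative_norm simp: field_simps inner_commute)
  from has_derivative_compose[OF this F[unfolded has_field_derivative_def]]
  show ?thesis using x by (simp add: sgn_div_norm power2_eq_square field_simps)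
qed

text \<open>The partial derivatives of \<open>F (ln |x|)\<close> are coordinates times \<open>F' (ln |x|) exp (- 2 ln |x|)\<close>. Allowing
  coordinate factors therefore makes the class closed under partial derivatives. The support condition
  keeps the functions away from the singularity at the origin.\<close>

inductive_set log_radial_functions :: "real \<Rightarrow> real \<Rightarrow> real \<Rightarrow> (real^'n::finite \<Rightarrow> real) set" for \<beta> t k where
  radial: "F \<in> profile_algebra \<beta> t k \<Longrightarrow> (\<And>l. \<bar>l\<bar> > k \<Longrightarrow> F l = 0) \<Longrightarrow>
    (\<lambda>x. if x = 0 then 0 else F (ln (norm x))) \<in> log_radial_functions \<beta> t k"
| coordinate: "f \<in> log_radial_functions \<beta> t k \<Longrightarrow> (\<lambda>x. x $ i * f x) \<in> log_radial_functions \<beta> t k"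
| add: "f \<in> log_radial_functions \<beta> t k \<Longrightarrow> g \<in> log_radial_functions \<beta> t k \<Longrightarrow>
    (\<lambda>x. f x + g x) \<in> log_radial_functions \<beta> t k"

lemma partial_eqI:
  assumes "(f has_derivative f') (at x)"
  shows "partial i f x = f' (axis i 1)"
  using frechet_derivative_at[OF assms] by (simp add: partial_def)

lemma log_radial_functions_partial:
  fixes f :: "real^'n::finite \<Rightarrow> real"
  assumes \<beta>: "\<beta> \<noteq> 0" and k: "k > 0" and f: "f \<in> log_radial_functions \<beta> t k"
  shows "f differentiable (at x) \<and> partial i f \<in> log_radial_functions \<beta> t k"
  using f
proof (induction arbitrary: x)
  case (radial F)
  obtain F' where F': "F' \<in> profile_algebra \<beta> t k" "\<And>l. (F has_real_derivative F' l) (at l)"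
    using profile_algebra_derivative[OF \<beta> _ radial(1)] k by auto
  have F'0: "F' l = 0" if "\<bar>l\<bar> > k" for l
  proof -
    have "((\<lambda>_. 0) has_real_derivative F' l) (at l)"
      by (rule has_field_derivative_transform_within_open[where S = "- {- k..k}", OF F'(2)])
        (use that radial(2) in \<open>auto simp: abs_if open_Compl split: if_splits\<close>)
    then show ?thesis using DERIV_unique DERIV_const by blast
  qed
  let ?f = "\<lambda>x :: real^'n. if x = 0 then 0 else F (ln (norm x))"
  let ?H = "\<lambda>l. F' l * exp (- 2 * l)"
  let ?g = "\<lambda>x :: real^'n. if x = 0 then 0 else ?H (ln (norm x))"
  have D: "(?f has_derivative (\<lambda>h. ?g x * (x \<bullet> h))) (at x)" for x
  proof (cases "x = 0")
    case True
    have "((\<lambda>_. 0) has_derivative (\<lambda>h. ?g x * (x \<bullet> h))) (at x)" using True by simp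
    then show ?thesis
    proof (rule has_derivative_transform_within_open[where s = "ball 0 (exp (- k))"])
      fix y :: "real^'n" assume y: "y \<in> ball 0 (exp (- k))"
      show "0 = ?f y"
      proof (cases "y = 0")
        case False
        then have "ln (norm y) < - k" using y ln_less_cancel_iff[of "norm y" "exp (- k)"] by simp
        then show ?thesis using radial(2) k by simp
      qed simp
    qed (use True in auto)
  next
    case False
    have "exp (- 2 * ln (norm x)) = 1 / (norm x)\<^sup>2"
      using False by (simp add: exp_minus exp_double field_simps)
    then have "((\<lambda>x. F (ln (norm x))) has_derivative (\<lambda>h. ?g x * (x \<bullet> h))) (at x)"
      using has_derivative_log_radial[OF False F'(2)] False by simp
    then show ?thesis
      by (rule has_derivative_transform_within_open[where s = "- {0}"]) (use False in auto)
  qed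
  have "partial i ?f = (\<lambda>x. x $ i * ?g x)"
    using partial_eqI[OF D] by (auto simp: inner_axis)
  moreover have "?g \<in> log_radial_functions \<beta> t k"
    using F'0 F'(1) by (intro log_radial_functions.radial profile_algebra.intros) auto
  ultimately show ?case using D by (auto simp: differentiable_def intro: log_radial_functions.coordinate)
next
  case (coordinate f j)
  have D: "((\<lambda>x. x $ j * f x) has_derivative (\<lambda>h. x $ j * (gradient f x \<bullet> h) + h $ j * f x)) (at x)" for x
    using coordinate by (intro has_derivative_mult has_derivative_gradient
        bounded_linear_imp_has_derivative bounded_linear_vec_nth) auto
  have "partial i (\<lambda>x. x $ j * f x) = (\<lambda>x. x $ j * partial i f x + (if i = j then f x else 0))"
  proof
    fix x
    have "axis i (1::real) $ j = (if i = j then 1 else 0)" by (simp add: axis_def)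
    then show "partial i (\<lambda>x. x $ j * f x) x = x $ j * partial i f x + (if i = j then f x else 0)"
      using partial_eqI[OF D] by (simp add: inner_axis gradient_def)
  qed
  moreover have "(\<lambda>x. x $ j * partial i f x + (if i = j then f x else 0)) \<in> log_radial_functions \<beta> t k"
    using coordinate by (cases "i = j") (auto intro!: log_radial_functions.add
        log_radial_functions.coordinate)
  ultimately show ?case using D by (auto simp: differentiable_def)
next
  case (add f g)
  have D: "((\<lambda>x. f x + g x) has_derivative (\<lambda>h. (gradient f x \<bullet> h) + (gradient g x \<bullet> h))) (at x)" for x
    using add by (intro has_derivative_add has_derivative_gradient) auto
  have "partial i (\<lambda>x. f x + g x) = (\<lambda>x. partial i f x + partial i g x)"
    using partial_eqI[OF D] by (auto simp: inner_axis gradient_def)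
  with add D show ?case by (auto simp: differentiable_def intro: log_radial_functions.add)
qed

lemma log_radial_test_function:
  fixes F :: "real \<Rightarrow> real"
  assumes \<beta>: "\<beta> \<noteq> 0" and k: "k > 0" and F: "F \<in> profile_algebra \<beta> t k" "\<And>l. \<bar>l\<bar> > k \<Longrightarrow> F l = 0"
  shows "(\<lambda>x :: real^'n::finite. if x = 0 then 0 else F (ln (norm x))) \<in> test_functions (- {0})"
proof -
  let ?f = "\<lambda>x :: real^'n. if x = 0 then 0 else F (ln (norm x))"
  have "fold partial is f \<in> log_radial_functions \<beta> t k"
    if "f \<in> log_radial_functions \<beta> t k" for "is" and f :: "real^'n \<Rightarrow> real"
    using that by (induction "is" arbitrary: f) (auto simp: log_radial_functions_partial[OF \<beta> k])
  moreover have "?f \<in> log_radial_functions \<beta> t k" by (rule log_radial_functions.radial[OF F])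
  ultimately have "fold partial is ?f \<in> log_radial_functions \<beta> t k" for "is" by blast
  then have "smooth ?f"
    unfolding smooth_def differentiable_on_def using log_radial_functions_partial[OF \<beta> k] by blast
  moreover have "support_on UNIV ?f \<subseteq> cball 0 (exp k) - ball 0 (exp (- k))"
  proof
    fix x assume "x \<in> support_on UNIV ?f"
    then have x: "x \<noteq> 0" and "\<not> \<bar>ln (norm x)\<bar> > k" using F(2)
        by (auto simp: support_on_def split: if_splits)
    then have "ln (norm x) \<le> k" "- k \<le> ln (norm x)" by auto
    then have "norm x \<le> exp k" "exp (- k) \<le> norm x"
      using x by (metis exp_le_cancel_iff exp_ln zero_less_norm_iff)+
    then show "x \<in> cball 0 (exp k) - ball 0 (exp (- k))" by simp
  qed
  then have "closure (support_on UNIV ?f) \<subseteq> cball 0 (exp k) - ball 0 (exp (- k))"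
    by (rule closure_minimal) (auto intro: closed_Diff)
  moreover from this have "compact (closure (support_on UNIV ?f))"
    by (meson bounded_cball bounded_subset compact_closure Diff_subset subset_trans closure_subset)
  ultimately show ?thesis unfolding test_functions_def by (auto simp: subset_iff)
qed

section \<open>The profile belongs to the completion\<close>

lemma nn_integral_FTC_bounded:
  fixes f F :: "real \<Rightarrow> real"
  assumes [measurable]: "f \<in> borel_measurable borel"
    and F: "\<And>r. r > 0 \<Longrightarrow> (F has_real_derivative f r) (at r)"
    and f: "\<And>r. r > 0 \<Longrightarrow> f r \<ge> 0" and B: "\<And>r. \<bar>F r\<bar> \<le> B"
  shows "(\<integral>\<^sup>+r. ennreal (f r) * indicator {0<..} r \<partial>lborel) \<le> ennreal (2 * B)"
proof -
  \<comment> \<open>Exhausting the open half-line by compact intervals avoids limits of \<open>F\<close> at both ends.\<close>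
  let ?I = "\<lambda>n. {1 / real (Suc n) .. real (Suc n)}"
  have "(\<lambda>n. ennreal (f r) * indicator (?I n) r) \<longlonglongrightarrow> ennreal (f r) * indicator {0<..} r" for r
  proof (rule tendsto_eventually)
    show "eventually (\<lambda>n. ennreal (f r) * indicator (?I n) r
        = ennreal (f r) * indicator {0<..} r) sequentially"
    proof (cases "r > 0")
      case True
      obtain m where m: "max r (1 / r) \<le> real m" using real_arch_simple by blast
      have "r \<in> ?I n" if "n \<ge> m" for n
      proof -
        have "r \<le> real (Suc n)" "1 / r \<le> real (Suc n)" using m that by auto
        with True show ?thesis by (auto simp: field_simps)
      qed
      with True show ?thesis by (auto simp: eventually_sequentially indicator_def)
    next
      case False
      have "r < 1 / real (Suc n)" for n
      proof -
        have "0 < 1 / real (Suc n)" by simp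
        with False show ?thesis by linarith
      qed
      then show ?thesis using False by (auto simp: indicator_def not_le)
    qed
  qed
  then have "(\<integral>\<^sup>+r. ennreal (f r) * indicator {0<..} r \<partial>lborel)
      = (\<integral>\<^sup>+r. liminf (\<lambda>n. ennreal (f r) * indicator (?I n) r) \<partial>lborel)"
    by (intro nn_integral_cong lim_imp_Liminf[symmetric]) auto
  also have "\<dots> \<le> liminf (\<lambda>n. \<integral>\<^sup>+r. ennreal (f r) * indicator (?I n) r \<partial>lborel)"
    by (rule nn_integral_liminf) measurable
  also have "\<dots> \<le> ennreal (2 * B)"
  proof (rule Liminf_le, simp, intro always_eventually allI)
    fix n
    have pos: "r > 0" if "1 / real (Suc n) \<le> r" for r
      by (rule less_le_trans[OF _ that]) simp
    have le: "1 / real (Suc n) \<le> real (Suc n)" by (rule order_trans[of _ 1]) auto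
    have "(\<integral>\<^sup>+r. ennreal (f r) * indicator (?I n) r \<partial>lborel) = ennreal (F (Suc n) - F (1 / real (Suc n)))"
      by (intro nn_integral_FTC_Icc F f pos le) auto
    also have "\<dots> \<le> ennreal (2 * B)"
      using B[of "real (Suc n)"] B[of "1 / real (Suc n)"] by (intro ennreal_leI) linarith
    finally show "(\<integral>\<^sup>+r. ennreal (f r) * indicator (?I n) r \<partial>lborel) \<le> ennreal (2 * B)" .
  qed
  finally show ?thesis .
qed

text \<open>With \<open>d = n - s\<close> the radial integrand is \<open>r\<^sup>d\<^sup>-\<^sup>1 exp (- \<kappa> r\<^sup>\<beta>)\<close>. As \<open>\<beta>\<close> and \<open>d\<close> have the same sign, the
  exponential is at most a multiple of \<open>1 / (1 + c\<^sup>2 r\<^sup>2\<^sup>d)\<close>, and the resulting bound has the bounded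
  primitive \<open>arctan (c r\<^sup>d) / (c d)\<close>. This treats both signs of \<open>\<beta>\<close> without splitting the half-line.\<close>

lemma integrable_exp_norm_powr:
  fixes \<kappa> \<beta> s :: real
  defines "n \<equiv> DIM('a::euclidean_space)"
  assumes \<kappa>: "\<kappa> > 0" and s: "\<beta> * (real n - s) > 0"
  shows "integrable lborel (\<lambda>x :: 'a. exp (- \<kappa> * norm x powr \<beta>) / norm x powr s)"
proof -
  define d where "d = real n - s"
  \<comment> \<open>Chosen so that \<open>(r\<^sup>\<beta>)\<^sup>m = r\<^sup>2\<^sup>d\<close>.\<close>
  define m where "m = 2 * d / \<beta>"
  have d: "d \<noteq> 0" "\<beta> \<noteq> 0" and m: "m > 0"
    using s by (auto simp: m_def d_def zero_less_mult_iff divide_pos_pos divide_neg_neg)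
  have n: "n > 0" by (simp add: n_def)
  define c where "c = \<kappa> powr (m / 2)"
  have c: "c > 0" "c\<^sup>2 = \<kappa> powr m" using \<kappa> by (auto simp: c_def powr_powr simp flip: powr_numeral)
  define K where "K = 1 + m powr m"
  have K: "K > 0" by (simp add: K_def add_pos_nonneg)
  define h where "h r = r powr (d - 1) / (1 + (c * r powr d)\<^sup>2)" for r
  have [measurable]: "h \<in> borel_measurable borel" unfolding h_def by measurable
  define \<omega> where "\<omega> = n * unit_ball_vol n"
  have \<omega>: "\<omega> \<ge> 0" by (simp add: \<omega>_def)
  let ?A = "\<lambda>r. ennreal (\<omega> * r ^ (n - 1)) * indicator {0..} r * ennreal (exp (- \<kappa> * r powr \<beta>) / r powr s)"
  let ?B = "\<lambda>r. ennreal (\<omega> * K) * (ennreal (h r) * indicator {0<..} r)"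
  have decay: "exp (- \<kappa> * r powr \<beta>) \<le> K / (1 + (c * r powr d)\<^sup>2)" if "r > 0" for r
  proof -
    define y where "y = \<kappa> * r powr \<beta>"
    have y: "y > 0" using \<kappa> that by (simp add: y_def)
    have "y / m \<le> exp (y / m)" using exp_ge_add_one_self[of "y / m"] by linarith
    then have "(y / m) powr m \<le> exp (y / m) powr m" using y m by (intro powr_mono2) auto
    also have "\<dots> = exp y" using m by (simp add: exp_powr_real)
    finally have "y powr m \<le> m powr m * exp y" using y m by (simp add: powr_divide field_simps)
    moreover have "1 \<le> exp y" using y by simp
    ultimately have "1 + y powr m \<le> exp y + m powr m * exp y" by linarith
    then have "1 + y powr m \<le> K * exp y" by (simp add: K_def distrib_right)
    moreover have "y powr m = (c * r powr d)\<^sup>2"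
      using \<kappa> that c d by (simp add: y_def powr_mult powr_powr power_mult_distrib m_def flip: powr_numeral)
        (simp add: powr_powr mult.commute flip: powr_numeral)
    moreover have "1 + (c * r powr d)\<^sup>2 > 0" by (simp add: add_pos_nonneg)
    ultimately show ?thesis by (simp add: y_def exp_minus field_simps)
  qed
  have "(\<integral>\<^sup>+x. ennreal (norm (exp (- \<kappa> * norm (x :: 'a) powr \<beta>) / norm x powr s)) \<partial>lborel)
    = (\<integral>\<^sup>+x. (\<lambda>r. ennreal (exp (- \<kappa> * r powr \<beta>) / r powr s)) (norm (x :: 'a)) \<partial>lborel)"
    by simp
  also have "\<dots> = (\<integral>\<^sup>+r. ?A r \<partial>lborel)"
    by (subst nn_integral_radial) (auto simp: n_def \<omega>_def)
  also have "\<dots> \<le> (\<integral>\<^sup>+r. ?B r \<partial>lborel)"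
  proof (rule nn_integral_mono_AE)
    have "AE r in lborel. r \<noteq> (0::real)" by (rule AE_lborel_singleton)
    then show "AE r in lborel. ?A r
        \<le> ?B r"
    proof eventually_elim
      fix r :: real assume "r \<noteq> 0"
      then consider "r < 0" | "r > 0" by linarith
      then show "?A r
        \<le> ?B r"
      proof cases
        case 2
        have "r ^ (n - 1) / r powr s = r powr (d - 1)"
          using 2 n by (simp add: d_def powr_diff powr_realpow[symmetric] of_nat_diff)
        moreover have "\<omega> * r ^ (n - 1) * (exp (- \<kappa> * r powr \<beta>) / r powr s)
            = \<omega> * (r ^ (n - 1) / r powr s * exp (- \<kappa> * r powr \<beta>))"
          by simp
        ultimately have "\<omega> * r ^ (n - 1) * (exp (- \<kappa> * r powr \<beta>) / r powr s)
            = \<omega> * (r powr (d - 1) * exp (- \<kappa> * r powr \<beta>))"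
          by (simp only:)
        also have "\<dots> \<le> \<omega> * (r powr (d - 1) * (K / (1 + (c * r powr d)\<^sup>2)))"
          using decay[OF 2] \<omega> by (intro mult_left_mono) auto
        also have "\<dots> = \<omega> * K * h r" by (simp add: h_def)
        finally show ?thesis using 2 \<omega> K by (simp add: ennreal_mult[symmetric] h_def ennreal_leI)
      qed simp
    qed
  qed
  also have "\<dots> = ennreal (\<omega> * K) * (\<integral>\<^sup>+r. ennreal (h r) * indicator {0<..} r \<partial>lborel)"
    by (rule nn_integral_cmult) measurable
  also have "\<dots> \<le> ennreal (\<omega> * K) * ennreal (2 * ((pi / 2) / (\<bar>c * d\<bar>)))"
  proof (intro mult_left_mono nn_integral_FTC_bounded)
    fix r :: real
    show "((\<lambda>r. arctan (c * r powr d) / (c * d)) has_real_derivative h r) (at r)" if "r > 0"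
    proof -
      have "((\<lambda>r. c * r powr d) has_real_derivative c * (d * r powr (d - 1))) (at r)"
        using that by (auto intro!: derivative_eq_intros)
      from DERIV_cdivide[OF DERIV_chain2[OF DERIV_arctan this], of "c * d"]
      show ?thesis
        by (rule DERIV_cong) (use c(1) d in \<open>simp add: h_def inverse_eq_divide\<close>)
    qed
    show "\<bar>arctan (c * r powr d) / (c * d)\<bar> \<le> (pi / 2) / \<bar>c * d\<bar>"
      unfolding abs_divide using arctan_bounded[of "c * r powr d"]
      by (intro divide_right_mono) (auto simp: abs_le_iff)
  qed (auto simp: h_def)
  also have "\<dots> < \<infinity>" by (simp add: ennreal_mult_less_top)
  finally show ?thesis by (simp add: integrable_iff_bounded)
qed

lemma nn_integral_log_annulus:
  fixes k :: real
  defines "n \<equiv> DIM('a::euclidean_space)"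
  assumes k: "k > 0"
  shows "(\<integral>\<^sup>+x. ennreal (indicator {- k..k} (ln (norm (x :: 'a))) / norm x powr n) \<partial>lborel)
      = ennreal (n * unit_ball_vol n * (2 * k))"
proof -
  have n: "n > 0" by (simp add: n_def)
  let ?A = "\<lambda>r. ennreal (n * unit_ball_vol n * r ^ (n - 1)) * indicator {0..} r
      * ennreal (indicator {- k..k} (ln r) / r powr n)"
  let ?B = "\<lambda>r. ennreal (n * unit_ball_vol n * (1 / r)) * indicator {exp (- k)..exp k} r"
  have "(\<integral>\<^sup>+x. ennreal (indicator {- k..k} (ln (norm (x :: 'a))) / norm x powr n) \<partial>lborel)
    = (\<integral>\<^sup>+r. ?A r \<partial>lborel)"
    unfolding n_def by (rule nn_integral_radial[where f
        = "\<lambda>r. ennreal (indicator {- k..k} (ln r) / r powr _)"]) measurable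
  also have "\<dots> = (\<integral>\<^sup>+r. ?B r \<partial>lborel)"
  proof (rule nn_integral_cong_AE)
    have "AE r in lborel. r \<noteq> (0::real)" by (rule AE_lborel_singleton)
    then show "AE r in lborel. ?A r
      = ?B r"
    proof eventually_elim
      fix r :: real assume "r \<noteq> 0"
      then consider "r < 0" | "r > 0" by linarith
      then show "?A r
        = ?B r"
      proof cases
        case 1
        then have "\<not> exp (- k) \<le> r" using exp_gt_zero[of "- k"] by linarith
        with 1 show ?thesis by simp
      next
        case 2
        have "- k \<le> ln r \<longleftrightarrow> exp (- k) \<le> r" "ln r \<le> k \<longleftrightarrow> r \<le> exp k"
          using 2 by (metis exp_le_cancel_iff exp_ln)+
        then have "ln r \<in> {- k..k} \<longleftrightarrow> r \<in> {exp (- k)..exp k}" by simp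
        moreover have "n * unit_ball_vol n * r ^ (n - 1) / r powr n = n * unit_ball_vol n * (1 / r)"
        proof -
          have "r powr n = r ^ (n - 1) * r"
            using 2 n power_minus_mult[of n r] by (simp add: powr_realpow)
          then show ?thesis using 2 by simp
        qed
        ultimately show ?thesis using 2 by (auto simp: indicator_def ennreal_mult[symmetric])
      qed
    qed
  qed
  also have "\<dots> = ennreal (n * unit_ball_vol n * ln (exp k) - n * unit_ball_vol n * ln (exp (- k)))"
  proof (rule nn_integral_FTC_Icc[where F = "\<lambda>r. n * unit_ball_vol n * ln r"])
    fix r assume "r \<in> {exp (- k)..exp k}"
    then have "exp (- k) \<le> r" by simp
    then have r: "r > 0" using exp_gt_zero[of "- k"] by linarith
    show "((\<lambda>r. n * unit_ball_vol n * ln r) has_real_derivative n * unit_ball_vol n * (1 / r)) (at r)"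
      using r by (intro DERIV_cmult) (auto intro!: derivative_eq_intros)
    show "0 \<le> n * unit_ball_vol n * (1 / r)" using r by simp
  qed (use k in auto)
  finally show ?thesis by (simp add: algebra_simps)
qed

text \<open>The factor \<open>exp 1\<close> normalises the value at \<open>l = 0\<close> to \<open>1\<close>. As \<open>k\<close> grows the
  values tend to \<open>1\<close>, and the derivative is of size \<open>1 / k\<close>.\<close>

definition log_cutoff :: "real \<Rightarrow> real \<Rightarrow> real" where
  "log_cutoff k l = exp 1 * flat_exp 0 (1 - (l / k)\<^sup>2)"

definition log_cutoff_deriv :: "real \<Rightarrow> real \<Rightarrow> real" where
  "log_cutoff_deriv k l = exp 1 * (flat_exp 2 (1 - (l / k)\<^sup>2) * (- 2 / k\<^sup>2 * l))"

lemma one_minus_square_le_0: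
  fixes l k :: real
  assumes "k > 0" "\<bar>l\<bar> > k"
  shows "\<not> 1 - (l / k)\<^sup>2 > 0"
proof -
  have "1 \<le> \<bar>l / k\<bar>" using assms by simp
  then have "1\<^sup>2 \<le> \<bar>l / k\<bar>\<^sup>2" by (intro power_mono) auto
  then have "1 \<le> (l / k)\<^sup>2" by (simp only: power2_abs power_one)
  then show ?thesis by simp
qed

lemma
  fixes k l :: real
  assumes k: "k > 0"
  shows log_cutoff_bounds: "0 \<le> log_cutoff k l" "log_cutoff k l \<le> 1"
    and log_cutoff_eq_0: "\<bar>l\<bar> > k \<Longrightarrow> log_cutoff k l = 0"
    and log_cutoff_has_derivative: "(log_cutoff k has_real_derivative log_cutoff_deriv k l) (at l)"
    and log_cutoff_deriv_bound: "\<bar>log_cutoff_deriv k l\<bar> \<le> 4 * exp 1 / k * indicator {- k..k} l"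
proof -
  let ?y = "1 - (l / k)\<^sup>2"
  show "0 \<le> log_cutoff k l" by (simp add: log_cutoff_def flat_exp_def)
  show "log_cutoff k l \<le> 1"
  proof (cases "?y > 0")
    case True
    have "1 \<le> 1 / ?y" using True by (simp add: field_simps)
    then have "exp 1 * exp (- 1 / ?y) \<le> (1::real)" by (simp flip: exp_add)
    with True show ?thesis by (simp add: log_cutoff_def flat_exp_def)
  qed (simp add: log_cutoff_def flat_exp_def)
  show "log_cutoff k l = 0" if "\<bar>l\<bar> > k"
    using one_minus_square_le_0[OF k that] by (simp add: log_cutoff_def flat_exp_def)
  have "((\<lambda>l. 1 - (l / k)\<^sup>2) has_real_derivative (- 2 / k\<^sup>2 * l)) (at l)"
    using k by (auto intro!: derivative_eq_intros simp: power2_eq_square)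
  from DERIV_cmult[OF DERIV_chain2[OF flat_exp_has_derivative[of 0] this], of "exp 1"]
  show "(log_cutoff k has_real_derivative log_cutoff_deriv k l) (at l)"
    by (simp add: log_cutoff_def[abs_def] log_cutoff_deriv_def numeral_2_eq_2)
  show "\<bar>log_cutoff_deriv k l\<bar> \<le> 4 * exp 1 / k * indicator {- k..k} l"
  proof (cases "\<bar>l\<bar> > k")
    case True
    then show ?thesis using one_minus_square_le_0[OF k True] k
        by (simp add: log_cutoff_deriv_def flat_exp_def)
  next
    case False
    have flat: "0 \<le> flat_exp 2 y" "flat_exp 2 y \<le> 2" for y
    proof -
      show "0 \<le> flat_exp 2 y" by (simp add: flat_exp_def)
      show "flat_exp 2 y \<le> 2"
      proof (cases "y > 0")
        case True
        have "1 + 1 / y + (1 / y)\<^sup>2 / 2 \<le> exp (1 / y)" using True by (intro exp_lower_Taylor_quadratic) simp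
        moreover have "0 \<le> 1 + 1 / y" using True by simp
        ultimately have "(1 / y)\<^sup>2 \<le> 2 * exp (1 / y)" by linarith
        then show ?thesis using True by (simp add: flat_exp_def exp_minus field_simps)
      qed (simp add: flat_exp_def)
    qed
    have "\<bar>- 2 / k\<^sup>2 * l\<bar> \<le> 2 / k"
      using False k by (simp add: abs_mult power2_eq_square field_simps)
    then have "flat_exp 2 ?y * \<bar>- 2 / k\<^sup>2 * l\<bar> \<le> 2 * (2 / k)" using flat[of ?y] by (intro mult_mono) auto
    then have "exp 1 * (flat_exp 2 ?y * \<bar>- 2 / k\<^sup>2 * l\<bar>) \<le> exp 1 * (2 * (2 / k))"
        by (rule mult_left_mono) simp
    moreover have "\<bar>log_cutoff_deriv k l\<bar> = exp 1 * (flat_exp 2 ?y * \<bar>- 2 / k\<^sup>2 * l\<bar>)"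
      using flat(1)[of ?y] by (simp add: log_cutoff_deriv_def abs_mult)
    ultimately have "\<bar>log_cutoff_deriv k l\<bar> \<le> exp 1 * (2 * (2 / k))" by (simp only:)
    moreover have "indicator {- k..k} l = (1::real)" using False
        by (auto simp: indicator_def abs_le_iff not_less)
    ultimately show ?thesis by (simp add: mult.commute)
  qed
qed

lemma log_cutoff_tendsto: "(\<lambda>n. log_cutoff (real (Suc n)) l) \<longlonglongrightarrow> 1"
proof -
  have "isCont (flat_exp 0) 1" using flat_exp_has_derivative by (rule DERIV_isCont)
  moreover have "(\<lambda>n. 1 - (l / real (Suc n))\<^sup>2) \<longlonglongrightarrow> 1 - 0\<^sup>2"
    by (intro tendsto_intros LIMSEQ_Suc lim_const_over_n)
  ultimately have "(\<lambda>n. flat_exp 0 (1 - (l / real (Suc n))\<^sup>2)) \<longlonglongrightarrow> flat_exp 0 1"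
    by (intro isCont_tendsto_compose[of 1 "flat_exp 0"]) auto
  then have "(\<lambda>n. exp 1 * flat_exp 0 (1 - (l / real (Suc n))\<^sup>2)) \<longlonglongrightarrow> exp 1 * flat_exp 0 1"
    by (intro tendsto_intros)
  moreover have "exp 1 * flat_exp 0 1 = (1::real)" by (simp add: flat_exp_def flip: exp_add)
  ultimately show ?thesis by (simp add: log_cutoff_def)
qed

lemma ckn_profile_log:
  fixes x :: "real^'n::finite"
  assumes "x \<noteq> 0"
  shows "ckn_profile a b t x = exp (t * exp ((b + 1 - a) * ln (norm x)) / (b + 1 - a))"
  using assms by (simp add: ckn_profile_def powr_def)

lemma ckn_profile_has_derivative:
  fixes x :: "real^'n::finite" and a b t D :: real
  assumes x: "x \<noteq> 0" and \<beta>: "b + 1 - a \<noteq> 0"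
  shows "((\<lambda>x. D * ckn_profile a b t x) has_derivative
    (\<lambda>h. ((D * t * norm x powr (b - a - 1) * ckn_profile a b t x) *\<^sub>R x) \<bullet> h)) (at x)"
proof -
  let ?\<beta> = "b + 1 - a"
  let ?P = "\<lambda>l. D * exp (t * exp (?\<beta> * l) / ?\<beta>)"
  have "(?P has_real_derivative D * (t * exp (?\<beta> * l) * exp (t * exp (?\<beta> * l) / ?\<beta>))) (at l)" for l
    using \<beta> by (auto intro!: derivative_eq_intros)
  from has_derivative_log_radial[OF x this]
  have "((\<lambda>x. ?P (ln (norm x))) has_derivative
    (\<lambda>h. ((D * (t * norm x powr ?\<beta> * ckn_profile a b t x) / (norm x)\<^sup>2) *\<^sub>R x) \<bullet> h)) (at x)"
    using x by (simp add: ckn_profile_log powr_def)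
  moreover have "norm x powr ?\<beta> / (norm x)\<^sup>2 = norm x powr (b - a - 1)"
    using x by (simp add: powr_diff powr_add power2_eq_square field_simps)
  then have "D * (t * norm x powr ?\<beta> * ckn_profile a b t x) / (norm x)\<^sup>2
      = D * t * norm x powr (b - a - 1) * ckn_profile a b t x"
    using x by (simp add: field_simps)
  ultimately have "((\<lambda>x. ?P (ln (norm x))) has_derivative
    (\<lambda>h. ((D * t * norm x powr (b - a - 1) * ckn_profile a b t x) *\<^sub>R x) \<bullet> h)) (at x)" by simp
  then show ?thesis
    by (rule has_derivative_transform_within_open[where s
        = "- {0}"]) (use x in \<open>auto simp: ckn_profile_log\<close>)
qed

lemma ckn_profile_pos: "ckn_profile a b t x > 0"
  by (simp add: ckn_profile_def)

lemma measurable_ckn_profile [measurable]: "ckn_profile a b t \<in> borel_measurable borel"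
  unfolding ckn_profile_def[abs_def] by measurable

lemma gradient_ckn_profile:
  fixes x :: "real^'n::finite"
  assumes "x \<noteq> 0" "b + 1 - a \<noteq> 0"
  shows "gradient (\<lambda>x. D * ckn_profile a b t x) x = (D * t * norm x powr (b - a - 1)
      * ckn_profile a b t x) *\<^sub>R x"
  by (intro gradient_eqI ckn_profile_has_derivative assms)

lemma measurable_gradient_ckn_profile:
  assumes "b + 1 - a \<noteq> 0"
  shows "gradient (\<lambda>x :: real^'n::finite. D * ckn_profile a b t x) \<in> borel_measurable borel"
proof -
  let ?g = "gradient (\<lambda>x :: real^'n. D * ckn_profile a b t x)"
  have "?g = (\<lambda>x. if x = 0 then ?g 0 else (D * t * norm x powr (b - a - 1) * ckn_profile a b t x) *\<^sub>R x)"
    by (rule ext) (simp add: gradient_ckn_profile[OF _ assms])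
  also have "\<dots> \<in> borel_measurable borel" by measurable
  finally show ?thesis .
qed

lemma continuous_ckn_profile_gradient:
  fixes D :: real
  assumes "b + 1 - a \<noteq> 0"
  shows "continuous_on (- {0 :: real^'n::finite}) (gradient (\<lambda>x. D * ckn_profile a b t x))"
proof -
  have "continuous_on (- {0 :: real^'n}) (\<lambda>x. (D * t * norm x powr (b - a - 1) * ckn_profile a b t x)
      *\<^sub>R x)"
    unfolding ckn_profile_def using assms by (intro continuous_intros) auto
  then show ?thesis
    using gradient_ckn_profile[OF _ assms] by (subst continuous_on_cong) auto
qed

lemma integrable_ckn_profile:
  fixes a b t p s D :: real
  assumes p: "p > 1" and t: "t * (b + 1 - a) < 0" and s: "(b + 1 - a) * (real CARD('n::finite) - s) > 0"
  shows "integrable lborel (\<lambda>x :: real^'n. \<bar>D * ckn_profile a b t x\<bar> powr p / norm x powr s)"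
proof -
  let ?\<kappa> = "- (p * t / (b + 1 - a))"
  have \<kappa>: "?\<kappa> > 0" using p t by (auto simp: mult_less_0_iff divide_pos_neg divide_neg_pos
      zero_less_divide_iff divide_less_0_iff)
  have eq: "\<bar>D * ckn_profile a b t x\<bar> powr p / norm x powr s
      = \<bar>D\<bar> powr p * (exp (- ?\<kappa> * norm x powr (b + 1 - a)) / norm x powr s)" for x :: "real^'n"
    by (simp add: abs_mult powr_mult ckn_profile_def exp_powr_real mult_ac)
  show ?thesis unfolding eq
    by (intro integrable_mult_right integrable_exp_norm_powr) (use \<kappa> s in auto)
qed

lemma ckn_exponent_signs:
  fixes a b p N :: real
  assumes p: "p > 1" and \<beta>: "b + 1 - a \<noteq> 0" and crit: "(b + 1 - a) * (N - p * (b + 1)) \<ge> 0"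
  shows "(b + 1 - a) * (N - p * a) > 0" "(b + 1 - a) * (N - ((p - 1) * a + b + 1)) > 0"
proof -
  let ?\<beta> = "b + 1 - a"
  have sq: "?\<beta> * ?\<beta> > 0" using \<beta> unfolding zero_less_mult_iff by linarith
  have "?\<beta> * (N - p * a) = ?\<beta> * (N - p * (b + 1)) + p * (?\<beta> * ?\<beta>)" by (simp add: algebra_simps)
  moreover have "p * (?\<beta> * ?\<beta>) > 0" using p sq by simp
  ultimately show "?\<beta> * (N - p * a) > 0" using crit by linarith
  have "?\<beta> * (N - ((p - 1) * a + b + 1)) = ?\<beta> * (N - p * (b + 1)) + (p - 1) * (?\<beta> * ?\<beta>)"
      by (simp add: algebra_simps)
  moreover have "(p - 1) * (?\<beta> * ?\<beta>) > 0" using p sq by simp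
  ultimately show "?\<beta> * (N - ((p - 1) * a + b + 1)) > 0" using crit by linarith
qed

text \<open>The gradient of the truncated profile differs from that of the profile by two terms. One contains
  \<open>1 - \<chi>\<close> and vanishes in the limit by dominated convergence. The other contains \<open>\<chi>'\<close> and is of order
  \<open>k\<^sup>-\<^sup>p\<close> times an integral over a logarithmic annulus, which grows at most linearly in \<open>k\<close>.\<close>

lemma ckn_space_ckn_profile:
  fixes a b t p D :: real
  assumes p: "p > 1" and t: "t * (b + 1 - a) < 0"
    and crit: "(b + 1 - a) * (real CARD('n::finite) - p * (b + 1)) \<ge> 0"
  shows "((\<lambda>x :: real^'n. D * ckn_profile a b t x), gradient (\<lambda>x. D * ckn_profile a b t x)) \<in> ckn_space
      p a b"
proof -
  let ?N = "real CARD('n)" and ?\<beta> = "b + 1 - a" and ?q = "p * (b + 1)"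
  let ?w = "ckn_profile a b t :: real^'n \<Rightarrow> real"
  let ?u = "\<lambda>x :: real^'n. D * ?w x"
  let ?P = "\<lambda>l. exp (t * exp (?\<beta> * l) / ?\<beta>)"
  have \<beta>: "?\<beta> \<noteq> 0" using t by auto
  note pa = ckn_exponent_signs(1)[OF p \<beta> crit]
  have w1: "0 < ?w x" "?w x \<le> 1" for x
  proof -
    show "0 < ?w x" by (rule ckn_profile_pos)
    have "t * norm x powr ?\<beta> / ?\<beta> = (t * ?\<beta>) * norm x powr ?\<beta> / ?\<beta>\<^sup>2" using \<beta>
        by (simp add: power2_eq_square)
    also have "\<dots> \<le> 0" by (intro divide_nonpos_nonneg mult_nonpos_nonneg[OF less_imp_le[OF t]]) auto
    finally show "?w x \<le> 1" by (simp add: ckn_profile_def)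
  qed
  have int_pa: "integrable lborel (\<lambda>x. \<bar>?w x\<bar> powr p / norm x powr (p * a))"
    using integrable_ckn_profile[OF p t pa, of 1] by simp
  define I where "I = (\<integral>\<^sup>+x. ennreal (\<bar>?w x\<bar> powr p / norm x powr (p * a)) \<partial>lborel)"
  have I: "I < \<infinity>" using int_pa unfolding I_def by (simp add: integrable_iff_bounded)
  \<comment> \<open>\<open>q\<close> lies between \<open>N\<close> and \<open>p a\<close>, so its power is dominated by one of the two on either side of \<open>|x| = 1\<close>.\<close>
  have q_le: "norm x powr - ?q \<le> norm x powr - ?N + norm x powr - (p * a)" if "x \<noteq> 0" for x :: "real^'n"
  proof -
    have "(?N \<le> ?q \<and> ?q \<le> p * a) \<or> (p * a \<le> ?q \<and> ?q \<le> ?N)"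
    proof (cases "?\<beta> > 0")
      case True
      then have "?q \<le> ?N" using crit by (simp add: zero_le_mult_iff)
      moreover have "p * a \<le> ?q" using True p by (intro mult_left_mono) auto
      ultimately show ?thesis by simp
    next
      case False
      then have "?\<beta> < 0" using \<beta> by simp
      then have "?N \<le> ?q" using crit by (simp add: zero_le_mult_iff)
      moreover have "?q \<le> p * a" using \<open>?\<beta> < 0\<close> p by (intro mult_left_mono) auto
      ultimately show ?thesis by simp
    qed
    then consider "norm x \<le> 1" "?q \<le> ?N" | "norm x \<le> 1" "?q \<le> p * a" | "norm x \<ge> 1" "?N
        \<le> ?q" | "norm x \<ge> 1" "p * a \<le> ?q"
      by linarith
    then show ?thesis
    proof cases
      case 1
      then have "norm x powr - ?q \<le> norm x powr - ?N" using that by (intro powr_mono') auto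
      then show ?thesis by (simp add: add_increasing2)
    next
      case 2
      then have "norm x powr - ?q \<le> norm x powr - (p * a)" using that by (intro powr_mono') auto
      then show ?thesis by (simp add: add_increasing)
    next
      case 3
      then have "norm x powr - ?q \<le> norm x powr - ?N" by (intro powr_mono) auto
      then show ?thesis by (simp add: add_increasing2)
    next
      case 4
      then have "norm x powr - ?q \<le> norm x powr - (p * a)" by (intro powr_mono) auto
      then show ?thesis by (simp add: add_increasing)
    qed
  qed
  define k where "k n = real (Suc n)" for n
  have k: "k n > 0" for n by (simp add: k_def)
  define F where "F n l = D * ?P l * log_cutoff (k n) l" for n l
  define \<phi> where "\<phi> n = (\<lambda>x :: real^'n. if x = 0 then 0 else F n (ln (norm x)))" for n
  have test: "\<phi> n \<in> test_functions (- {0})" for n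
    unfolding \<phi>_def
  proof (rule log_radial_test_function[OF \<beta> k[of n]])
    show "F n \<in> profile_algebra ?\<beta> t (k n)"
      unfolding F_def log_cutoff_def by (intro profile_algebra.intros)
    show "F n l = 0" if "\<bar>l\<bar> > k n" for l
      using log_cutoff_eq_0[OF k that] by (simp add: F_def)
  qed
  let ?\<chi> = "\<lambda>n x. log_cutoff (k n) (ln (norm (x :: real^'n)))"
  let ?\<chi>' = "\<lambda>n x. log_cutoff_deriv (k n) (ln (norm (x :: real^'n)))"
  have phi: "\<phi> n x = ?u x * ?\<chi> n x" if "x \<noteq> 0" for n x
    using that by (simp add: \<phi>_def F_def ckn_profile_log)
  have grad_phi: "gradient (\<phi> n) x = ((D * (t * norm x powr ?\<beta> * ?w x * ?\<chi> n x + ?w x * ?\<chi>' n x))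
      / (norm x)\<^sup>2) *\<^sub>R x" if "x \<noteq> 0" for n x
  proof (rule gradient_eqI)
    have "(?P has_real_derivative (t * exp (?\<beta> * l) * ?P l)) (at l)" for l
      using \<beta> by (auto intro!: derivative_eq_intros)
    from DERIV_mult[OF DERIV_cmult[OF this, of D] log_cutoff_has_derivative[OF k]]
    have "(F n has_real_derivative D * (t * exp (?\<beta> * l) * ?P l * log_cutoff (k n) l + ?P l
        * log_cutoff_deriv (k n) l)) (at l)" for l
      unfolding F_def by (rule DERIV_cong) (simp add: algebra_simps)
    from has_derivative_log_radial[OF that this]
    have "((\<lambda>x. F n (ln (norm x))) has_derivative (\<lambda>h. (((D
        * (t * norm x powr ?\<beta> * ?w x * ?\<chi> n x + ?w x * ?\<chi>' n x)) / (norm x)\<^sup>2) *\<^sub>R x) \<bullet> h)) (at x)"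
      using that by (simp add: ckn_profile_log powr_def)
    then show "(\<phi> n has_derivative (\<lambda>h. (((D * (t * norm x powr ?\<beta> * ?w x * ?\<chi> n x + ?w x * ?\<chi>' n x))
        / (norm x)\<^sup>2) *\<^sub>R x) \<bullet> h)) (at x)"
      by (rule has_derivative_transform_within_open[where s = "- {0}"]) (use that in \<open>auto simp: \<phi>_def\<close>)
  qed
  let ?z = "\<lambda>n x. (1 - ?\<chi> n x) powr p * (\<bar>?w x\<bar> powr p / norm x powr (p * a))"
  have [measurable]: "log_cutoff (k n) \<in> borel_measurable borel" for n
    unfolding log_cutoff_def[abs_def] flat_exp_def by measurable
  have chi01: "0 \<le> 1 - ?\<chi> n x" "1 - ?\<chi> n x \<le> 1" for n x
    using log_cutoff_bounds[OF k] by auto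
  have z: "(\<lambda>n. \<integral>\<^sup>+x. ennreal (?z n x) \<partial>lborel) \<longlonglongrightarrow> 0"
  proof -
    have "(\<lambda>n. \<integral>\<^sup>+x. ennreal (?z n x) \<partial>lborel) \<longlonglongrightarrow> (\<integral>\<^sup>+x. 0 \<partial>(lborel :: (real^'n) measure))"
    proof (rule nn_integral_dominated_convergence[where w
        = "\<lambda>x. ennreal (\<bar>?w x\<bar> powr p / norm x powr (p * a))"])
      show "AE x in lborel. ennreal (?z n x) \<le> ennreal (\<bar>?w x\<bar> powr p / norm x powr (p * a))" for n
      proof (intro always_eventually allI ennreal_leI)
        fix x
        have "(1 - ?\<chi> n x) powr p \<le> 1" using chi01[of n x] p by (intro powr_le1) auto
        then show "?z n x \<le> \<bar>?w x\<bar> powr p / norm x powr (p * a)"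
          by (intro mult_left_le_one_le) auto
      qed
      show "(\<integral>\<^sup>+x. ennreal (\<bar>?w x\<bar> powr p / norm x powr (p * a)) \<partial>lborel) < \<infinity>" using I by (simp add: I_def)
      show "AE x in lborel. (\<lambda>n. ennreal (?z n x)) \<longlonglongrightarrow> 0"
      proof (intro always_eventually allI)
        fix x
        have "(\<lambda>n. 1 - ?\<chi> n x) \<longlonglongrightarrow> 1 - 1"
          unfolding k_def by (intro tendsto_intros log_cutoff_tendsto)
        then have "(\<lambda>n. (1 - ?\<chi> n x) powr p) \<longlonglongrightarrow> 0 powr p"
          using p chi01 by (intro tendsto_powr') (auto intro!: always_eventually)
        then have "(\<lambda>n. ?z n x) \<longlonglongrightarrow> 0 powr p * (\<bar>?w x\<bar> powr p / norm x powr (p * a))"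
          by (intro tendsto_mult tendsto_const)
        then show "(\<lambda>n. ennreal (?z n x)) \<longlonglongrightarrow> 0"
          using tendsto_ennrealI[of "\<lambda>n. ?z n x" 0] by simp
      qed
    qed measurable
    then show ?thesis by simp
  qed
  let ?\<omega> = "?N * unit_ball_vol ?N"
  let ?J = "\<lambda>n x. indicator {- k n..k n} (ln (norm x)) * (\<bar>?w x\<bar> powr p / norm x powr ?q)"
  let ?M = "\<lambda>n x. norm (gradient (\<phi> n) x - gradient ?u x) powr p / norm x powr (p * b)"
  have ne0: "AE x in lborel. x \<noteq> (0 :: real^'n)" by (rule AE_lborel_singleton)
  have annulus: "(\<integral>\<^sup>+x. ennreal (?J n x) \<partial>lborel)
      \<le> ennreal (?\<omega> * (2 * k n)) + I" for n
  proof -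
    have "(\<integral>\<^sup>+x. ennreal (?J n x) \<partial>lborel)
      \<le> (\<integral>\<^sup>+x. ennreal (indicator {- k n..k n} (ln (norm x)) / norm x powr ?N)
          + ennreal (\<bar>?w x\<bar> powr p / norm x powr (p * a)) \<partial>lborel)"
    proof (rule nn_integral_mono_AE)
      from ne0 show "AE x in lborel. ennreal (?J n x)
        \<le> ennreal (indicator {- k n..k n} (ln (norm x)) / norm x powr ?N)
            + ennreal (\<bar>?w x\<bar> powr p / norm x powr (p * a))"
      proof eventually_elim
        fix x :: "real^'n" assume x: "x \<noteq> 0"
        have wp: "\<bar>?w x\<bar> powr p \<le> 1" using w1[of x] p by (intro powr_le1) auto
        have "\<bar>?w x\<bar> powr p * norm x powr - ?q \<le> \<bar>?w x\<bar> powr p * (norm x powr - ?N + norm x powr - (p * a))"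
          by (intro mult_left_mono q_le x) simp
        also have "\<dots> \<le> 1 * norm x powr - ?N + \<bar>?w x\<bar> powr p * norm x powr - (p * a)"
          unfolding distrib_left using wp by (intro add_mono mult_right_mono) auto
        finally have "\<bar>?w x\<bar> powr p / norm x powr ?q \<le> 1 / norm x powr ?N + \<bar>?w x\<bar> powr p
            / norm x powr (p * a)"
          by (simp add: powr_minus_divide)
        then show "ennreal (?J n x)
          \<le> ennreal (indicator {- k n..k n} (ln (norm x)) / norm x powr ?N)
              + ennreal (\<bar>?w x\<bar> powr p / norm x powr (p * a))"
          by (auto simp: indicator_def ennreal_plus[symmetric] ennreal_leI simp del: ennreal_plus)
      qed
    qed
    also have "\<dots> = (\<integral>\<^sup>+x. ennreal (indicator {- k n..k n} (ln (norm (x :: real^'n))) / norm x powr ?N)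
        \<partial>lborel) + I"
      unfolding I_def by (intro nn_integral_add) measurable
    also have "(\<integral>\<^sup>+x. ennreal (indicator {- k n..k n} (ln (norm (x :: real^'n))) / norm x powr ?N)
        \<partial>lborel) = ennreal (?\<omega> * (2 * k n))"
      using nn_integral_log_annulus[where 'a = "real^'n", OF k] by simp
    finally show ?thesis .
  qed
  have conv_u: "(\<lambda>n. \<integral>\<^sup>+x. ennreal (\<bar>\<phi> n x - ?u x\<bar> powr p / norm x powr (p * a)) \<partial>lborel) \<longlonglongrightarrow> 0"
  proof -
    have "(\<integral>\<^sup>+x. ennreal (\<bar>\<phi> n x - ?u x\<bar> powr p / norm x powr (p * a)) \<partial>lborel)
        = ennreal (\<bar>D\<bar> powr p) * (\<integral>\<^sup>+x. ennreal (?z n x) \<partial>lborel)" for n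
    proof -
      have "(\<integral>\<^sup>+x. ennreal (\<bar>\<phi> n x - ?u x\<bar> powr p / norm x powr (p * a)) \<partial>lborel)
          = (\<integral>\<^sup>+x. ennreal (\<bar>D\<bar> powr p) * ennreal (?z n x) \<partial>lborel)"
      proof (rule nn_integral_cong_AE)
        from ne0 show "AE x in lborel. ennreal (\<bar>\<phi> n x - ?u x\<bar> powr p / norm x powr (p * a))
            = ennreal (\<bar>D\<bar> powr p) * ennreal (?z n x)"
        proof eventually_elim
          fix x :: "real^'n" assume x: "x \<noteq> 0"
          have "\<phi> n x - ?u x = - (D * ?w x * (1 - ?\<chi> n x))" by (simp add: phi[OF x] algebra_simps)
          then have "\<bar>\<phi> n x - ?u x\<bar> powr p = \<bar>D\<bar> powr p * \<bar>?w x\<bar> powr p * (1 - ?\<chi> n x) powr p"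
            using chi01[of n x] by (simp add: abs_mult powr_mult)
          then show "ennreal (\<bar>\<phi> n x - ?u x\<bar> powr p / norm x powr (p * a))
              = ennreal (\<bar>D\<bar> powr p) * ennreal (?z n x)"
            by (simp add: ennreal_mult[symmetric] mult_ac)
        qed
      qed
      then show ?thesis by (simp add: nn_integral_cmult)
    qed
    moreover have "(\<lambda>n. ennreal (\<bar>D\<bar> powr p) * (\<integral>\<^sup>+x. ennreal (?z n x) \<partial>lborel)) \<longlonglongrightarrow> ennreal (\<bar>D\<bar> powr p) * 0"
      by (intro ennreal_tendsto_cmult z) simp
    ultimately show ?thesis by simp
  qed
  have conv_g: "(\<lambda>n. \<integral>\<^sup>+x. ennreal (?M n x) \<partial>lborel) \<longlonglongrightarrow> 0"
  proof -
    define c where "c = (1 / 2 :: real) powr (1 - p)"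
    have c: "c \<ge> 0" by (simp add: c_def)
    define A where "A = c * \<bar>D * t\<bar> powr p"
    define B where "B n = c * (\<bar>D\<bar> * (4 * exp 1 / k n)) powr p" for n
    have AB: "A \<ge> 0" "B n \<ge> 0" for n using c by (auto simp: A_def B_def)
    have bound: "(\<integral>\<^sup>+x. ennreal (?M n x) \<partial>lborel)
      \<le> ennreal A * (\<integral>\<^sup>+x. ennreal (?z n x) \<partial>lborel) + ennreal (B n) * (ennreal (?\<omega> * (2 * k n)) + I)" for n
    proof -
      have "(\<integral>\<^sup>+x. ennreal (?M n x) \<partial>lborel)
        \<le> (\<integral>\<^sup>+x. ennreal A * ennreal (?z n x) + ennreal (B n) * ennreal (?J n x) \<partial>lborel)"
      proof (rule nn_integral_mono_AE)
        from ne0 show "AE x in lborel. ennreal (?M n x)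
          \<le> ennreal A * ennreal (?z n x) + ennreal (B n) * ennreal (?J n x)"
        proof eventually_elim
          fix x :: "real^'n" assume x: "x \<noteq> 0"
          let ?r = "norm x"
          define Y1 where "Y1 = D * t * ?r powr (?\<beta> - 1) * ?w x * (?\<chi> n x - 1)"
          define Y2 where "Y2 = D * ?w x * ?\<chi>' n x / ?r"
          define E where "E = ?r powr ?\<beta>"
          have pw: "?r powr (?\<beta> - 1) = E / ?r" "?r powr (b - a - 1) = E / ?r\<^sup>2"
            using x by (simp_all add: E_def powr_diff powr_add power2_eq_square field_simps)
          have "gradient (\<phi> n) x - gradient ?u x = ((Y1 + Y2) / ?r) *\<^sub>R x"
            unfolding grad_phi[OF x] gradient_ckn_profile[OF x \<beta>] scaleR_left_diff_distrib[symmetric]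
              Y1_def Y2_def pw E_def[symmetric]
            using x by (simp add: power2_eq_square field_simps)
          then have "norm (gradient (\<phi> n) x - gradient ?u x) = norm (Y1 + Y2)" using x by simp
          also have "\<dots> powr p \<le> (1 - 1 / 2) powr (1 - p) * norm Y1 powr p + (1 / 2) powr (1 - p)
              * norm (Y1 + Y2 - Y1) powr p"
            by (rule norm_powr_split[OF p]) auto
          also have "\<dots> = c * \<bar>Y1\<bar> powr p + c * \<bar>Y2\<bar> powr p" by (simp add: c_def)
          finally have le: "?M n x
            \<le> c * \<bar>Y1\<bar> powr p / ?r powr (p * b) + c * \<bar>Y2\<bar> powr p / ?r powr (p * b)"
            by (simp add: divide_right_mono flip: add_divide_distrib)
          have "\<bar>Y1\<bar> = \<bar>D * t\<bar> * ?r powr (?\<beta> - 1) * \<bar>?w x\<bar> * (1 - ?\<chi> n x)"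
            using chi01[of n x] by (simp add: Y1_def abs_mult)
          then have Y1: "\<bar>Y1\<bar> powr p = \<bar>D * t\<bar> powr p * ?r powr ((?\<beta> - 1) * p) * \<bar>?w x\<bar> powr p
              * (1 - ?\<chi> n x) powr p"
            using chi01[of n x] by (simp add: powr_mult powr_powr)
          have ratio: "?r powr ((?\<beta> - 1) * p) / ?r powr (p * b) = 1 / ?r powr (p * a)"
          proof -
            have "?r powr ((?\<beta> - 1) * p) / ?r powr (p * b) = ?r powr ((?\<beta> - 1) * p - p * b)" using x
                by (simp add: powr_diff)
            also have "(?\<beta> - 1) * p - p * b = - (p * a)" by (simp add: algebra_simps)
            finally show ?thesis by (simp add: powr_minus_divide)
          qed
          have "c * \<bar>Y1\<bar> powr p / ?r powr (p * b)
              = c * \<bar>D * t\<bar> powr p * \<bar>?w x\<bar> powr p * (1 - ?\<chi> n x) powr p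
                  * (?r powr ((?\<beta> - 1) * p) / ?r powr (p * b))"
            unfolding Y1 by simp
          then have 1: "c * \<bar>Y1\<bar> powr p / ?r powr (p * b) = A * ?z n x"
            unfolding ratio by (simp add: A_def)
          have "\<bar>Y2\<bar> \<le> \<bar>D\<bar> * (4 * exp 1 / k n) * \<bar>?w x\<bar> / ?r * indicator {- k n..k n} (ln ?r)"
          proof -
            have "\<bar>Y2\<bar> = \<bar>D\<bar> * \<bar>?w x\<bar> / ?r * \<bar>?\<chi>' n x\<bar>" by (simp add: Y2_def abs_mult)
            also have "\<dots> \<le> \<bar>D\<bar> * \<bar>?w x\<bar> / ?r * (4 * exp 1 / k n * indicator {- k n..k n} (ln ?r))"
              by (intro mult_left_mono log_cutoff_deriv_bound k) simp
            finally show ?thesis by (simp add: mult_ac)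
          qed
          then have "\<bar>Y2\<bar> powr p \<le> (\<bar>D\<bar> * (4 * exp 1 / k n) * \<bar>?w x\<bar> / ?r
              * indicator {- k n..k n} (ln ?r)) powr p"
            using p by (intro powr_mono2) auto
          also have "\<dots> = (\<bar>D\<bar> * (4 * exp 1 / k n)) powr p * \<bar>?w x\<bar> powr p / ?r powr p
              * indicator {- k n..k n} (ln ?r)"
            using k[of n] by (simp add: powr_mult powr_divide indicator_def)
          finally have "\<bar>Y2\<bar> powr p / ?r powr (p * b) \<le> (\<bar>D\<bar> * (4 * exp 1 / k n)) powr p * \<bar>?w x\<bar> powr p
              / ?r powr p * indicator {- k n..k n} (ln ?r) / ?r powr (p * b)"
            by (rule divide_right_mono) simp
          also have "\<dots> = (\<bar>D\<bar> * (4 * exp 1 / k n)) powr p * (?J n x)"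
            by (simp add: distrib_left powr_add mult_ac)
          finally have "c * (\<bar>Y2\<bar> powr p / ?r powr (p * b))
              \<le> c * ((\<bar>D\<bar> * (4 * exp 1 / k n)) powr p * (?J n x))"
            using c by (rule mult_left_mono)
          then have 2: "c * \<bar>Y2\<bar> powr p / ?r powr (p * b) \<le> B n * (?J n x)"
            by (simp add: B_def)
          from le 1 2 have "?M n x
            \<le> A * ?z n x + B n * (?J n x)" by linarith
          then show "ennreal (?M n x)
            \<le> ennreal A * ennreal (?z n x) + ennreal (B n) * ennreal (?J n x)"
            using AB by (simp add: ennreal_mult[symmetric] ennreal_plus[symmetric] ennreal_leI del:
                ennreal_plus)
        qed
      qed
      also have "\<dots> = ennreal A * (\<integral>\<^sup>+x. ennreal (?z n x) \<partial>lborel)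
        + ennreal (B n) * (\<integral>\<^sup>+x. ennreal (?J n x) \<partial>lborel)"
        by (subst nn_integral_add, measurable, subst nn_integral_cmult, measurable, subst
            nn_integral_cmult, measurable)
      also have "\<dots> \<le> ennreal A * (\<integral>\<^sup>+x. ennreal (?z n x) \<partial>lborel) + ennreal (B n)
          * (ennreal (?\<omega> * (2 * k n)) + I)"
        by (intro add_left_mono mult_left_mono annulus) simp
      finally show ?thesis .
    qed
    have "(\<lambda>n. ennreal (B n) * (ennreal (?\<omega> * (2 * k n)) + I)) \<longlonglongrightarrow> 0"
    proof -
      obtain i where i: "I = ennreal i" "i \<ge> 0" using I by (cases I) auto
      have "filterlim k at_top sequentially"
        unfolding k_def by (rule filterlim_compose[OF filterlim_real_sequentially filterlim_Suc])
      then have "(\<lambda>n. k n powr (1 - p)) \<longlonglongrightarrow> 0" "(\<lambda>n. k n powr (- p)) \<longlonglongrightarrow> 0"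
        using p by (auto intro!: tendsto_neg_powr)
      then have "(\<lambda>n. (c * (\<bar>D\<bar> * (4 * exp 1)) powr p) * (?\<omega> * 2 * k n powr (1 - p) + i * k n powr (- p)))
        \<longlonglongrightarrow> (c * (\<bar>D\<bar> * (4 * exp 1)) powr p) * (?\<omega> * 2 * 0 + i * 0)"
        by (intro tendsto_mult tendsto_add tendsto_const)
      moreover have "(c * (\<bar>D\<bar> * (4 * exp 1)) powr p) * (?\<omega> * 2 * k n powr (1 - p) + i * k n powr (- p))
          = B n * (?\<omega> * (2 * k n) + i)" for n
      proof -
        have "(\<bar>D\<bar> * (4 * exp 1 / k n)) powr p = (\<bar>D\<bar> * (4 * exp 1)) powr p / k n powr p"
          unfolding times_divide_eq_right by (rule powr_divide)
        then have B: "B n = c * ((\<bar>D\<bar> * (4 * exp 1)) powr p / k n powr p)" by (simp only: B_def)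
        have "k n powr (1 - p) = k n / k n powr p" "k n powr (- p) = 1 / k n powr p"
          using k[of n] by (simp_all add: powr_diff powr_minus_divide)
        then show ?thesis unfolding B by (simp add: distrib_left distrib_right add_divide_distrib)
      qed
      ultimately have "(\<lambda>n. B n * (?\<omega> * (2 * k n) + i)) \<longlonglongrightarrow> 0" by simp
      then have "(\<lambda>n. ennreal (B n * (?\<omega> * (2 * k n) + i))) \<longlonglongrightarrow> ennreal 0"
        by (rule tendsto_ennrealI)
      moreover have "ennreal (B n * (?\<omega> * (2 * k n) + i))
          = ennreal (B n) * (ennreal (?\<omega> * (2 * k n)) + I)" for n
      proof -
        have "0 \<le> ?\<omega> * (2 * k n)" using k[of n] by (simp add: less_imp_le)
        then show ?thesis using AB(2)[of n] i by (simp add: ennreal_mult ennreal_plus[symmetric] del: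
            ennreal_plus)
      qed
      ultimately show ?thesis by (simp only: ennreal_0)
    qed
    moreover have "(\<lambda>n. ennreal A * (\<integral>\<^sup>+x. ennreal (?z n x) \<partial>lborel)) \<longlonglongrightarrow> ennreal A * 0"
      by (intro ennreal_tendsto_cmult z) simp
    ultimately have "(\<lambda>n. ennreal A * (\<integral>\<^sup>+x. ennreal (?z n x) \<partial>lborel) + ennreal (B n)
        * (ennreal (?\<omega> * (2 * k n)) + I)) \<longlonglongrightarrow> ennreal A * 0 + 0"
      by (intro tendsto_add)
    then have "(\<lambda>n. ennreal A * (\<integral>\<^sup>+x. ennreal (?z n x) \<partial>lborel) + ennreal (B n)
        * (ennreal (?\<omega> * (2 * k n)) + I)) \<longlonglongrightarrow> 0"
      by (simp only: mult_zero_right add_0_right)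
    then show ?thesis
      by (rule tendsto_sandwich[OF _ _ tendsto_const, rotated 2])
          (intro always_eventually allI zero_le bound)+
  qed
  show ?thesis
    unfolding ckn_space_def using test conv_u conv_g measurable_gradient_ckn_profile[OF \<beta>] by auto
qed

section \<open>Extremals and sharpness\<close>

text \<open>For the profile, \<open>|\<nabla>u|\<^sup>p / |x|\<^sup>p\<^sup>b\<close> and the cross term are constant multiples of \<open>|u|\<^sup>p / |x|\<^sup>p\<^sup>a\<close>.
  The left side is thus \<open>|t|\<close> times the integral of the latter, and \<open>radial_identity\<close> computes
  that integral from the right side.\<close>

lemma ckn_attains_ckn_profile:
  fixes a b t p D :: real
  assumes p: "p > 1" and t: "t * (b + 1 - a) < 0"
    and crit: "(b + 1 - a) * (real CARD('n::finite) - p * (b + 1)) \<ge> 0"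
  shows "ckn_attains p a b (\<bar>(p - 1) * a + b + 1 - real CARD('n)\<bar> / p)
    (\<lambda>x :: real^'n. D * ckn_profile a b t x) (gradient (\<lambda>x. D * ckn_profile a b t x))"
proof -
  let ?\<beta> = "b + 1 - a" and ?s = "(p - 1) * a + b + 1" and ?N = "real CARD('n)"
  let ?u = "\<lambda>x :: real^'n. D * ckn_profile a b t x"
  let ?U = "\<lambda>x. \<bar>?u x\<bar> powr p / norm x powr (p * a)"
  let ?X = "\<lambda>x. signed_powr (?u x) (p - 1) * (x \<bullet> gradient ?u x) / norm x powr ?s"
  have \<beta>: "?\<beta> \<noteq> 0" using t by auto
  note signs = ckn_exponent_signs[OF p \<beta> crit]
  have int_u: "integrable lborel (\<lambda>x. ?U x)"
    and int_r: "integrable lborel (\<lambda>x. \<bar>?u x\<bar> powr p / norm x powr ?s)"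
    using integrable_ckn_profile[OF p t signs(1)] integrable_ckn_profile[OF p t signs(2)] by auto
  define B where "B = weighted_integral p (p * a) ?u"
  define R where "R = ckn_rhs p a b ?u"
  have B: "B \<ge> 0" by (simp add: B_def weighted_integral_nonneg)
  have g: "norm (gradient ?u x) powr p / norm x powr (p * b) = \<bar>t\<bar> powr p * (?U x)" if "x \<noteq> 0" for x
  proof -
    have "norm (gradient ?u x) = \<bar>t\<bar> * \<bar>?u x\<bar> * norm x powr (b - a)"
      using that by (simp add: gradient_ckn_profile[OF that \<beta>] abs_mult powr_diff powr_add field_simps)
    then have "norm (gradient ?u x) powr p = \<bar>t\<bar> powr p * \<bar>?u x\<bar> powr p * norm x powr (p * b - p * a)"
      by (simp add: powr_mult powr_powr algebra_simps)
    then show ?thesis using that by (simp add: powr_diff)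
  qed
  have cross: "?X x = t * (?U x)" if "x \<noteq> 0" for x
  proof -
    have xx: "x \<bullet> x = norm x powr 2" by (simp add: power2_norm_eq_inner)
    have "x \<bullet> gradient ?u x = t * ?u x * (norm x powr (b - a - 1) * norm x powr 2)"
      by (simp add: gradient_ckn_profile[OF that \<beta>] xx)
    also have "norm x powr (b - a - 1) * norm x powr 2 = norm x powr ((b - a - 1) + 2)"
        by (rule powr_add[symmetric])
    also have "(b - a - 1) + 2 = ?\<beta>" by simp
    finally have "signed_powr (?u x) (p - 1) * (x \<bullet> gradient ?u x)
        = t * (signed_powr (?u x) (p - 1) * ?u x) * norm x powr ?\<beta>" by simp
    also have "signed_powr (?u x) (p - 1) * ?u x = \<bar>?u x\<bar> powr p"
    proof -
      have "signed_powr (?u x) (p - 1) * ?u x = \<bar>?u x\<bar> * \<bar>?u x\<bar> powr (p - 1)"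
          by (simp add: signed_powr_def sgn_if)
      also have "\<dots> = \<bar>?u x\<bar> powr p" using powr_mult_base[of "\<bar>?u x\<bar>" "p - 1"] by simp
      finally show ?thesis .
    qed
    finally have "?X x = t * \<bar>?u x\<bar> powr p * (norm x powr ?\<beta> / norm x powr ?s)" by simp
    also have "norm x powr ?\<beta> / norm x powr ?s = norm x powr (?\<beta> - ?s)" by (rule powr_diff[symmetric])
    also have "?\<beta> - ?s = - (p * a)" by (simp add: algebra_simps)
    finally show ?thesis by (simp add: powr_minus_divide)
  qed
  note [measurable] = measurable_gradient_ckn_profile[OF \<beta>]
  have ne0: "AE x in lborel. x \<noteq> (0 :: real^'n)" by (rule AE_lborel_singleton)
  have A: "weighted_integral p (p * b) (gradient ?u) = \<bar>t\<bar> powr p * B"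
  proof -
    have "weighted_integral p (p * b) (gradient ?u) = (\<integral>x. \<bar>t\<bar> powr p * (?U x) \<partial>lborel)"
      unfolding weighted_integral_def using ne0 g by (intro integral_cong_AE) (auto elim!: eventually_mono)
    then show ?thesis unfolding B_def weighted_integral_def real_norm_def
        by (simp only: integral_mult_right_zero)
  qed
  have int_cross: "integrable lborel (\<lambda>x. ?X x)"
    and cross_eq: "(\<integral>x. ?X x \<partial>lborel) = t * B"
  proof -
    have ae: "AE x in lborel. ?X x = t * (?U x)"
      using ne0 by eventually_elim (rule cross)
    have i: "integrable lborel (\<lambda>x. t * (?U x))"
      by (intro integrable_mult_right int_u)
    have m: "(\<lambda>x. ?X x) \<in> borel_measurable lborel"
      by measurable
    show "integrable lborel (\<lambda>x. ?X x)"
      using integrable_cong_AE[OF m _ ae] i by (simp add: borel_measurable_integrable)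
    have "(\<integral>x. ?X x \<partial>lborel)
        = (\<integral>x. t * (?U x) \<partial>lborel)"
      by (intro integral_cong_AE m ae borel_measurable_integrable i)
    then show "(\<integral>x. ?X x \<partial>lborel) = t * B"
      unfolding B_def weighted_integral_def real_norm_def by (simp only: integral_mult_right_zero)
  qed
  have deriv: "(?u has_derivative (\<lambda>h. gradient ?u x \<bullet> h)) (at x)" if "x \<noteq> 0" for x
    unfolding gradient_ckn_profile[OF that \<beta>] by (rule ckn_profile_has_derivative[OF that \<beta>])
  have "p * (t * B) = (?s - ?N) * R"
    using radial_identity[OF p deriv continuous_ckn_profile_gradient[OF \<beta>] int_r int_cross]
    by (simp add: cross_eq R_def ckn_rhs_def weighted_integral_def)
  then have "\<bar>p * (t * B)\<bar> = \<bar>(?s - ?N) * R\<bar>" by simp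
  moreover have "R \<ge> 0" by (simp add: R_def ckn_rhs_def weighted_integral_nonneg)
  ultimately have "p * (\<bar>t\<bar> * B) = \<bar>?s - ?N\<bar> * R"
    using p B by (simp only: abs_mult abs_of_nonneg)
  then have "\<bar>t\<bar> * B = \<bar>?s - ?N\<bar> / p * R" using p by (simp add: field_simps)
  moreover have "ckn_lhs p a b ?u (gradient ?u) = \<bar>t\<bar> * B"
  proof -
    have "ckn_lhs p a b ?u (gradient ?u) = \<bar>t\<bar> * (B powr (1 / p) * B powr ((p - 1) / p))"
      unfolding ckn_lhs_def A B_def[symmetric] using p B by (simp add: powr_mult powr_powr)
    also have "B powr (1 / p) * B powr ((p - 1) / p) = B powr (1 / p + (p - 1) / p)" by (simp add: powr_add)
    also have "1 / p + (p - 1) / p = 1" using p by (simp add: field_simps)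
    finally show ?thesis using B by simp
  qed
  ultimately show ?thesis
    unfolding ckn_attains_def R_def using ckn_space_ckn_profile[OF p t crit, of D] int_r by simp
qed

lemma ckn_sharp_constant:
  fixes a b p :: real
  assumes p: "p > 1" and \<beta>: "b + 1 - a \<noteq> 0"
    and crit: "(b + 1 - a) * (real CARD('n::finite) - p * (b + 1)) \<ge> 0"
  shows "ckn_sharp p a b (\<bar>(p - 1) * a + b + 1 - real CARD('n)\<bar> / p) TYPE('n)"
proof -
  let ?C = "\<bar>(p - 1) * a + b + 1 - real CARD('n)\<bar> / p"
  \<comment> \<open>Any admissible profile serves as a witness against a larger constant.\<close>
  define t where "t = - (b + 1 - a)"
  have t: "t * (b + 1 - a) < 0" using \<beta> by (simp add: t_def mult_less_0_iff not_less) linarith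
  let ?w = "\<lambda>x :: real^'n. 1 * ckn_profile a b t x"
  have att: "ckn_attains p a b ?C ?w (gradient ?w)" by (rule ckn_attains_ckn_profile[OF p t crit])
  then have ug: "(?w, gradient ?w) \<in> ckn_space p a b"
    and int: "integrable lborel (\<lambda>x. \<bar>?w x\<bar> powr p / norm x powr ((p - 1) * a + b + 1))"
    and eq: "ckn_lhs p a b ?w (gradient ?w) = ?C * ckn_rhs p a b ?w"
    by (auto simp: ckn_attains_def)
  have ne0: "AE x in lborel. x \<noteq> (0 :: real^'n)" by (rule AE_lborel_singleton)
  have "ckn_rhs p a b ?w \<noteq> 0"
  proof
    assume "ckn_rhs p a b ?w = 0"
    then have "AE x in lborel. \<bar>?w x\<bar> powr p / norm x powr ((p - 1) * a + b + 1) = 0"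
      using int unfolding ckn_rhs_def weighted_integral_def real_norm_def
      by (subst (asm) integral_nonneg_eq_0_iff_AE) auto
    with ne0 have "AE x in lborel. x \<notin> (UNIV :: (real^'n) set)"
      by eventually_elim (simp add: ckn_profile_pos[THEN order_less_imp_not_eq2])
    then show False using AE_lborel_ex_in_open[of "\<lambda>x. x \<notin> (UNIV :: (real^'n) set)" UNIV] by auto
  qed
  then have R: "ckn_rhs p a b ?w > 0"
    using weighted_integral_nonneg[of p "(p - 1) * a + b + 1" ?w] by (simp add: ckn_rhs_def)
  have "\<not> ckn_constant p a b C' TYPE('n)" if C': "C' > ?C" for C'
  proof
    assume const: "ckn_constant p a b C' TYPE('n)"
    have "C' \<ge> 0" using C' p by (intro order_trans[OF _ less_imp_le[OF C']]) simp
    from ckn_constant_completion[OF p ug int this const] have "C' * ckn_rhs p a b ?w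
        \<le> ?C * ckn_rhs p a b ?w"
      by (simp only: eq)
    then show False using R C' by (simp only: mult_le_cancel_right_pos)
  qed
  moreover have "ckn_constant p a b ?C TYPE('n)"
    unfolding ckn_constant_def using ckn_inequality[OF p] by (metis abs_minus_commute)
  ultimately show ?thesis by (simp add: ckn_sharp_def)
qed

text \<open>In dimension at least 2 the punctured space is itself an admissible \<open>S\<close>; on the line the two half-lines
  are.\<close>

lemma multiple_of_profileI:
  fixes u w :: "real^'n::finite \<Rightarrow> real"
  assumes "\<And>S. open S \<Longrightarrow> connected S \<Longrightarrow> 0 \<notin> S \<Longrightarrow> ae_multiple_on S u w"
  shows "multiple_of_profile u w"
proof (cases "CARD('n) \<ge> 2")
  case True
  then have "connected (- {0 :: real^'n})" by (intro connected_punctured_universe) simp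
  then have "ae_multiple_on (- {0}) u w" by (intro assms) (auto simp: open_Compl)
  then obtain D where "AE x in lborel. x \<in> - {0} \<longrightarrow> u x = D * w x" by (auto simp: ae_multiple_on_def)
  moreover have "AE x in lborel. x \<noteq> (0 :: real^'n)" by (rule AE_lborel_singleton)
  ultimately have "AE x in lborel. x \<in> UNIV \<longrightarrow> u x = D * w x" by eventually_elim simp
  with True show ?thesis by (auto simp: multiple_of_profile_def ae_multiple_on_def)
next
  case False
  have "ae_multiple_on H u w" if "H \<in> components (- {0})" for H
    using that in_components_subset[OF that]
    by (intro assms) (auto intro: open_components in_components_connected open_Compl)
  with False show ?thesis by (simp add: multiple_of_profile_def)
qed

lemma ckn_attains_imp_multiple:
  fixes a b p :: real and u :: "real^'n::finite \<Rightarrow> real"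
  assumes p: "p > 1" and \<beta>: "b + 1 - a \<noteq> 0"
    and crit: "(b + 1 - a) * (real CARD('n) - p * (b + 1)) \<ge> 0"
    and att: "ckn_attains p a b (\<bar>(p - 1) * a + b + 1 - real CARD('n)\<bar> / p) u g"
  shows "\<exists>t. t * (b + 1 - a) < 0 \<and> multiple_of_profile u (ckn_profile a b t)"
proof -
  let ?\<beta> = "b + 1 - a" and ?c = "(p - 1) * a + b + 1 - real CARD('n)"
  have sign: "?\<beta> * - ?c > 0" using ckn_exponent_signs(2)[OF p \<beta> crit] by simp
  then have c: "?c \<noteq> 0" by (metis minus_zero mult_zero_right less_irrefl)
  from ckn_attains_gradient[OF p c att] show ?thesis
  proof (elim disjE exE conjE)
    assume "AE x in lborel. u x = 0"
    then have "multiple_of_profile u (ckn_profile a b (- ?\<beta>))"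
      by (intro multiple_of_profileI) (auto simp: ae_multiple_on_def intro!: exI[of _ 0] elim!:
          eventually_mono)
    moreover have "- ?\<beta> * ?\<beta> < 0" using \<beta> by (simp add: mult_less_0_iff not_less) linarith
    ultimately show ?thesis by blast
  next
    fix t assume tc: "t * ?c > 0" and g: "AE x in lborel. g x = (t * norm x powr (b - a - 1) * u x) *\<^sub>R x"
    have ug: "(u, g) \<in> ckn_space p a b" using att by (simp add: ckn_attains_def)
    let ?G = "\<lambda>x :: real^'n. (t * norm x powr (b - a - 1) * ckn_profile a b t x) *\<^sub>R x"
    have t: "t * ?\<beta> < 0"
      using tc sign by (auto simp: zero_less_mult_iff mult_less_0_iff)
    have "ae_multiple_on S u (ckn_profile a b t)" if S: "open S" "connected S" "0 \<notin> S" for S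
    proof (rule ckn_space_multiple_on[OF p ug _ _ _ _ _ _ S, where G = ?G])
      show "(ckn_profile a b t has_derivative (\<lambda>h. ?G x \<bullet> h)) (at x)" if "x \<noteq> 0" for x :: "real^'n"
        using ckn_profile_has_derivative[OF that \<beta>, of 1 t] by simp
      show "continuous_on (- {0}) ?G"
        unfolding ckn_profile_def using \<beta> by (intro continuous_intros) auto
      from g show "AE x in lborel. g x = (u x / ckn_profile a b t x) *\<^sub>R ?G x"
      proof eventually_elim
        fix x assume "g x = (t * norm x powr (b - a - 1) * u x) *\<^sub>R x"
        then show "g x = (u x / ckn_profile a b t x) *\<^sub>R ?G x"
          using ckn_profile_pos[of a b t x] by (simp add: mult_ac)
      qed
    qed (auto simp: ckn_profile_pos)
    with t show ?thesis using multiple_of_profileI by blast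
  qed
qed

theorem corollary1p2:
  fixes p a b N :: real
  assumes "N = real CARD('n::finite)" and "p > 1"
  shows "(\<forall>u \<in> test_functions (- {0 :: real^'n}).
            ckn_lhs p a b u (gradient u) \<ge> \<bar>N - 1 - (p - 1) * a - b\<bar> / p * ckn_rhs p a b u) \<and>
         (b + 1 - a > 0 \<and> b \<le> (N - p) / p \<longrightarrow>
            ckn_sharp p a b ((N - 1 - (p - 1) * a - b) / p) TYPE('n) \<and>
            (\<forall>t < 0. \<forall>D. let u = (\<lambda>x :: real^'n. D * ckn_profile a b t x) in
               ckn_attains p a b ((N - 1 - (p - 1) * a - b) / p) u (gradient u)) \<and>
            (\<forall>(u :: real^'n \<Rightarrow> real) g. ckn_attains p a b ((N - 1 - (p - 1) * a - b) / p) u g \<longrightarrow>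
               (\<exists>t < 0. multiple_of_profile u (ckn_profile a b t)))) \<and>
         (b + 1 - a < 0 \<and> b \<ge> (N - p) / p \<longrightarrow>
            ckn_sharp p a b ((1 + (p - 1) * a + b - N) / p) TYPE('n) \<and>
            (\<forall>t > 0. \<forall>D. let u = (\<lambda>x :: real^'n. D * ckn_profile a b t x) in
               ckn_attains p a b ((1 + (p - 1) * a + b - N) / p) u (gradient u)) \<and>
            (\<forall>(u :: real^'n \<Rightarrow> real) g. ckn_attains p a b ((1 + (p - 1) * a + b - N) / p) u g \<longrightarrow>
               (\<exists>t > 0. multiple_of_profile u (ckn_profile a b t))))"
proof (intro conjI impI)
  note N = assms(1) and p = assms(2)
  let ?c = "(p - 1) * a + b + 1 - real CARD('n)"
  show "\<forall>u \<in> test_functions (- {0 :: real^'n}).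
      ckn_lhs p a b u (gradient u) \<ge> \<bar>N - 1 - (p - 1) * a - b\<bar> / p * ckn_rhs p a b u"
  proof
    fix u :: "real^'n \<Rightarrow> real" assume u: "u \<in> test_functions (- {0})"
    have "N - 1 - (p - 1) * a - b = real CARD('n) - ((p - 1) * a + b + 1)" by (simp add: N)
    then show "ckn_lhs p a b u (gradient u) \<ge> \<bar>N - 1 - (p - 1) * a - b\<bar> / p * ckn_rhs p a b u"
      using ckn_inequality[OF p u, of a b] by (simp only:)
  qed
  {
    assume h: "b + 1 - a > 0 \<and> b \<le> (N - p) / p"
    then have \<beta>: "b + 1 - a \<noteq> 0" by simp
    have crit: "(b + 1 - a) * (real CARD('n) - p * (b + 1)) \<ge> 0"
      using h p by (intro mult_nonneg_nonneg) (auto simp: N field_simps)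
    have "?c < 0" using ckn_exponent_signs(2)[OF p \<beta> crit] h by (simp add: zero_less_mult_iff)
    then have C: "(N - 1 - (p - 1) * a - b) / p = \<bar>?c\<bar> / p" by (simp add: N)
    have t: "t * (b + 1 - a) < 0 \<longleftrightarrow> t < 0" for t using h by (simp add: mult_less_0_iff)
    show "ckn_sharp p a b ((N - 1 - (p - 1) * a - b) / p) TYPE('n)"
      unfolding C by (rule ckn_sharp_constant[OF p \<beta> crit])
    show "\<forall>t < 0. \<forall>D. let u = (\<lambda>x :: real^'n. D * ckn_profile a b t x) in
        ckn_attains p a b ((N - 1 - (p - 1) * a - b) / p) u (gradient u)"
      unfolding C Let_def using ckn_attains_ckn_profile[OF p _ crit] t by simp
    show "\<forall>(u :: real^'n \<Rightarrow> real) g. ckn_attains p a b ((N - 1 - (p - 1) * a - b) / p) u g \<longrightarrow>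
        (\<exists>t < 0. multiple_of_profile u (ckn_profile a b t))"
      unfolding C using ckn_attains_imp_multiple[OF p \<beta> crit] t by blast
  }
  {
    assume h: "b + 1 - a < 0 \<and> b \<ge> (N - p) / p"
    then have \<beta>: "b + 1 - a \<noteq> 0" by simp
    have crit: "(b + 1 - a) * (real CARD('n) - p * (b + 1)) \<ge> 0"
      using h p by (intro mult_nonpos_nonpos) (auto simp: N field_simps)
    have "?c > 0" using ckn_exponent_signs(2)[OF p \<beta> crit] h by (simp add: zero_less_mult_iff)
    then have C: "(1 + (p - 1) * a + b - N) / p = \<bar>?c\<bar> / p" by (simp add: N)
    have t: "t * (b + 1 - a) < 0 \<longleftrightarrow> t > 0" for t using h by (simp add: mult_less_0_iff)
    show "ckn_sharp p a b ((1 + (p - 1) * a + b - N) / p) TYPE('n)"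
      unfolding C by (rule ckn_sharp_constant[OF p \<beta> crit])
    show "\<forall>t > 0. \<forall>D. let u = (\<lambda>x :: real^'n. D * ckn_profile a b t x) in
        ckn_attains p a b ((1 + (p - 1) * a + b - N) / p) u (gradient u)"
      unfolding C Let_def using ckn_attains_ckn_profile[OF p _ crit] t by simp
    show "\<forall>(u :: real^'n \<Rightarrow> real) g. ckn_attains p a b ((1 + (p - 1) * a + b - N) / p) u g \<longrightarrow>
        (\<exists>t > 0. multiple_of_profile u (ckn_profile a b t))"
      unfolding C using ckn_attains_imp_multiple[OF p \<beta> crit] t by blast
  }
qed

end
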